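(* Let $G_n=\mathrm{GL}(n,\mathbb{C})$. For sequences of integers $\underline{\lambda}=(\lambda_1\ge\cdots\ge\lambda_{n+1}\ge0)$ and $\underline{\mu}=(\mu_1\ge\cdots\ge\mu_{n+1}\ge0)$, let $\Psi_{\underline{\lambda}}$, $\Psi_{\underline{\mu}}$ be the corresponding irreducible highest weight representations of $G_{n+1}$. Suppose $l(\underline{\lambda})\le n$ and $l(\underline{\mu})\le n$, and let $$\Psi_{\underline{\lambda}}\otimes\Psi_{\underline{\mu}}=\sum_{\underline{\nu}}C_{\underline{\lambda}\,\underline{\mu}}^{\underline{\nu}}\,\Psi_{\underline{\nu}}$$ be the decomposition of the tensor product into irreducible representations of $G_{n+1}$. Assume that $l(\underline{\nu})\le n$ whenever $C_{\underline{\lambda}\,\underline{\mu}}^{\underline{\nu}}\ne0$. Then the decomposition $\Psi_{\underline{\lambda}}\otimes\Psi_{\underline{\mu}}=\sum_{\underline{\nu}}C_{\underline{\lambda}\,\underline{\mu}}^{\underline{\nu}}\,\Psi_{\underline{\nu}}$ of the tensor product of $\Psi_{\underline{\lambda}}$ and $\Psi_{\underline{\mu}}$ as representations of $G_{n+1}$ is the same as the decomposition when $\Psi_{\underline{\lambda}}$ and $\Psi_{\underline{\mu}}$ are treated as representations of $G_n$; that is, with the same coefficients $C_{\underline{\lambda}\,\underline{\mu}}^{\underline{\nu}}$ and the same $\underline{\nu}$ (with the last zero dropped), the identity $\Psi_{\underline{\lambda}}\otimes\Psi_{\underline{\mu}}=\sum_{\underline{\nu}}C_{\underline{\lambda}\,\underline{\mu}}^{\underline{\nu}}\,\Psi_{\underline{\nu}}$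 holds for the irreducible representations of $G_n$ with these highest weights.
   Context: For a sequence of integers $\underline{\lambda}=(\lambda_1\ge\lambda_2\ge\cdots\ge0)$ the length $l(\underline{\lambda})$ is the largest $s$ with $\lambda_s\ne0$ (and $0$ if all entries vanish). If $l(\underline{\lambda})\le n$, then "$\Psi_{\underline{\lambda}}$ treated as a representation of $G_n$" means the irreducible representation of $\mathrm{GL}(n,\mathbb{C})$ with highest weight $(\lambda_1,\dots,\lambda_n)$ (not the restriction of the representation of $\mathrm{GL}(n+1,\mathbb{C})$). *)

theory Defs
  imports "HOL-Algebra.Group" "Jordan_Normal_Form.VS_Connect"
begin

abbreviation GL :: "nat \<Rightarrow> complex mat monoid" where
  "GL m \<equiv> units_of (ring_mat TYPE(complex) m ())"

text \<open>The coordinate ring of the affine variety \<open>GL m\<close>, as functions: it is generated by the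
  constants, the matrix entries and \<open>1 / det\<close>. Values outside \<open>GL m\<close> are irrelevant.\<close>

inductive_set regular_functions :: "nat \<Rightarrow> (complex mat \<Rightarrow> complex) set" for m :: nat where
  const: "(\<lambda>g. c) \<in> regular_functions m"
| entry: "i < m \<Longrightarrow> j < m \<Longrightarrow> (\<lambda>g. g $$ (i, j)) \<in> regular_functions m"
| inv_det: "(\<lambda>g. inverse (Determinant.det g)) \<in> regular_functions m"
| add: "f \<in> regular_functions m \<Longrightarrow> h \<in> regular_functions m \<Longrightarrow>
    (\<lambda>g. f g + h g) \<in> regular_functions m"
| mult: "f \<in> regular_functions m \<Longrightarrow> h \<in> regular_functions m \<Longrightarrow>
    (\<lambda>g. f g * h g) \<in> regular_functions m"

text \<open>A finite-dimensional representation is given in coordinates: the space is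
  \<open>carrier_vec (rdim R)\<close> and \<open>g\<close> acts by the matrix \<open>act R g\<close>. As usual for
  \<open>GL(m, \<complex>)\<close>, representations are rational (algebraic), i.e. their matrix coefficients are
  regular functions on the group; this excludes twists by wild automorphisms of \<open>\<complex>\<close>.\<close>

record rep =
  rdim :: nat
  act :: "complex mat \<Rightarrow> complex mat"

definition is_rep :: "nat \<Rightarrow> rep \<Rightarrow> bool" where
  "is_rep m R \<longleftrightarrow>
     act R \<in> hom (GL m) (GL (rdim R)) \<and>
     (\<forall>i < rdim R. \<forall>j < rdim R. \<exists>f \<in> regular_functions m.
        \<forall>g \<in> carrier (GL m). act R g $$ (i, j) = f g)"

definition irreducible_rep :: "nat \<Rightarrow> rep \<Rightarrow> bool" where
  "irreducible_rep m R \<longleftrightarrow>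
     is_rep m R \<and> 0 < rdim R \<and>
     (\<forall>W. subspace class_ring W (module_vec TYPE(complex) (rdim R)) \<longrightarrow>
        (\<forall>g \<in> carrier (GL m). \<forall>w \<in> W. act R g *\<^sub>v w \<in> W) \<longrightarrow>
        W = {0\<^sub>v (rdim R)} \<or> W = carrier_vec (rdim R))"

definition rep_equiv :: "nat \<Rightarrow> rep \<Rightarrow> rep \<Rightarrow> bool" where
  "rep_equiv m R S \<longleftrightarrow>
     rdim R = rdim S \<and>
     (\<exists>P \<in> carrier (GL (rdim R)). \<forall>g \<in> carrier (GL m). P * act R g = act S g * P)"

definition kronecker :: "complex mat \<Rightarrow> complex mat \<Rightarrow> complex mat" where
  "kronecker A B =
     mat (dim_row A * dim_row B) (dim_col A * dim_col B)
       (\<lambda>(i, j). A $$ (i div dim_row B, j div dim_col B) * B $$ (i mod dim_row B, j mod dim_col B))"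

definition tensor_rep :: "rep \<Rightarrow> rep \<Rightarrow> rep" where
  "tensor_rep R S =
     \<lparr> rdim = rdim R * rdim S, act = (\<lambda>g. kronecker (act R g) (act S g)) \<rparr>"

definition direct_sum_rep :: "rep list \<Rightarrow> rep" where
  "direct_sum_rep Rs =
     \<lparr> rdim = sum_list (map rdim Rs), act = (\<lambda>g. diag_block_mat (map (\<lambda>R. act R g) Rs)) \<rparr>"

text \<open>Weights are integer lists; position \<open>i\<close> of the list (counted from 0) is the entry
  usually written with index \<open>i + 1\<close>.\<close>

definition dominant :: "nat \<Rightarrow> int list \<Rightarrow> bool" where
  "dominant m \<nu> \<longleftrightarrow> length \<nu> = m \<and> sorted_wrt (\<ge>) \<nu>"

definition weight_length :: "int list \<Rightarrow> nat" where
  "weight_length \<nu> = Max (insert 0 {s. 1 \<le> s \<and> s \<le> length \<nu> \<and> \<nu> ! (s - 1) \<noteq> 0})"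

text \<open>A highest weight vector of weight \<open>\<nu>\<close>: a nonzero weight vector for the diagonal torus
  that is fixed by the upper unitriangular matrices.\<close>

definition highest_weight_vector :: "nat \<Rightarrow> rep \<Rightarrow> int list \<Rightarrow> complex vec \<Rightarrow> bool" where
  "highest_weight_vector m R \<nu> v \<longleftrightarrow>
     v \<in> carrier_vec (rdim R) \<and> v \<noteq> 0\<^sub>v (rdim R) \<and>
     (\<forall>t \<in> carrier (GL m). diagonal_mat t \<longrightarrow>
        act R t *\<^sub>v v = (\<Prod>i<m. t $$ (i, i) powi (\<nu> ! i)) \<cdot>\<^sub>v v) \<and>
     (\<forall>u \<in> carrier (GL m). upper_triangular u \<longrightarrow> (\<forall>i<m. u $$ (i, i) = 1) \<longrightarrow>
        act R u *\<^sub>v v = v)"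

text \<open>\<open>is_irrep_hw m \<nu> R\<close>: \<open>R\<close> is a model of the irreducible representation of
  \<open>GL(m, \<complex>)\<close> with highest weight \<open>\<nu>\<close>, which is determined up to equivalence.\<close>

definition is_irrep_hw :: "nat \<Rightarrow> int list \<Rightarrow> rep \<Rightarrow> bool" where
  "is_irrep_hw m \<nu> R \<longleftrightarrow>
     dominant m \<nu> \<and> irreducible_rep m R \<and> (\<exists>v. highest_weight_vector m R \<nu> v)"

text \<open>\<open>R\<close> is equivalent to a finite direct sum in which the irreducible representation of
  highest weight \<open>\<nu>\<close> occurs exactly \<open>C \<nu>\<close> times. In particular \<open>C\<close> has finite support and
  vanishes outside the dominant weights of \<open>GL(m, \<complex>)\<close>; negative entries are not excluded.\<close>

definition decomposes_as :: "nat \<Rightarrow> rep \<Rightarrow> (int list \<Rightarrow> nat) \<Rightarrow> bool" where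
  "decomposes_as m R C \<longleftrightarrow>
     (\<exists>Xs :: (int list \<times> rep) list.
        (\<forall>(\<nu>, S) \<in> set Xs. is_irrep_hw m \<nu> S) \<and>
        (\<forall>\<nu>. count_list (map fst Xs) \<nu> = C \<nu>) \<and>
        rep_equiv m R (direct_sum_rep (map snd Xs)))"

end

theory Submission
  imports Defs "Jordan_Normal_Form.Char_Poly" "HOL-Computational_Algebra.Fundamental_Theorem_Algebra"
begin

text \<open>Let \<open>V\<close> be irreducible for \<open>GL(n + 1)\<close> with highest weight vector \<open>v\<close> of weight \<open>\<lambda>\<close>,
  where the last entry of \<open>\<lambda>\<close> is 0, and let \<open>D(t)\<close> be the action of \<open>diag(1, \<dots>, 1, t)\<close>. By density
  of the big cell, \<open>V\<close> is spanned by the vectors \<open>u l v\<close> with \<open>u\<close> in the lower unipotent radical of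
  the parabolic of type \<open>(n, 1)\<close> and \<open>l\<close> in its Levi subgroup. Conjugation by \<open>diag(1, \<dots>, 1, t)\<close>
  contracts \<open>u\<close> to 1 as \<open>t\<close> tends to 0, so \<open>D(t)\<close> converges to a projection commuting with
  \<open>GL(n)\<close>; its image is irreducible with highest weight \<open>\<lambda>\<close>, the last zero dropped. Limits are
  compatible with tensor products, direct sums and equivalences, so passing to the image of
  \<open>lim D(t)\<close> turns the given decomposition for \<open>GL(n + 1)\<close> into the required one for \<open>GL(n)\<close>.
  The same projection, with \<open>D(t)\<close> rescaled when the last entry of \<open>\<lambda>\<close> is not 0, shows by induction
  on \<open>n\<close> that an irreducible representation is determined by its highest weight.\<close>

section \<open>Linear algebra\<close>

text \<open>The entries of D(t) are Laurent polynomials in t, so convergence at 0 has to be earned.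
  Moving diag(1, ..., 1, t) past a lower unipotent element only produces nonnegative powers of t, so
  the last entry k of the highest weight is the smallest exponent that occurs. A summand whose
  highest weight ends in k behaves like t^k times a convergent family: for k > 0 it would vanish in
  the limit, for k < 0 it would diverge. The assumption on the weights of the decomposition forces k
  = 0 in every summand, so each summand leaves exactly one irreducible representation of GL(n) and
  multiplicities survive. A highest weight only names a representation up to equivalence, and the
  models for GL(n) in the theorem are arbitrary. Uniqueness is what allows them to be exchanged for
  the images of the limit projections. Since representations are matrices on coordinate spaces, the
  image of a projection p needs coordinates. They come from a factorization p = E * F with F * E =
  1; a matrix M that commutes with p then acts on the image by F * M * E.\<close>

lemma carrier_GL_iff: "g \<in> carrier (GL m) \<longleftrightarrow> g \<in> carrier_mat m m \<and> det g \<noteq> 0"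
proof
  assume "g \<in> carrier (GL m)"
  then have U: "g \<in> Units (ring_mat TYPE(complex) m ())" by (simp add: units_of_def)
  then have "g \<in> carrier_mat m m" by (auto simp: Units_def ring_mat_def)
  with unit_imp_det_non_zero[OF U] show "g \<in> carrier_mat m m \<and> det g \<noteq> 0" by simp
next
  assume "g \<in> carrier_mat m m \<and> det g \<noteq> 0"
  then show "g \<in> carrier (GL m)" by (auto simp: units_of_def intro: det_non_zero_imp_unit)
qed

lemma mult_GL: "g * h = g \<otimes>\<^bsub>GL m\<^esub> h"
  by (simp add: units_of_def ring_mat_def)

lemma carrier_GLI:
  assumes "A \<in> carrier_mat m m" "B \<in> carrier_mat m m" "A * B = 1\<^sub>m m"
  shows "A \<in> carrier (GL m)"
proof -
  have "det A * det B = 1" using assms by (metis det_mult det_one)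
  then show ?thesis using assms(1) by (auto simp: carrier_GL_iff)
qed

lemma GL_inverse:
  assumes "g \<in> carrier (GL m)"
  obtains h where "h \<in> carrier (GL m)" "g * h = 1\<^sub>m m" "h * g = 1\<^sub>m m"
proof -
  have "g \<in> Units (ring_mat TYPE(complex) m ())" using assms by (simp add: units_of_def)
  then obtain h where h: "h \<in> carrier_mat m m" "g * h = 1\<^sub>m m" "h * g = 1\<^sub>m m"
    by (auto simp: Units_def ring_mat_def)
  with carrier_GLI[of h m g] assms have "h \<in> carrier (GL m)" by (simp add: carrier_GL_iff)
  with that h show ?thesis by blast
qed

lemma mult_in_GL: "g \<in> carrier (GL m) \<Longrightarrow> h \<in> carrier (GL m) \<Longrightarrow> g * h \<in> carrier (GL m)"
  by (auto simp: carrier_GL_iff det_mult)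

lemma one_in_GL: "1\<^sub>m m \<in> carrier (GL m)"
  by (simp add: carrier_GL_iff)

abbreviation is_subspace :: "nat \<Rightarrow> complex vec set \<Rightarrow> bool" where
  "is_subspace N W \<equiv> VectorSpace.subspace class_ring W (module_vec TYPE(complex) N)"

lemma subspace_vec_iff:
  "is_subspace N W \<longleftrightarrow>
     W \<subseteq> carrier_vec N \<and> 0\<^sub>v N \<in> W \<and> (\<forall>x\<in>W. \<forall>y\<in>W. x + y \<in> W) \<and> (\<forall>c. \<forall>x\<in>W. c \<cdot>\<^sub>v x \<in> W)"
  unfolding VectorSpace.subspace_def submodule_def
  by (auto simp: vec_vs vec_module module_vec_simps class_ring_simps)

lemma smult_mat_mult_vec:
  assumes "M \<in> carrier_mat nr nc" "v \<in> carrier_vec nc"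
  shows "(c \<cdot>\<^sub>m M) *\<^sub>v v = c \<cdot>\<^sub>v (M *\<^sub>v v)"
  using assms by (intro eq_vecI) (auto simp: smult_scalar_prod_distrib[of _ nc])

text \<open>If N < k, zero rows below \<open>E\<close> and zero columns beside \<open>F\<close> make
  both k by k without changing \<open>F * E\<close>. A one-sided inverse of a square matrix is
  two-sided, yet the last row of \<open>E' * F'\<close> is zero.\<close>

lemma left_inverse_dim_le:
  fixes E F :: "complex mat"
  assumes E: "E \<in> carrier_mat N k" and F: "F \<in> carrier_mat k N" and FE: "F * E = 1\<^sub>m k"
  shows "k \<le> N"
proof (rule ccontr)
  assume "\<not> k \<le> N"
  then have k: "N + (k - N) = k" "N < k" by auto
  define E' F' where "E' = four_block_mat E (0\<^sub>m N 0) (0\<^sub>m (k - N) k) (0\<^sub>m (k - N) 0)"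
    and "F' = four_block_mat F (0\<^sub>m k (k - N)) (0\<^sub>m 0 N) (0\<^sub>m 0 (k - N))"
  have E': "E' \<in> carrier_mat k k" and F': "F' \<in> carrier_mat k k"
    using E F k by (auto simp: E'_def F'_def)
  have "F' * E' = four_block_mat (F * E + 0\<^sub>m k (k - N) * 0\<^sub>m (k - N) k)
      (F * 0\<^sub>m N 0 + 0\<^sub>m k (k - N) * 0\<^sub>m (k - N) 0) (0\<^sub>m 0 N * E + 0\<^sub>m 0 (k - N) * 0\<^sub>m (k - N) k)
      (0\<^sub>m 0 N * 0\<^sub>m N 0 + 0\<^sub>m 0 (k - N) * 0\<^sub>m (k - N) 0)"
    unfolding E'_def F'_def by (rule mult_four_block_mat) (use E F in auto)
  also have "\<dots> = 1\<^sub>m k"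
    using E F by (intro eq_matI) (auto simp: FE)
  finally have "E' * F' = 1\<^sub>m k" using mat_mult_left_right_inverse[OF F' E'] by simp
  moreover have "row E' (k - 1) = 0\<^sub>v k"
    using E k by (intro eq_vecI) (auto simp: E'_def)
  then have "(E' * F') $$ (k - 1, k - 1) = 0"
    using E' F' k by (auto simp: scalar_prod_left_zero)
  ultimately show False using k by auto
qed

lemma left_right_inverse_dim_eq:
  fixes A B :: "complex mat"
  assumes "A \<in> carrier_mat N k" "B \<in> carrier_mat k N" "B * A = 1\<^sub>m k" "A * B = 1\<^sub>m N"
  shows "N = k"
  using left_inverse_dim_le[of A N k B] left_inverse_dim_le[of B k N A] assms by auto

text \<open>The columns of \<open>E\<close> form a basis of \<open>W\<close> and \<open>E * F\<close> is a projection onto \<open>W\<close>.\<close>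

lemma subspace_splitting:
  fixes W :: "complex vec set"
  assumes "is_subspace N W"
  obtains k E F where "E \<in> carrier_mat N k" "F \<in> carrier_mat k N" "F * E = 1\<^sub>m k"
    "\<And>x. x \<in> carrier_vec k \<Longrightarrow> E *\<^sub>v x \<in> W" "\<And>w. w \<in> W \<Longrightarrow> E *\<^sub>v (F *\<^sub>v w) = w"
proof -
  have WN: "W \<subseteq> carrier_vec N" and W0: "0\<^sub>v N \<in> W"
    and Wadd: "\<And>x y. x \<in> W \<Longrightarrow> y \<in> W \<Longrightarrow> x + y \<in> W"
    and Wsm: "\<And>c x. x \<in> W \<Longrightarrow> c \<cdot>\<^sub>v x \<in> W"
    using assms by (auto simp: subspace_vec_iff)
  \<comment> \<open>By \<open>left_inverse_dim_le\<close> such k are bounded by N, so there is a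
    largest one. If \<open>E * F\<close> moved some w in W, a further column could be adjoined to
    \<open>E\<close>, contradicting maximality.\<close>
  define P where "P k \<longleftrightarrow> (\<exists>E F. E \<in> carrier_mat N k \<and> F \<in> carrier_mat k N \<and> F * E = 1\<^sub>m k \<and>
    (\<forall>x \<in> carrier_vec k. E *\<^sub>v x \<in> W))" for k
  have bound: "k \<le> N" if "P k" for k
    using that left_inverse_dim_le unfolding P_def by blast
  have "0\<^sub>m N 0 *\<^sub>v x = (0\<^sub>v N :: complex vec)" if "x \<in> carrier_vec 0" for x
    using that by (intro eq_vecI) (auto simp: scalar_prod_def)
  then have "P 0" unfolding P_def
    by (intro exI[of _ "0\<^sub>m N 0"] exI[of _ "0\<^sub>m 0 N"]) (auto simp: W0)
  define k where "k = (GREATEST k. P k)"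
  have Pk: "P k" unfolding k_def by (rule GreatestI_nat[of P 0 N]) (use \<open>P 0\<close> bound in auto)
  have nP: "\<not> P (Suc k)" 
    using Greatest_le_nat[of P "Suc k" N] bound unfolding k_def by fastforce
  from Pk obtain E F where E: "E \<in> carrier_mat N k" and F: "F \<in> carrier_mat k N"
    and FE: "F * E = 1\<^sub>m k" and EW: "\<And>x. x \<in> carrier_vec k \<Longrightarrow> E *\<^sub>v x \<in> W"
    unfolding P_def by auto
  have "E *\<^sub>v (F *\<^sub>v w) = w" if w: "w \<in> W" for w
  proof (rule ccontr)
    assume ne: "E *\<^sub>v (F *\<^sub>v w) \<noteq> w"
    have wN: "w \<in> carrier_vec N" using w WN by auto
    \<comment> \<open>The part of w missed by \<open>E * F\<close>: a nonzero vector of W that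
      \<open>F\<close> kills. It becomes the new column.\<close>
    define e where "e = w + (-1) \<cdot>\<^sub>v (E *\<^sub>v (F *\<^sub>v w))"
    have eN: "e \<in> carrier_vec N" using E F wN by (auto simp: e_def)
    have eW: "e \<in> W" unfolding e_def using E F wN w by (intro Wadd Wsm EW) auto
    have "\<exists>i<N. e $ i \<noteq> 0"
    proof (rule ccontr)
      assume "\<not> (\<exists>i<N. e $ i \<noteq> 0)"
      then have "E *\<^sub>v (F *\<^sub>v w) = w" using wN E F
        by (intro eq_vecI) (auto simp: e_def)
      with ne show False by simp
    qed
    then obtain i where i: "i < N" "e $ i \<noteq> 0" by auto
    have Fe: "F *\<^sub>v e = 0\<^sub>v k"
    proof -
      have "F *\<^sub>v e = F *\<^sub>v w + (-1) \<cdot>\<^sub>v (F *\<^sub>v (E *\<^sub>v (F *\<^sub>v w)))"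
        unfolding e_def using E F wN
        by (simp add: mult_add_distrib_mat_vec[of F k N] mult_mat_vec[of F k N])
      also have "F *\<^sub>v (E *\<^sub>v (F *\<^sub>v w)) = (F * E) *\<^sub>v (F *\<^sub>v w)"
        using E F wN by (subst assoc_mult_mat_vec[of F k N E k]) auto
      also have "\<dots> = F *\<^sub>v w" using E F wN by (simp add: FE)
      also have "F *\<^sub>v w + (-1) \<cdot>\<^sub>v (F *\<^sub>v w) = 0\<^sub>v k"
        using F by (intro eq_vecI) auto
      finally show ?thesis .
    qed
    define ee where "ee = mat N 1 (\<lambda>(j,_). e $ j)"
    \<comment> \<open>The new row must be 1 on e and 0 on the columns of \<open>E\<close>. The
      rescaled i-th coordinate \<open>f\<close> achieves the first; subtracting
      \<open>f * E * F\<close> achieves the second and keeps the first, because \<open>F\<close>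
      kills e.\<close>
    define f where "f = mat 1 N (\<lambda>(_,j). if j = i then 1 / e $ i else 0)"
    define f' where "f' = f + (-1) \<cdot>\<^sub>m (f * E * F)"
    have ee: "ee \<in> carrier_mat N 1" and f: "f \<in> carrier_mat 1 N" and f': "f' \<in> carrier_mat 1 N"
      using E F by (auto simp: ee_def f_def f'_def)
    have Fee: "F * ee = 0\<^sub>m k 1"
    proof (intro eq_matI)
      fix a b assume ab: "a < dim_row (0\<^sub>m k 1 :: complex mat)" "b < dim_col (0\<^sub>m k 1 :: complex mat)"
      have "col ee b = e" using ab eN by (intro eq_vecI) (auto simp: ee_def)
      then have "(F * ee) $$ (a, b) = (F *\<^sub>v e) $ a" using ab F ee by auto
      then show "(F * ee) $$ (a, b) = 0\<^sub>m k 1 $$ (a, b)" using ab by (simp add: Fe)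
    qed (use F ee in auto)
    have fee: "f * ee = 1\<^sub>m 1"
    proof (intro eq_matI)
      fix a b :: nat assume ab: "a < dim_row (1\<^sub>m 1 :: complex mat)" "b < dim_col (1\<^sub>m 1 :: complex mat)"
      have "(f * ee) $$ (a, b) = (\<Sum>j = 0..<N. (if j = i then 1 / e $ i else 0) * e $ j)"
        using ab f ee by (auto simp: scalar_prod_def f_def ee_def intro!: sum.cong)
      also have "\<dots> = (\<Sum>j = 0..<N. if j = i then 1 else 0)"
        using i by (intro sum.cong) auto
      also have "\<dots> = 1" using i by simp
      finally show "(f * ee) $$ (a, b) = 1\<^sub>m 1 $$ (a, b)" using ab by simp
    qed (use f ee in auto)
    have f'E: "f' * E = 0\<^sub>m 1 k"
    proof -
      have "f' * E = f * E + (-1) \<cdot>\<^sub>m (f * E * F * E)" using f E F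
        unfolding f'_def by (subst add_mult_distrib_mat[of _ 1 N]) (auto simp: mult_smult_assoc_mat[of _ 1 N])
      also have "f * E * F * E = f * E * (F * E)" using f E F
        by (intro assoc_mult_mat[of _ 1 k _ N]) auto
      also have "\<dots> = f * E" using f E by (simp add: FE)
      also have "f * E + (-1) \<cdot>\<^sub>m (f * E) = 0\<^sub>m 1 k" using f E by (intro eq_matI) auto
      finally show ?thesis .
    qed
    have f'ee: "f' * ee = 1\<^sub>m 1"
    proof -
      have "f' * ee = f * ee + (-1) \<cdot>\<^sub>m (f * E * F * ee)" using f E F ee
        unfolding f'_def by (subst add_mult_distrib_mat[of _ 1 N]) (auto simp: mult_smult_assoc_mat[of _ 1 N])
      also have "f * E * F * ee = f * E * (F * ee)" using f E F ee
        by (intro assoc_mult_mat[of _ 1 k _ N]) auto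
      also have "\<dots> = 0\<^sub>m 1 1" using f E by (simp add: Fee)
      finally show ?thesis by (simp add: fee)
    qed
    define E' F' where "E' = four_block_mat E ee (0\<^sub>m 0 k) (0\<^sub>m 0 1)"
      and "F' = four_block_mat F (0\<^sub>m k 0) f' (0\<^sub>m 1 0)"
    have E': "E' \<in> carrier_mat N (Suc k)" and F': "F' \<in> carrier_mat (Suc k) N"
      using E F ee f' by (auto simp: E'_def F'_def)
    have "F' * E' = four_block_mat (F * E + 0\<^sub>m k 0 * 0\<^sub>m 0 k) (F * ee + 0\<^sub>m k 0 * 0\<^sub>m 0 1)
        (f' * E + 0\<^sub>m 1 0 * 0\<^sub>m 0 k) (f' * ee + 0\<^sub>m 1 0 * 0\<^sub>m 0 1)"
      unfolding E'_def F'_def by (rule mult_four_block_mat) (use E F ee f' in auto)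
    also have "\<dots> = 1\<^sub>m (Suc k)"
      by (intro eq_matI) (auto simp: FE Fee f'E f'ee)
    finally have FE': "F' * E' = 1\<^sub>m (Suc k)" .
    have "E' *\<^sub>v x \<in> W" if x: "x \<in> carrier_vec (Suc k)" for x
    proof -
      define a b where "a = vec_first x k" and "b = vec_last x 1"
      have xab: "x = a @\<^sub>v b" and a: "a \<in> carrier_vec k" and b: "b \<in> carrier_vec 1"
        using x vec_first_last_append[of x k 1] by (auto simp: a_def b_def)
      have "E' *\<^sub>v x = (E *\<^sub>v a + ee *\<^sub>v b) @\<^sub>v (0\<^sub>m 0 k *\<^sub>v a + 0\<^sub>m 0 1 *\<^sub>v b)"
        unfolding E'_def xab by (rule four_block_mat_mult_vec) (use E ee a b in auto)
      also have "\<dots> = E *\<^sub>v a + b $ 0 \<cdot>\<^sub>v e"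
        using E ee a b eN by (intro eq_vecI) (auto simp: scalar_prod_def ee_def)
      finally show ?thesis using a eW by (simp add: Wadd Wsm EW)
    qed
    with E' F' FE' have "P (Suc k)" unfolding P_def by blast
    with nP show False by simp
  qed
  with E F FE EW that show ?thesis by blast
qed

text \<open>The matrix 1 - E * F vanishes on W, but not at a vector x outside W, since otherwise x =
  E (F x) would lie in W. A row that is nonzero at x is the required functional.\<close>

lemma proper_subspace_annihilator:
  fixes W :: "complex vec set"
  assumes sub: "is_subspace N W" and ne: "W \<noteq> carrier_vec N"
  obtains a where "a \<in> carrier_vec N" "a \<noteq> 0\<^sub>v N" "\<And>w. w \<in> W \<Longrightarrow> a \<bullet> w = 0"
proof -
  obtain k E F where E: "E \<in> carrier_mat N k" and F: "F \<in> carrier_mat k N"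
    and EW: "\<And>x. x \<in> carrier_vec k \<Longrightarrow> E *\<^sub>v x \<in> W" and W: "\<And>w. w \<in> W \<Longrightarrow> E *\<^sub>v (F *\<^sub>v w) = w"
    using subspace_splitting[OF sub] by metis
  have WN: "W \<subseteq> carrier_vec N" using sub by (simp add: subspace_vec_iff)
  define Q where "Q = 1\<^sub>m N + (-1) \<cdot>\<^sub>m (E * F)"
  have Q: "Q \<in> carrier_mat N N" using E F by (auto simp: Q_def)
  have Qx: "Q *\<^sub>v x = x + (-1) \<cdot>\<^sub>v (E *\<^sub>v (F *\<^sub>v x))" if x: "x \<in> carrier_vec N" for x
  proof -
    have EF: "E * F \<in> carrier_mat N N" using E F by auto
    have "Q *\<^sub>v x = 1\<^sub>m N *\<^sub>v x + ((-1) \<cdot>\<^sub>m (E * F)) *\<^sub>v x"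
      unfolding Q_def using EF x by (intro add_mult_distrib_mat_vec) auto
    also have "((-1) \<cdot>\<^sub>m (E * F)) *\<^sub>v x = (-1) \<cdot>\<^sub>v ((E * F) *\<^sub>v x)"
      using smult_mat_mult_vec[OF EF x] by simp
    also have "(E * F) *\<^sub>v x = E *\<^sub>v (F *\<^sub>v x)" using E F x by (intro assoc_mult_mat_vec) auto
    finally show ?thesis using x by simp
  qed
  from ne WN obtain x where x: "x \<in> carrier_vec N" "x \<notin> W" by auto
  have "Q *\<^sub>v x \<noteq> 0\<^sub>v N"
  proof
    assume 0: "Q *\<^sub>v x = 0\<^sub>v N"
    have "E *\<^sub>v (F *\<^sub>v x) = x"
    proof (intro eq_vecI)
      fix i assume i: "i < dim_vec x"
      have "(Q *\<^sub>v x) $ i = 0" using i x by (simp add: 0)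
      then show "(E *\<^sub>v (F *\<^sub>v x)) $ i = x $ i" using i x(1) E F by (simp add: Qx)
    qed (use E F x in auto)
    moreover have "E *\<^sub>v (F *\<^sub>v x) \<in> W" using F x by (intro EW) auto
    ultimately show False using x by simp
  qed
  then obtain i where i: "i < N" "(Q *\<^sub>v x) $ i \<noteq> 0"
    using Q by (metis carrier_matD(1) dim_mult_mat_vec eq_vecI index_zero_vec)
  show ?thesis
  proof (rule that[of "row Q i"])
    show "row Q i \<in> carrier_vec N" using Q by auto
    show "row Q i \<noteq> 0\<^sub>v N" using i x Q by auto
    fix w assume w: "w \<in> W"
    then have wN: "w \<in> carrier_vec N" using WN by auto
    have "row Q i \<bullet> w = (Q *\<^sub>v w) $ i" using i Q by auto
    also have "\<dots> = 0" using wN i E F by (simp add: Qx W w)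
    finally show "row Q i \<bullet> w = 0" .
  qed
qed

section \<open>Regular functions and the big cell\<close>

definition emb :: "complex mat \<Rightarrow> complex \<Rightarrow> complex mat" where
  "emb A d = four_block_mat A (0\<^sub>m (dim_row A) 1) (0\<^sub>m 1 (dim_col A)) (mat 1 1 (\<lambda>_. d))"

definition lo :: "nat \<Rightarrow> complex mat \<Rightarrow> complex mat" where
  "lo n y = four_block_mat (1\<^sub>m n) (0\<^sub>m n 1) y (1\<^sub>m 1)"

definition up :: "nat \<Rightarrow> complex mat \<Rightarrow> complex mat" where
  "up n x = four_block_mat (1\<^sub>m n) x (0\<^sub>m 1 n) (1\<^sub>m 1)"

lemma emb_carrier: "A \<in> carrier_mat n n \<Longrightarrow> emb A d \<in> carrier_mat (Suc n) (Suc n)"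
  by (auto simp: emb_def)

lemma lo_carrier: "lo n y \<in> carrier_mat (Suc n) (Suc n)"
  by (auto simp: lo_def)

lemma up_carrier: "up n x \<in> carrier_mat (Suc n) (Suc n)"
  by (auto simp: up_def)

lemma det_emb: 
  assumes "A \<in> carrier_mat n n" shows "det (emb A d) = det A * d"
proof -
  have "det (emb A d) = det A * det (mat 1 1 (\<lambda>_. d))" unfolding emb_def using assms
    by (intro det_four_block_mat_lower_left_zero[of _ n _ 1]) auto
  also have "det (mat 1 1 (\<lambda>_. d)) = d" by (subst det_single) auto
  finally show ?thesis .
qed

lemma det_lo: "y \<in> carrier_mat 1 n \<Longrightarrow> det (lo n y) = 1"
  unfolding lo_def by (subst det_four_block_mat_upper_right_zero[of _ n _ 1]) auto

lemma det_up: "x \<in> carrier_mat n 1 \<Longrightarrow> det (up n x) = 1"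
  unfolding up_def by (subst det_four_block_mat_lower_left_zero[of _ n _ 1]) auto

lemma emb_GL: "A \<in> carrier (GL n) \<Longrightarrow> d \<noteq> 0 \<Longrightarrow> emb A d \<in> carrier (GL (Suc n))"
  by (auto simp: carrier_GL_iff emb_carrier det_emb)

lemma emb_one_GL: "d \<noteq> 0 \<Longrightarrow> emb (1\<^sub>m n) d \<in> carrier (GL (Suc n))"
  by (simp add: emb_GL one_in_GL)

lemma lo_GL: "y \<in> carrier_mat 1 n \<Longrightarrow> lo n y \<in> carrier (GL (Suc n))"
  by (auto simp: carrier_GL_iff lo_carrier det_lo)

lemma up_GL: "x \<in> carrier_mat n 1 \<Longrightarrow> up n x \<in> carrier (GL (Suc n))"
  by (auto simp: carrier_GL_iff up_carrier det_up)

lemma emb_mult: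
  assumes A: "A \<in> carrier_mat n n" and B: "B \<in> carrier_mat n n"
  shows "emb A a * emb B b = emb (A * B) (a * b)"
proof -
  have "emb A a * emb B b = four_block_mat (A * B + 0\<^sub>m n 1 * 0\<^sub>m 1 n)
      (A * 0\<^sub>m n 1 + 0\<^sub>m n 1 * mat 1 1 (\<lambda>_. b)) (0\<^sub>m 1 n * B + mat 1 1 (\<lambda>_. a) * 0\<^sub>m 1 n)
      (0\<^sub>m 1 n * 0\<^sub>m n 1 + mat 1 1 (\<lambda>_. a) * mat 1 1 (\<lambda>_. b))"
    using A B unfolding emb_def by (subst mult_four_block_mat[of _ n n _ 1 _ 1 _ _ n _ 1]) auto
  also have "\<dots> = emb (A * B) (a * b)"
    using A B by (intro eq_matI) (auto simp: emb_def scalar_prod_def)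
  finally show ?thesis .
qed

lemma emb_one_one: "emb (1\<^sub>m n) 1 = 1\<^sub>m (Suc n)"
  by (intro eq_matI) (auto simp: emb_def)

lemma emb_one_commute:
  "A \<in> carrier_mat n n \<Longrightarrow> emb (1\<^sub>m n) t * emb A d = emb A d * emb (1\<^sub>m n) t"
  by (simp add: emb_mult[of _ n] mult.commute)

text \<open>The source of all contraction arguments: conjugation by diag(1, ..., 1, t) multiplies
  the lower unipotent radical by t, and so shrinks it to 1 as t tends to 0.\<close>

lemma emb_one_lo:
  assumes y: "y \<in> carrier_mat 1 n"
  shows "emb (1\<^sub>m n) t * lo n y = lo n (t \<cdot>\<^sub>m y) * emb (1\<^sub>m n) t"
proof -
  have l: "emb (1\<^sub>m n) t * lo n y = four_block_mat (1\<^sub>m n * 1\<^sub>m n + 0\<^sub>m n 1 * y)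
      (1\<^sub>m n * 0\<^sub>m n 1 + 0\<^sub>m n 1 * 1\<^sub>m 1) (0\<^sub>m 1 n * 1\<^sub>m n + mat 1 1 (\<lambda>_. t) * y)
      (0\<^sub>m 1 n * 0\<^sub>m n 1 + mat 1 1 (\<lambda>_. t) * 1\<^sub>m 1)"
    using y unfolding emb_def lo_def by (subst mult_four_block_mat[of _ n n _ 1 _ 1 _ _ n _ 1]) auto
  have r: "lo n (t \<cdot>\<^sub>m y) * emb (1\<^sub>m n) t = four_block_mat (1\<^sub>m n * 1\<^sub>m n + 0\<^sub>m n 1 * 0\<^sub>m 1 n)
      (1\<^sub>m n * 0\<^sub>m n 1 + 0\<^sub>m n 1 * mat 1 1 (\<lambda>_. t)) ((t \<cdot>\<^sub>m y) * 1\<^sub>m n + 1\<^sub>m 1 * 0\<^sub>m 1 n)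
      ((t \<cdot>\<^sub>m y) * 0\<^sub>m n 1 + 1\<^sub>m 1 * mat 1 1 (\<lambda>_. t))"
    using y unfolding emb_def lo_def by (subst mult_four_block_mat[of _ n n _ 1 _ 1 _ _ n _ 1]) auto
  have "mat 1 1 (\<lambda>_. t) * y = t \<cdot>\<^sub>m y"
    using y by (intro eq_matI) (auto simp: scalar_prod_def)
  then show ?thesis unfolding l r using y by (intro cong_four_block_mat) auto
qed

text \<open>On the upper radical the same conjugation multiplies by 1/t. Placing t on the left-hand
  side avoids the division.\<close>

lemma emb_one_up:
  assumes x: "x \<in> carrier_mat n 1"
  shows "emb (1\<^sub>m n) t * up n (t \<cdot>\<^sub>m x) = up n x * emb (1\<^sub>m n) t"
proof -
  have l: "emb (1\<^sub>m n) t * up n (t \<cdot>\<^sub>m x) = four_block_mat (1\<^sub>m n * 1\<^sub>m n + 0\<^sub>m n 1 * 0\<^sub>m 1 n)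
      (1\<^sub>m n * (t \<cdot>\<^sub>m x) + 0\<^sub>m n 1 * 1\<^sub>m 1) (0\<^sub>m 1 n * 1\<^sub>m n + mat 1 1 (\<lambda>_. t) * 0\<^sub>m 1 n)
      (0\<^sub>m 1 n * (t \<cdot>\<^sub>m x) + mat 1 1 (\<lambda>_. t) * 1\<^sub>m 1)"
    using x unfolding emb_def up_def by (subst mult_four_block_mat[of _ n n _ 1 _ 1 _ _ n _ 1]) auto
  have r: "up n x * emb (1\<^sub>m n) t = four_block_mat (1\<^sub>m n * 1\<^sub>m n + x * 0\<^sub>m 1 n)
      (1\<^sub>m n * 0\<^sub>m n 1 + x * mat 1 1 (\<lambda>_. t)) (0\<^sub>m 1 n * 1\<^sub>m n + 1\<^sub>m 1 * 0\<^sub>m 1 n)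
      (0\<^sub>m 1 n * 0\<^sub>m n 1 + 1\<^sub>m 1 * mat 1 1 (\<lambda>_. t))"
    using x unfolding emb_def up_def by (subst mult_four_block_mat[of _ n n _ 1 _ 1 _ _ n _ 1]) auto
  have "x * mat 1 1 (\<lambda>_. t) = t \<cdot>\<^sub>m x"
    using x by (intro eq_matI) (auto simp: scalar_prod_def)
  then show ?thesis unfolding l r using x by (intro cong_four_block_mat) auto
qed

text \<open>Block elimination with the leading n by n block A as pivot: for g with blocks A, b, c
  and corner entry, x is the inverse of A times b, y is c times that inverse, and d is the Schur
  complement. It is nonzero because det g = det A * d.\<close>

lemma big_cell_decomposition:
  assumes g: "g \<in> carrier (GL (Suc n))" and minor: "det (mat n n (\<lambda>ij. g $$ ij)) \<noteq> 0"
  obtains y A d x where "y \<in> carrier_mat 1 n" "A \<in> carrier (GL n)" "d \<noteq> 0" "x \<in> carrier_mat n 1"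
    "g = lo n y * (emb A d * up n x)"
proof -
  define A where "A = mat n n (\<lambda>ij. g $$ ij)"
  define b where "b = mat n 1 (\<lambda>(i, _). g $$ (i, n))"
  define c where "c = mat 1 n (\<lambda>(_, j). g $$ (n, j))"
  have AG: "A \<in> carrier (GL n)" using minor by (simp add: A_def carrier_GL_iff)
  then have A: "A \<in> carrier_mat n n" by (simp add: carrier_GL_iff)
  obtain A' where A'G: "A' \<in> carrier (GL n)" and AA': "A * A' = 1\<^sub>m n" "A' * A = 1\<^sub>m n"
    using GL_inverse[OF AG] by blast
  then have A': "A' \<in> carrier_mat n n" by (simp add: carrier_GL_iff)
  have b: "b \<in> carrier_mat n 1" and c: "c \<in> carrier_mat 1 n" by (auto simp: b_def c_def)
  define x y d where "x = A' * b" and "y = c * A'" and "d = g $$ (n, n) - (c * A' * b) $$ (0, 0)"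
  have x: "x \<in> carrier_mat n 1" and y: "y \<in> carrier_mat 1 n" using A' b c by (auto simp: x_def y_def)
  have e1: "emb A d * up n x = four_block_mat (A * 1\<^sub>m n + 0\<^sub>m n 1 * 0\<^sub>m 1 n)
      (A * x + 0\<^sub>m n 1 * 1\<^sub>m 1) (0\<^sub>m 1 n * 1\<^sub>m n + mat 1 1 (\<lambda>_. d) * 0\<^sub>m 1 n)
      (0\<^sub>m 1 n * x + mat 1 1 (\<lambda>_. d) * 1\<^sub>m 1)"
    using x A unfolding emb_def up_def by (subst mult_four_block_mat[of _ n n _ 1 _ 1 _ _ n _ 1]) auto
  have "A * x = A * A' * b" using A A' b by (simp add: x_def assoc_mult_mat[of A n n])
  then have Ax: "A * x = b" using b by (simp add: AA')
  have "y * A = c * (A' * A)" using A A' c by (simp add: y_def)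
  then have yA: "y * A = c" using c by (simp add: AA')
  have e2: "emb A d * up n x = four_block_mat A b (0\<^sub>m 1 n) (mat 1 1 (\<lambda>_. d))"
    unfolding e1 Ax using A b x by (intro cong_four_block_mat) auto
  have "lo n y * (emb A d * up n x) = four_block_mat (1\<^sub>m n * A + 0\<^sub>m n 1 * 0\<^sub>m 1 n)
      (1\<^sub>m n * b + 0\<^sub>m n 1 * mat 1 1 (\<lambda>_. d)) (y * A + 1\<^sub>m 1 * 0\<^sub>m 1 n)
      (y * b + 1\<^sub>m 1 * mat 1 1 (\<lambda>_. d))"
    unfolding e2 lo_def using A b y by (subst mult_four_block_mat[of _ n n _ 1 _ 1 _ _ n _ 1]) auto
  also have "\<dots> = four_block_mat A b c (c * A' * b + mat 1 1 (\<lambda>_. d))"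
    unfolding yA using A b c by (intro cong_four_block_mat) (auto simp: y_def)
  also have "c * A' * b + mat 1 1 (\<lambda>_. d) = mat 1 1 (\<lambda>_. g $$ (n, n))"
    using A' b c by (intro eq_matI) (auto simp: d_def simp del: index_mult_mat(1))
  also have "four_block_mat A b c (mat 1 1 (\<lambda>_. g $$ (n, n))) = g"
    using g by (intro eq_matI) (auto simp: A_def b_def c_def carrier_GL_iff less_Suc_eq)
  finally have eq: "g = lo n y * (emb A d * up n x)" by simp
  have "det g = det A * d"
    unfolding eq using A x y 
    by (simp add: det_mult[of _ "Suc n"] lo_carrier emb_carrier[of _ n] up_carrier
        det_lo det_up det_emb[of _ n] mult_carrier_mat[of _ "Suc n" "Suc n"])
  then have "d \<noteq> 0" using g by (auto simp: carrier_GL_iff)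
  with that AG x y eq show ?thesis by blast
qed

section \<open>Continuity of regular functions and density of the big cell\<close>

lemma det_tendsto:
  fixes X :: "'t \<Rightarrow> complex mat"
  assumes X: "\<And>t. X t \<in> carrier_mat m m" and L: "L \<in> carrier_mat m m"
    and lim: "\<And>i j. i < m \<Longrightarrow> j < m \<Longrightarrow> ((\<lambda>t. X t $$ (i, j)) \<longlongrightarrow> L $$ (i, j)) F"
  shows "((\<lambda>t. det (X t)) \<longlongrightarrow> det L) F"
proof -
  have "((\<lambda>t. \<Sum>p | p permutes {0..<m}. signof p * (\<Prod>i = 0..<m. X t $$ (i, p i))) \<longlongrightarrow>
      (\<Sum>p | p permutes {0..<m}. signof p * (\<Prod>i = 0..<m. L $$ (i, p i)))) F"
    by (intro tendsto_sum tendsto_mult tendsto_const tendsto_prod lim) (auto dest: permutes_in_image)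
  then show ?thesis by (simp add: det_def'[OF X] det_def'[OF L])
qed

lemma regular_functions_tendsto:
  fixes X :: "'t \<Rightarrow> complex mat"
  assumes f: "f \<in> regular_functions m"
    and X: "\<And>t. X t \<in> carrier_mat m m" and L: "L \<in> carrier (GL m)"
    and lim: "\<And>i j. i < m \<Longrightarrow> j < m \<Longrightarrow> ((\<lambda>t. X t $$ (i, j)) \<longlongrightarrow> L $$ (i, j)) F"
  shows "((\<lambda>t. f (X t)) \<longlongrightarrow> f L) F"
  using f
proof induction
  case inv_det
  have "((\<lambda>t. det (X t)) \<longlongrightarrow> det L) F" using L X by (intro det_tendsto lim) (auto simp: carrier_GL_iff)
  then show ?case using L by (intro tendsto_inverse) (auto simp: carrier_GL_iff)
qed (auto intro!: tendsto_intros lim)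

text \<open>Matrix coefficients of a representation are prescribed only on the group, whereas
  \<open>regular_functions\<close> consists of functions of all matrices. This is the closure of the
  latter under equality on \<open>GL m\<close>.\<close>

definition regular_on :: "nat \<Rightarrow> (complex mat \<Rightarrow> complex) \<Rightarrow> bool" where
  "regular_on m f \<longleftrightarrow> (\<exists>h \<in> regular_functions m. \<forall>g \<in> carrier (GL m). f g = h g)"

lemma regular_on_const: "regular_on m (\<lambda>g. c)"
  by (auto simp: regular_on_def intro: regular_functions.const)

lemma regular_on_add:
  "regular_on m f \<Longrightarrow> regular_on m h \<Longrightarrow> regular_on m (\<lambda>g. f g + h g)"
  unfolding regular_on_def using regular_functions.add by fastforce

lemma regular_on_mult:
  "regular_on m f \<Longrightarrow> regular_on m h \<Longrightarrow> regular_on m (\<lambda>g. f g * h g)"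
  unfolding regular_on_def using regular_functions.mult by fastforce

lemma regular_on_sum:
  "(\<And>i. i \<in> I \<Longrightarrow> regular_on m (f i)) \<Longrightarrow> regular_on m (\<lambda>g. \<Sum>i\<in>I. f i g)"
  by (induction I rule: infinite_finite_induct) (auto intro: regular_on_const regular_on_add)

lemma regular_on_diff:
  assumes "regular_on m f" "regular_on m h" 
  shows "regular_on m (\<lambda>g. f g - h g)"
  using regular_on_add[OF assms(1) regular_on_mult[OF regular_on_const[of m "-1"] assms(2)]] by simp

lemma regular_on_cong:
  assumes "\<And>g. g \<in> carrier (GL m) \<Longrightarrow> f g = h g" 
  shows "regular_on m f \<longleftrightarrow> regular_on m h"
  using assms by (simp add: regular_on_def cong: bex_cong)

text \<open>Restriction to GL(n) inside GL(n + 1) stays algebraic, since det (emb g 1) = det g turns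
  1/det into 1/det. This makes the compressed representations rational.\<close>

lemma regular_on_emb:
  assumes "regular_on (Suc n) f"
  shows "regular_on n (\<lambda>g. f (emb g 1))"
proof -
  obtain h where h: "h \<in> regular_functions (Suc n)" and fh: "\<And>g. g \<in> carrier (GL (Suc n)) \<Longrightarrow> f g = h g"
    using assms by (auto simp: regular_on_def)
  from h have "regular_on n (\<lambda>g. h (emb g 1))"
  proof induction
    case (entry i j)
    show ?case
    proof (cases "i < n \<and> j < n")
      case True
      then have "regular_on n (\<lambda>g. g $$ (i, j))" 
        by (auto simp: regular_on_def intro: regular_functions.entry)
      then show ?thesis
        using True by (subst regular_on_cong[of _ _ "\<lambda>g. g $$ (i, j)"]) (auto simp: carrier_GL_iff emb_def)
    next
      case False
      then show ?thesis using entry regular_on_const[of n "if i = j then 1 else 0"]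
        by (subst regular_on_cong[of _ _ "\<lambda>g. if i = j then 1 else 0"])
          (auto simp: carrier_GL_iff emb_def less_Suc_eq)
    qed
  next
    case inv_det
    have "regular_on n (\<lambda>g. inverse (det g))" 
      by (auto simp: regular_on_def intro: regular_functions.inv_det)
    then show ?case by (subst regular_on_cong[of _ _ "\<lambda>g. inverse (det g)"]) 
        (auto simp: carrier_GL_iff det_emb)
  qed (auto intro: regular_on_const regular_on_add regular_on_mult)
  then show ?thesis by (subst regular_on_cong[of _ _ "\<lambda>g. h (emb g 1)"]) (auto intro!: fh emb_GL)
qed

text \<open>The matrices \<open>X t\<close> may be singular for some t. As det L is nonzero they are
  eventually invertible, and there f agrees with a regular function.\<close>

lemma regular_on_tendsto:
  fixes X :: "'t \<Rightarrow> complex mat"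
  assumes f: "regular_on m f" and X: "\<And>t. X t \<in> carrier_mat m m" and L: "L \<in> carrier (GL m)"
    and lim: "\<And>i j. i < m \<Longrightarrow> j < m \<Longrightarrow> ((\<lambda>t. X t $$ (i, j)) \<longlongrightarrow> L $$ (i, j)) F"
  shows "((\<lambda>t. f (X t)) \<longlongrightarrow> f L) F"
proof -
  obtain h where h: "h \<in> regular_functions m" and fh: "\<And>g. g \<in> carrier (GL m) \<Longrightarrow> f g = h g"
    using f by (auto simp: regular_on_def)
  have "((\<lambda>t. det (X t)) \<longlongrightarrow> det L) F" using L X by (intro det_tendsto lim) (auto simp: carrier_GL_iff)
  then have "eventually (\<lambda>t. det (X t) \<noteq> 0) F"
    using L by (intro tendsto_imp_eventually_ne) (auto simp: carrier_GL_iff)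
  then have ev: "eventually (\<lambda>t. h (X t) = f (X t)) F"
    by eventually_elim (use X fh in \<open>auto simp: carrier_GL_iff\<close>)
  have "((\<lambda>t. h (X t)) \<longlongrightarrow> h L) F" using regular_functions_tendsto[OF h X L lim] by blast
  then show ?thesis using tendsto_cong[OF ev] fh[OF L] by simp
qed

text \<open>The bad values of s are the negatives of the roots of the characteristic polynomial,
  hence finitely many.\<close>

lemma eventually_det_shift_nonzero:
  fixes B :: "complex mat"
  assumes B: "B \<in> carrier_mat m m"
  shows "eventually (\<lambda>s. det (B + s \<cdot>\<^sub>m 1\<^sub>m m) \<noteq> 0) (at 0)"
proof -
  have "char_poly B \<noteq> 0" using degree_monic_char_poly[OF B] by auto
  then have "finite {k. poly (char_poly B) k = 0}" by (rule poly_roots_finite)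
  then have "finite (uminus -` {k. poly (char_poly B) k = 0})" by (intro finite_vimageI) auto
  then have "finite {s. poly (char_poly B) (- s) = 0}" by (simp add: vimage_def)
  moreover have "poly (char_poly B) (- s) = 0 \<longleftrightarrow> det (B + s \<cdot>\<^sub>m 1\<^sub>m m) = 0" for s
    using B by (simp add: eigenvalue_root_char_poly[OF B, symmetric] eigenvalue_det[OF B] char_matrix_def)
  ultimately have fin: "finite {s. det (B + s \<cdot>\<^sub>m 1\<^sub>m m) = 0}" by simp
  \<comment> \<open>The value 0 may itself be a root. The punctured filter ignores it, so only the
    other roots are removed to get an open neighbourhood of 0.\<close>
  then have "open (- ({s. det (B + s \<cdot>\<^sub>m 1\<^sub>m m) = 0} - {0}))"
    by (intro open_Compl finite_imp_closed) auto
  then show ?thesis unfolding eventually_at_topological by (auto intro!: exI)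
qed

text \<open>Density by an explicit path: for small nonzero s both g + s * 1 and its leading n by n
  block are invertible, so g + s * 1 lies in the big cell, and it tends to g as s tends to
  0.\<close>

lemma regular_zero_on_big_cell:
  assumes f: "regular_on (Suc n) f"
    and zero: "\<And>y A d x. y \<in> carrier_mat 1 n \<Longrightarrow> A \<in> carrier (GL n) \<Longrightarrow> d \<noteq> 0 \<Longrightarrow>
      x \<in> carrier_mat n 1 \<Longrightarrow> f (lo n y * (emb A d * up n x)) = 0"
    and g: "g \<in> carrier (GL (Suc n))"
  shows "f g = 0"
proof -
  have gc: "g \<in> carrier_mat (Suc n) (Suc n)" using g by (simp add: carrier_GL_iff)
  define X where "X s = g + s \<cdot>\<^sub>m 1\<^sub>m (Suc n)" for s
  have X: "X s \<in> carrier_mat (Suc n) (Suc n)" for s by (auto simp: X_def)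
  have "((\<lambda>s. X s $$ (i, j)) \<longlongrightarrow> g $$ (i, j)) (at 0)" if "i < Suc n" "j < Suc n" for i j
  proof -
    have "((\<lambda>s. g $$ (i, j) + s * 1\<^sub>m (Suc n) $$ (i, j)) \<longlongrightarrow> g $$ (i, j) + 0 * 1\<^sub>m (Suc n) $$ (i, j)) (at 0)"
      by (intro tendsto_intros)
    then show ?thesis using that gc by (simp add: X_def)
  qed
  then have lim: "((\<lambda>s. f (X s)) \<longlongrightarrow> f g) (at 0)"
    by (intro regular_on_tendsto[OF f X g]) auto
  define B where "B = mat n n (\<lambda>ij. g $$ ij)"
  have "eventually (\<lambda>s. det (X s) \<noteq> 0) (at 0)"
    unfolding X_def by (rule eventually_det_shift_nonzero[OF gc])
  moreover have "eventually (\<lambda>s. det (B + s \<cdot>\<^sub>m 1\<^sub>m n) \<noteq> 0) (at 0)"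
    by (rule eventually_det_shift_nonzero) (auto simp: B_def)
  ultimately have "eventually (\<lambda>s. f (X s) = 0) (at 0)"
  proof eventually_elim
    case (elim s)
    have XG: "X s \<in> carrier (GL (Suc n))" using elim X by (simp add: carrier_GL_iff)
    have "mat n n (\<lambda>ij. X s $$ ij) = B + s \<cdot>\<^sub>m 1\<^sub>m n"
      using gc by (intro eq_matI) (auto simp: X_def B_def)
    then have "det (mat n n (\<lambda>ij. X s $$ ij)) \<noteq> 0" using elim by simp
    from big_cell_decomposition[OF XG this] show ?case using zero by metis
  qed
  then have "((\<lambda>s. f (X s)) \<longlongrightarrow> 0) (at 0)" by (simp add: tendsto_eventually)
  with lim show ?thesis using tendsto_unique[of "at (0::complex)"] by auto
qed

text \<open>On the unipotent elements \<open>up n x\<close> the generator 1/det is constantly 1, and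
  the matrix entries are affine in s along the line through x.\<close>

lemma regular_on_up_poly:
  assumes f: "regular_on (Suc n) f" and x: "x \<in> carrier_mat n 1"
  shows "\<exists>p. \<forall>s. f (up n (s \<cdot>\<^sub>m x)) = poly p s"
proof -
  obtain h where h: "h \<in> regular_functions (Suc n)" and fh: "\<And>g. g \<in> carrier (GL (Suc n)) \<Longrightarrow> f g = h g"
    using f by (auto simp: regular_on_def)
  from h have "\<exists>p. \<forall>s. h (up n (s \<cdot>\<^sub>m x)) = poly p s"
  proof induction
    case (const c)
    then show ?case by (intro exI[of _ "[:c:]"]) simp
  next
    case (entry i j)
    then show ?case using x
      by (intro exI[of _ "if i < n \<and> j = n then [:0, x $$ (i, 0):] else [:if i = j then 1 else 0:]"])
        (auto simp: up_def less_Suc_eq)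
  next
    case inv_det
    then show ?case using x by (intro exI[of _ "[:1:]"]) (auto simp: det_up)
  next
    case (add f h)
    then show ?case by (metis poly_add)
  next
    case (mult f h)
    then show ?case by (metis poly_mult)
  qed
  then show ?thesis using fh up_GL x by (metis smult_carrier_mat)
qed

text \<open>If the part \<open>q\<close> above the constant term were nonzero, the polynomial would
  exceed \<open>norm L + 1\<close> in absolute value far out, which a limit L along
  \<open>inverse t\<close> forbids.\<close>

lemma poly_bounded_at_infinity_const:
  fixes p :: "complex poly"
  assumes lim: "((\<lambda>t. poly p (inverse t)) \<longlongrightarrow> L) (at 0)"
  shows "poly p s = poly p 0"
proof (cases p)
  case (pCons a q)
  have "q = 0"
  proof (rule ccontr)
    assume "q \<noteq> 0"
    from poly_infinity[OF this, of "norm L + 1" a] obtain r where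
      r: "\<And>z. r \<le> norm z \<Longrightarrow> norm L + 1 \<le> norm (poly p z)" by (auto simp: pCons)
    have "eventually (\<lambda>z::complex. r \<le> norm z) at_infinity" by (auto simp: eventually_at_infinity)
    then have "eventually (\<lambda>t::complex. r \<le> norm (inverse t)) (at 0)"
      using filterlim_inverse_at_infinity by (auto simp: filterlim_iff)
    moreover have "eventually (\<lambda>t. dist (poly p (inverse t)) L < 1) (at 0)"
      using lim by (auto simp: tendsto_iff)
    ultimately have "eventually (\<lambda>t::complex. False) (at 0)"
    proof eventually_elim
      case (elim t)
      have "norm (poly p (inverse t)) \<le> norm L + dist (poly p (inverse t)) L"
        unfolding dist_norm by (metis add.commute diff_add_cancel norm_triangle_ineq)
      then show ?case using r[OF elim(1)] elim(2) by simp
    qed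
    then show False by simp
  qed
  then show ?thesis by (simp add: pCons)
qed

section \<open>Irreducible representations\<close>

lemma mat_eq_by_vec:
  fixes M M' :: "'a :: comm_ring_1 mat"
  assumes M: "M \<in> carrier_mat nr nc" and M': "M' \<in> carrier_mat nr nc"
    and eq: "\<And>x. x \<in> carrier_vec nc \<Longrightarrow> M *\<^sub>v x = M' *\<^sub>v x"
  shows "M = M'"
proof (intro eq_matI)
  fix i j assume ij: "i < dim_row M'" "j < dim_col M'"
  have "(M *\<^sub>v unit_vec nc j) $ i = (M' *\<^sub>v unit_vec nc j) $ i" by (subst eq) auto
  then show "M $$ (i, j) = M' $$ (i, j)" using ij M M' by simp
qed (use M M' in auto)

lemma mult_mat_zero_vec:
  fixes M :: "'a :: comm_ring_1 mat"
  shows "M \<in> carrier_mat nr nc \<Longrightarrow> M *\<^sub>v 0\<^sub>v nc = 0\<^sub>v nr"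
  by (intro eq_vecI) auto

lemma subspace_with_unit_vecs:
  assumes sub: "is_subspace N W" and unit: "\<And>j. j < N \<Longrightarrow> unit_vec N j \<in> W"
  shows "W = carrier_vec N"
proof (rule ccontr)
  assume "W \<noteq> carrier_vec N"
  from proper_subspace_annihilator[OF sub this] obtain a where a: "a \<in> carrier_vec N" "a \<noteq> 0\<^sub>v N"
    "\<And>w. w \<in> W \<Longrightarrow> a \<bullet> w = 0" by blast
  have "a = 0\<^sub>v N"
  proof (intro eq_vecI)
    fix j assume j: "j < dim_vec (0\<^sub>v N :: complex vec)"
    then show "a $ j = 0\<^sub>v N $ j" using a(3)[OF unit[of j]] a(1) by simp
  qed (use a in auto)
  with a show False by simp
qed

section \<open>Representations in coordinates\<close>

lemma rep_carrier: "is_rep m R \<Longrightarrow> g \<in> carrier (GL m) \<Longrightarrow> act R g \<in> carrier_mat (rdim R) (rdim R)"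
  using hom_in_carrier[of "act R" "GL m" "GL (rdim R)" g] by (auto simp: is_rep_def carrier_GL_iff)

lemma rep_mult:
  assumes "is_rep m R" "g \<in> carrier (GL m)" "h \<in> carrier (GL m)"
  shows "act R (g * h) = act R g * act R h"
proof -
  have "act R (g \<otimes>\<^bsub>GL m\<^esub> h) = act R g \<otimes>\<^bsub>GL (rdim R)\<^esub> act R h"
    using assms by (intro hom_mult) (auto simp: is_rep_def)
  then show ?thesis by (simp only: mult_GL[symmetric])
qed

text \<open>The image of the identity is idempotent and invertible.\<close>

lemma rep_one:
  assumes "is_rep m R" shows "act R (1\<^sub>m m) = 1\<^sub>m (rdim R)"
proof -
  let ?P = "act R (1\<^sub>m m)"
  have "?P \<in> carrier (GL (rdim R))"
    using assms hom_in_carrier[of "act R" "GL m" "GL (rdim R)"] one_in_GL by (auto simp: is_rep_def)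
  then obtain Q where Q: "Q \<in> carrier (GL (rdim R))" "Q * ?P = 1\<^sub>m (rdim R)"
    by (metis GL_inverse)
  have P: "?P \<in> carrier_mat (rdim R) (rdim R)" using rep_carrier[OF assms one_in_GL] .
  have "?P * ?P = ?P" using rep_mult[OF assms one_in_GL one_in_GL] by simp
  moreover have "Q * (?P * ?P) = (Q * ?P) * ?P"
    using Q(1) P by (intro assoc_mult_mat[symmetric]) (auto simp: carrier_GL_iff)
  ultimately show ?thesis using Q(2) P by simp
qed

lemma rep_mult_vec:
  assumes "is_rep m R" "g \<in> carrier (GL m)" "h \<in> carrier (GL m)" "x \<in> carrier_vec (rdim R)"
  shows "act R (g * h) *\<^sub>v x = act R g *\<^sub>v (act R h *\<^sub>v x)"
  using assms rep_carrier[OF assms(1)] by (simp add: rep_mult[OF assms(1)] assoc_mult_mat_vec[of _ "rdim R" "rdim R" _ "rdim R"])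

lemma rep_vec_carrier:
  assumes "is_rep m R" "g \<in> carrier (GL m)" "x \<in> carrier_vec (rdim R)"
  shows "act R g *\<^sub>v x \<in> carrier_vec (rdim R)"
  using rep_carrier[OF assms(1,2)] assms(3) by auto

lemma rep_entry_regular:
  assumes "is_rep m R" "i < rdim R" "j < rdim R"
  shows "regular_on m (\<lambda>g. act R g $$ (i, j))"
  using assms by (auto simp: is_rep_def regular_on_def)

lemma rep_coefficient_regular:
  assumes R: "is_rep m R" and a: "a \<in> carrier_vec (rdim R)" and x: "x \<in> carrier_vec (rdim R)"
  shows "regular_on m (\<lambda>g. a \<bullet> (act R g *\<^sub>v x))"
proof -
  let ?N = "rdim R"
  have "regular_on m (\<lambda>g. \<Sum>i\<in>{0..<?N}. a $ i * (\<Sum>j\<in>{0..<?N}. act R g $$ (i, j) * x $ j))"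
    by (intro regular_on_sum regular_on_mult regular_on_const rep_entry_regular[OF R]) auto
  moreover have "a \<bullet> (act R g *\<^sub>v x) = (\<Sum>i\<in>{0..<?N}. a $ i * (\<Sum>j\<in>{0..<?N}. act R g $$ (i, j) * x $ j))"
    if "g \<in> carrier (GL m)" for g
    using rep_carrier[OF R that] a x by (auto simp: scalar_prod_def intro!: sum.cong)
  ultimately show ?thesis by (subst regular_on_cong) auto
qed

text \<open>Invertibility of \<open>act R g\<close> comes from the inverse h of g, because
  \<open>act R h\<close> is then an inverse matrix.\<close>

lemma is_repI:
  assumes car: "\<And>g. g \<in> carrier (GL m) \<Longrightarrow> act R g \<in> carrier_mat (rdim R) (rdim R)"
    and mult: "\<And>g h. g \<in> carrier (GL m) \<Longrightarrow> h \<in> carrier (GL m) \<Longrightarrow> act R (g * h) = act R g * act R h"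
    and one: "act R (1\<^sub>m m) = 1\<^sub>m (rdim R)"
    and reg: "\<And>i j. i < rdim R \<Longrightarrow> j < rdim R \<Longrightarrow> regular_on m (\<lambda>g. act R g $$ (i, j))"
  shows "is_rep m R"
proof -
  have "act R g \<in> carrier (GL (rdim R))" if g: "g \<in> carrier (GL m)" for g
  proof -
    obtain h where h: "h \<in> carrier (GL m)" "g * h = 1\<^sub>m m" using GL_inverse[OF g] by blast
    then show ?thesis using mult[OF g h(1)] one car g by (intro carrier_GLI[of _ _ "act R h"]) auto
  qed
  moreover have "act R (g \<otimes>\<^bsub>GL m\<^esub> h) = act R g \<otimes>\<^bsub>GL (rdim R)\<^esub> act R h"
    if "g \<in> carrier (GL m)" "h \<in> carrier (GL m)" for g h
    using mult[OF that] by (simp only: mult_GL[symmetric])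
  ultimately show ?thesis using reg by (auto simp: is_rep_def hom_def regular_on_def)
qed

lemma irreducible_is_rep: "irreducible_rep m R \<Longrightarrow> is_rep m R"
  by (simp add: irreducible_rep_def)

lemma irreducible_subspace:
  assumes "irreducible_rep m R" "is_subspace (rdim R) W"
    "\<And>g w. g \<in> carrier (GL m) \<Longrightarrow> w \<in> W \<Longrightarrow> act R g *\<^sub>v w \<in> W"
    "x \<in> W" "x \<noteq> 0\<^sub>v (rdim R)"
  shows "W = carrier_vec (rdim R)"
  using assms unfolding irreducible_rep_def by blast

text \<open>The common kernel of the translates of a linear map is an invariant subspace.\<close>

lemma irreducible_translates_kernel:
  assumes irr: "irreducible_rep m R" and Phi: "Phi \<in> carrier_mat K (rdim R)"
    and x: "x \<in> carrier_vec (rdim R)" "x \<noteq> 0\<^sub>v (rdim R)"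
    and zero: "\<And>g. g \<in> carrier (GL m) \<Longrightarrow> Phi *\<^sub>v (act R g *\<^sub>v x) = 0\<^sub>v K"
    and y: "y \<in> carrier_vec (rdim R)"
  shows "Phi *\<^sub>v y = 0\<^sub>v K"
proof -
  note R = irreducible_is_rep[OF irr]
  note car = rep_carrier[OF R]
  let ?N = "rdim R"
  define W where "W = {z \<in> carrier_vec ?N. \<forall>g \<in> carrier (GL m). Phi *\<^sub>v (act R g *\<^sub>v z) = 0\<^sub>v K}"
  have "is_subspace ?N W" unfolding subspace_vec_iff
  proof (intro conjI allI ballI)
    show "W \<subseteq> carrier_vec ?N" by (auto simp: W_def)
    show "0\<^sub>v ?N \<in> W" using Phi 
      by (auto simp: W_def mult_mat_zero_vec[OF car] mult_mat_zero_vec[OF Phi])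
  next
    fix x y assume xy: "x \<in> W" "y \<in> W"
    have "Phi *\<^sub>v (act R g *\<^sub>v (x + y)) = 0\<^sub>v K" if g: "g \<in> carrier (GL m)" for g
    proof -
      have "Phi *\<^sub>v (act R g *\<^sub>v (x + y)) = Phi *\<^sub>v (act R g *\<^sub>v x) + Phi *\<^sub>v (act R g *\<^sub>v y)"
        using xy Phi car[OF g] by (simp add: W_def mult_add_distrib_mat_vec[of _ ?N ?N] 
            mult_add_distrib_mat_vec[of _ K ?N])
      then show ?thesis using xy g by (simp add: W_def)
    qed
    then show "x + y \<in> W" using xy by (simp add: W_def)
  next
    fix c x assume x: "x \<in> W"
    have "Phi *\<^sub>v (act R g *\<^sub>v (c \<cdot>\<^sub>v x)) = 0\<^sub>v K" if g: "g \<in> carrier (GL m)" for g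
    proof -
      have "Phi *\<^sub>v (act R g *\<^sub>v (c \<cdot>\<^sub>v x)) = c \<cdot>\<^sub>v (Phi *\<^sub>v (act R g *\<^sub>v x))"
        using x Phi car[OF g] by (simp add: W_def mult_mat_vec[of _ ?N ?N] mult_mat_vec[of _ K ?N])
      then show ?thesis using x g by (auto simp: W_def)
    qed
    then show "c \<cdot>\<^sub>v x \<in> W" using x by (simp add: W_def)
  qed
  moreover have "act R g *\<^sub>v z \<in> W" if "g \<in> carrier (GL m)" "z \<in> W" for g z
    using that car by (auto simp: W_def rep_mult_vec[OF R, symmetric] mult_in_GL intro: mult_mat_vec_carrier)
  ultimately have "W = carrier_vec ?N"
    using x zero by (intro irreducible_subspace[OF irr, of W x]) (auto simp: W_def)
  then have "Phi *\<^sub>v (act R (1\<^sub>m m) *\<^sub>v y) = 0\<^sub>v K" using y one_in_GL[of m] by (auto simp: W_def)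
  then show ?thesis using y by (simp add: rep_one[OF R])
qed

text \<open>A proper W has a nonzero annihilator a. The coefficient of a along the orbit of w
  vanishes on the big cell, where the upper factor fixes w and the rest stays in W, and hence on the
  whole group by density. The translates of w lie in the kernel of a, so irreducibility forces a =
  0.\<close>

lemma irreducible_big_cell_span:
  assumes irr: "irreducible_rep (Suc n) R"
    and w: "w \<in> carrier_vec (rdim R)" "w \<noteq> 0\<^sub>v (rdim R)"
    and up: "\<And>x. x \<in> carrier_mat n 1 \<Longrightarrow> act R (up n x) *\<^sub>v w = w"
    and sub: "is_subspace (rdim R) W"
    and cell: "\<And>y A d. y \<in> carrier_mat 1 n \<Longrightarrow> A \<in> carrier (GL n) \<Longrightarrow> d \<noteq> 0 \<Longrightarrow>
       act R (lo n y) *\<^sub>v (act R (emb A d) *\<^sub>v w) \<in> W"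
  shows "W = carrier_vec (rdim R)"
proof (rule ccontr)
  note R = irreducible_is_rep[OF irr]
  let ?N = "rdim R"
  assume "W \<noteq> carrier_vec ?N"
  from proper_subspace_annihilator[OF sub this] obtain a where a: "a \<in> carrier_vec ?N" "a \<noteq> 0\<^sub>v ?N"
    "\<And>w. w \<in> W \<Longrightarrow> a \<bullet> w = 0" by blast
  have az: "a \<bullet> (act R g *\<^sub>v w) = 0" if g: "g \<in> carrier (GL (Suc n))" for g
  proof (rule regular_zero_on_big_cell[OF rep_coefficient_regular[OF R a(1) w(1)] _ g])
    fix y A x :: "complex mat" and d :: complex
    assume h: "y \<in> carrier_mat 1 n" "A \<in> carrier (GL n)" "d \<noteq> 0" "x \<in> carrier_mat n 1"
    have "act R (lo n y * (emb A d * up n x)) *\<^sub>v w = act R (lo n y) *\<^sub>v (act R (emb A d) *\<^sub>v w)"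
      using h w by (simp add: rep_mult_vec[OF R] mult_in_GL lo_GL emb_GL up_GL up)
    then show "a \<bullet> (act R (lo n y * (emb A d * up n x)) *\<^sub>v w) = 0" using a cell h by simp
  qed
  \<comment> \<open>The functional a as a one-row matrix, the form that
    \<open>irreducible_translates_kernel\<close> takes.\<close>
  define Phi where "Phi = mat 1 ?N (\<lambda>(_, j). a $ j)"
  have Phi: "Phi \<in> carrier_mat 1 ?N" by (simp add: Phi_def)
  have Phi_vec: "Phi *\<^sub>v z = vec 1 (\<lambda>_. a \<bullet> z)" if "z \<in> carrier_vec ?N" for z
    using that a(1) by (intro eq_vecI) (auto simp: Phi_def scalar_prod_def)
  have "a = 0\<^sub>v ?N"
  proof (intro eq_vecI)
    fix j assume j: "j < dim_vec (0\<^sub>v ?N :: complex vec)"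
    have "Phi *\<^sub>v unit_vec ?N j = 0\<^sub>v 1"
      by (rule irreducible_translates_kernel[OF irr Phi w])
        (auto simp: Phi_vec rep_vec_carrier[OF R] w az)
    then have "(Phi *\<^sub>v unit_vec ?N j) $ 0 = 0" by simp
    then have "a \<bullet> unit_vec ?N j = 0" by (simp add: Phi_vec)
    then show "a $ j = 0\<^sub>v ?N $ j" using a(1) j by simp
  qed (use a in auto)
  with a show False by simp
qed

text \<open>If \<open>R\<close> and \<open>S\<close> are irreducible and some pair \<open>(v, w)\<close> with \<open>Phi *\<^sub>v v \<noteq> 0\<close> is intertwined,
  this relation is the graph of an isomorphism.\<close>

definition intertwined :: "nat \<Rightarrow> rep \<Rightarrow> rep \<Rightarrow> complex mat \<Rightarrow> complex mat \<Rightarrow> complex vec \<Rightarrow> complex vec \<Rightarrow> bool" where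
  "intertwined m R S Phi Psi x y \<longleftrightarrow> x \<in> carrier_vec (rdim R) \<and> y \<in> carrier_vec (rdim S) \<and>
     (\<forall>h \<in> carrier (GL m). Phi *\<^sub>v (act R h *\<^sub>v x) = Psi *\<^sub>v (act S h *\<^sub>v y))"

lemma intertwined_sym: "intertwined m R S Phi Psi x y \<longleftrightarrow> intertwined m S R Psi Phi y x"
  by (auto simp: intertwined_def)

context
  fixes m :: nat and R S :: rep and Phi Psi :: "complex mat" and K :: nat
  assumes R: "is_rep m R" and S: "is_rep m S"
    and Phi: "Phi \<in> carrier_mat K (rdim R)" and Psi: "Psi \<in> carrier_mat K (rdim S)"
begin

lemma intertwined_add:
  assumes "intertwined m R S Phi Psi x y" "intertwined m R S Phi Psi x' y'"
  shows "intertwined m R S Phi Psi (x + x') (y + y')"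
  unfolding intertwined_def
proof (intro conjI ballI)
  fix h assume h: "h \<in> carrier (GL m)"
  have c: "x \<in> carrier_vec (rdim R)" "x' \<in> carrier_vec (rdim R)" "y \<in> carrier_vec (rdim S)" 
    "y' \<in> carrier_vec (rdim S)" using assms by (auto simp: intertwined_def)
  have "Phi *\<^sub>v (act R h *\<^sub>v (x + x')) = Phi *\<^sub>v (act R h *\<^sub>v x) + Phi *\<^sub>v (act R h *\<^sub>v x')"
    using c rep_carrier[OF R h] Phi
    by (simp add: mult_add_distrib_mat_vec[of _ "rdim R" "rdim R"] mult_add_distrib_mat_vec[of Phi K "rdim R"])
  also have "\<dots> = Psi *\<^sub>v (act S h *\<^sub>v y) + Psi *\<^sub>v (act S h *\<^sub>v y')"
    using assms h by (simp add: intertwined_def)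
  also have "\<dots> = Psi *\<^sub>v (act S h *\<^sub>v (y + y'))"
    using c rep_carrier[OF S h] Psi
    by (simp add: mult_add_distrib_mat_vec[of _ "rdim S" "rdim S"] mult_add_distrib_mat_vec[of Psi K "rdim S"])
  finally show "Phi *\<^sub>v (act R h *\<^sub>v (x + x')) = Psi *\<^sub>v (act S h *\<^sub>v (y + y'))" .
qed (use assms in \<open>auto simp: intertwined_def\<close>)

lemma intertwined_smult:
  assumes "intertwined m R S Phi Psi x y"
  shows "intertwined m R S Phi Psi (c \<cdot>\<^sub>v x) (c \<cdot>\<^sub>v y)"
  unfolding intertwined_def
proof (intro conjI ballI)
  fix h assume h: "h \<in> carrier (GL m)"
  have c: "x \<in> carrier_vec (rdim R)" "y \<in> carrier_vec (rdim S)" using assms by (auto simp: intertwined_def)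
  have "Phi *\<^sub>v (act R h *\<^sub>v (c \<cdot>\<^sub>v x)) = c \<cdot>\<^sub>v (Phi *\<^sub>v (act R h *\<^sub>v x))"
    using c rep_carrier[OF R h] Phi
    by (simp add: mult_mat_vec[of _ "rdim R" "rdim R"] mult_mat_vec[of Phi K "rdim R"])
  also have "\<dots> = c \<cdot>\<^sub>v (Psi *\<^sub>v (act S h *\<^sub>v y))"
    using assms h by (simp add: intertwined_def)
  also have "\<dots> = Psi *\<^sub>v (act S h *\<^sub>v (c \<cdot>\<^sub>v y))"
    using c rep_carrier[OF S h] Psi
    by (simp add: mult_mat_vec[of _ "rdim S" "rdim S"] mult_mat_vec[of Psi K "rdim S"])
  finally show "Phi *\<^sub>v (act R h *\<^sub>v (c \<cdot>\<^sub>v x)) = Psi *\<^sub>v (act S h *\<^sub>v (c \<cdot>\<^sub>v y))" .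
qed (use assms in \<open>auto simp: intertwined_def\<close>)

lemma intertwined_zero: "intertwined m R S Phi Psi (0\<^sub>v (rdim R)) (0\<^sub>v (rdim S))"
  by (auto simp: intertwined_def mult_mat_zero_vec[OF Phi] mult_mat_zero_vec[OF Psi]
      mult_mat_zero_vec[OF rep_carrier[OF R]] mult_mat_zero_vec[OF rep_carrier[OF S]])

lemma intertwined_act:
  assumes "intertwined m R S Phi Psi x y" "g \<in> carrier (GL m)"
  shows "intertwined m R S Phi Psi (act R g *\<^sub>v x) (act S g *\<^sub>v y)"
  using assms rep_vec_carrier[OF R] rep_vec_carrier[OF S]
  by (auto simp: intertwined_def rep_mult_vec[OF R, symmetric] rep_mult_vec[OF S, symmetric] mult_in_GL)

context
  fixes v w :: "complex vec"
  assumes irrS: "irreducible_rep m S" and vw: "intertwined m R S Phi Psi v w"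
    and nz: "Phi *\<^sub>v v \<noteq> 0\<^sub>v K"
begin

text \<open>The difference u of two partners is a partner of 0, so \<open>Psi\<close> kills every
  translate of u. If u were nonzero, irreducibility of S would make \<open>Psi\<close> vanish,
  contrary to Psi w = Phi v.\<close>

lemma intertwined_unique:
  assumes xy: "intertwined m R S Phi Psi x y" and xz: "intertwined m R S Phi Psi x z"
  shows "y = z"
proof -
  have c: "x \<in> carrier_vec (rdim R)" "y \<in> carrier_vec (rdim S)" "z \<in> carrier_vec (rdim S)"
    using xy xz by (auto simp: intertwined_def)
  define u where "u = y + (-1) \<cdot>\<^sub>v z"
  have u: "u \<in> carrier_vec (rdim S)" using c by (auto simp: u_def)
  have "intertwined m R S Phi Psi (x + (-1) \<cdot>\<^sub>v x) u"
    unfolding u_def by (intro intertwined_add intertwined_smult xy xz)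
  also have "x + (-1) \<cdot>\<^sub>v x = 0\<^sub>v (rdim R)" using c by (intro eq_vecI) auto
  finally have 0: "intertwined m R S Phi Psi (0\<^sub>v (rdim R)) u" .
  have "Psi *\<^sub>v (act S g *\<^sub>v u) = 0\<^sub>v K" if g: "g \<in> carrier (GL m)" for g
  proof -
    have "Psi *\<^sub>v (act S g *\<^sub>v u) = Phi *\<^sub>v (act R g *\<^sub>v 0\<^sub>v (rdim R))" using 0 g by (simp add: intertwined_def)
    also have "\<dots> = 0\<^sub>v K" by (simp add: mult_mat_zero_vec[OF Phi] mult_mat_zero_vec[OF rep_carrier[OF R g]])
    finally show ?thesis .
  qed
  moreover have "Psi *\<^sub>v w = Phi *\<^sub>v v"
    using vw one_in_GL[of m] by (auto simp: intertwined_def rep_one[OF R] rep_one[OF S])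
  ultimately have u0: "u = 0\<^sub>v (rdim S)"
    using irreducible_translates_kernel[OF irrS Psi u, of w] vw nz by (auto simp: intertwined_def)
  show "y = z"
  proof (intro eq_vecI)
    fix i assume i: "i < dim_vec z"
    have "u $ i = 0" using i c by (simp add: u0)
    then show "y $ i = z $ i" using i c by (simp add: u_def)
  qed (use c in auto)
qed

text \<open>The vectors that have a partner form an invariant subspace containing v, which is
  nonzero because \<open>Phi\<close> does not kill it. By irreducibility every vector has a
  partner.\<close>

lemma intertwining_matrix:
  assumes irrR: "irreducible_rep m R"
  obtains P where "P \<in> carrier_mat (rdim S) (rdim R)"
    "\<And>x. x \<in> carrier_vec (rdim R) \<Longrightarrow> intertwined m R S Phi Psi x (P *\<^sub>v x)"
proof -
  let ?N = "rdim R" and ?I = "intertwined m R S Phi Psi"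
  define W where "W = {x. \<exists>y. ?I x y}"
  have "is_subspace ?N W" unfolding subspace_vec_iff
  proof (intro conjI allI ballI)
    show "W \<subseteq> carrier_vec ?N" by (auto simp: W_def intertwined_def)
    show "0\<^sub>v ?N \<in> W" using intertwined_zero by (auto simp: W_def)
    show "x + y \<in> W" if "x \<in> W" "y \<in> W" for x y
      using that by (auto simp: W_def intro: intertwined_add)
    show "c \<cdot>\<^sub>v x \<in> W" if "x \<in> W" for c x
      using that by (auto simp: W_def intro: intertwined_smult)
  qed
  moreover have "v \<noteq> 0\<^sub>v ?N" using nz mult_mat_zero_vec[OF Phi] by auto
  ultimately have "W = carrier_vec ?N"
    using vw intertwined_act by (intro irreducible_subspace[OF irrR, of W v]) (auto simp: W_def)
  then have "\<exists>f. \<forall>x \<in> carrier_vec ?N. ?I x (f x)" by (intro bchoice) (auto simp: W_def)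
  then obtain f where f: "\<And>x. x \<in> carrier_vec ?N \<Longrightarrow> ?I x (f x)" by auto
  \<comment> \<open>The choice \<open>f\<close> is not known to be linear. Its values on the unit
    vectors are taken as columns, and the subspace U shows that the resulting matrix still sends
    every x to a partner.\<close>
  define P where "P = mat (rdim S) ?N (\<lambda>(i, j). f (unit_vec ?N j) $ i)"
  have P: "P \<in> carrier_mat (rdim S) ?N" by (simp add: P_def)
  define U where "U = {x \<in> carrier_vec ?N. ?I x (P *\<^sub>v x)}"
  have "U = carrier_vec ?N"
  proof (rule subspace_with_unit_vecs)
    have "P *\<^sub>v 0\<^sub>v ?N = 0\<^sub>v (rdim S)" by (rule mult_mat_zero_vec[OF P])
    then show "is_subspace ?N U" unfolding subspace_vec_iff U_def
      using P by (auto simp: mult_add_distrib_mat_vec[OF P] mult_mat_vec[OF P] intertwined_zero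
          intro: intertwined_add intertwined_smult)
    fix j assume j: "j < ?N"
    have I: "?I (unit_vec ?N j) (f (unit_vec ?N j))" by (rule f) simp
    then have "f (unit_vec ?N j) \<in> carrier_vec (rdim S)" by (simp add: intertwined_def)
    then have "P *\<^sub>v unit_vec ?N j = f (unit_vec ?N j)"
      using j by (intro eq_vecI) (auto simp: P_def)
    then show "unit_vec ?N j \<in> U" using I by (simp add: U_def)
  qed
  then show ?thesis using that[OF P] by (auto simp: U_def)
qed

end

end

text \<open>Equal coefficients make (v, w) an intertwined pair. The relation is symmetric, so there
  are matrices in both directions, and uniqueness of partners makes them mutually inverse and
  equivariant. The normalization \<open>P *\<^sub>v v = w\<close> is recorded for the induction in
  \<open>highest_weight_unique\<close>, which has to match highest weight vectors and not only
  representations.\<close>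

lemma irreducible_equiv_by_coefficients:
  assumes irrR: "irreducible_rep m R" and irrS: "irreducible_rep m S"
    and Phi: "Phi \<in> carrier_mat K (rdim R)" and Psi: "Psi \<in> carrier_mat K (rdim S)"
    and v: "v \<in> carrier_vec (rdim R)" and w: "w \<in> carrier_vec (rdim S)"
    and eq: "\<And>h. h \<in> carrier (GL m) \<Longrightarrow> Phi *\<^sub>v (act R h *\<^sub>v v) = Psi *\<^sub>v (act S h *\<^sub>v w)"
    and nz: "Phi *\<^sub>v v \<noteq> 0\<^sub>v K"
  shows "rdim R = rdim S \<and> (\<exists>P \<in> carrier (GL (rdim R)). (\<forall>g \<in> carrier (GL m). P * act R g = act S g * P) \<and>
    P *\<^sub>v v = w)"
proof -
  note R = irreducible_is_rep[OF irrR] and S = irreducible_is_rep[OF irrS]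
  let ?I = "intertwined m R S Phi Psi"
  have vw: "?I v w" using eq v w by (simp add: intertwined_def)
  have wv: "intertwined m S R Psi Phi w v" using vw by (simp add: intertwined_sym)
  have nz': "Psi *\<^sub>v w \<noteq> 0\<^sub>v K"
    using eq[OF one_in_GL] nz v w by (simp add: rep_one[OF R] rep_one[OF S])
  note unique = intertwined_unique[OF R S Phi Psi irrS vw nz]
  note unique' = intertwined_unique[OF S R Psi Phi irrR wv nz']
  obtain P where P: "P \<in> carrier_mat (rdim S) (rdim R)"
    and PI: "\<And>x. x \<in> carrier_vec (rdim R) \<Longrightarrow> ?I x (P *\<^sub>v x)"
    using intertwining_matrix[OF R S Phi Psi irrS vw nz irrR] by blast
  obtain Q where Q: "Q \<in> carrier_mat (rdim R) (rdim S)"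
    and QI: "\<And>x. x \<in> carrier_vec (rdim S) \<Longrightarrow> intertwined m S R Psi Phi x (Q *\<^sub>v x)"
    using intertwining_matrix[OF S R Psi Phi irrR wv nz' irrS] by blast
  have QP: "Q * P = 1\<^sub>m (rdim R)"
  proof (rule mat_eq_by_vec)
    fix x :: "complex vec" assume x: "x \<in> carrier_vec (rdim R)"
    have "Q *\<^sub>v (P *\<^sub>v x) = x"
      using PI[OF x] QI[of "P *\<^sub>v x"] P x by (intro unique'[of "P *\<^sub>v x"]) (auto simp: intertwined_sym)
    then show "(Q * P) *\<^sub>v x = 1\<^sub>m (rdim R) *\<^sub>v x" using P Q x by simp
  qed (use P Q in auto)
  have PQ: "P * Q = 1\<^sub>m (rdim S)"
  proof (rule mat_eq_by_vec)
    fix x :: "complex vec" assume x: "x \<in> carrier_vec (rdim S)"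
    have "P *\<^sub>v (Q *\<^sub>v x) = x"
      using QI[OF x] PI[of "Q *\<^sub>v x"] Q x by (intro unique[of "Q *\<^sub>v x"]) (auto simp: intertwined_sym)
    then show "(P * Q) *\<^sub>v x = 1\<^sub>m (rdim S) *\<^sub>v x" using P Q x by simp
  qed (use P Q in auto)
  have dim: "rdim R = rdim S" using left_right_inverse_dim_eq[OF P Q QP PQ] by simp
  have "P \<in> carrier (GL (rdim R))" using P Q PQ dim by (intro carrier_GLI[of _ _ Q]) auto
  moreover have "P * act R g = act S g * P" if g: "g \<in> carrier (GL m)" for g
  proof (rule mat_eq_by_vec)
    fix x :: "complex vec" assume x: "x \<in> carrier_vec (rdim R)"
    have "P *\<^sub>v (act R g *\<^sub>v x) = act S g *\<^sub>v (P *\<^sub>v x)"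
      by (rule unique[OF PI intertwined_act[OF R S Phi Psi PI g]]) (use x g rep_vec_carrier[OF R] in auto)
    then show "(P * act R g) *\<^sub>v x = (act S g * P) *\<^sub>v x"
      using P x rep_carrier[OF R g] rep_carrier[OF S g]
      by (simp add: assoc_mult_mat_vec[of P "rdim S" "rdim R" "act R g" "rdim R"] 
          assoc_mult_mat_vec[of "act S g" "rdim S" "rdim S" P "rdim R"])
  qed (use P rep_carrier[OF R g] rep_carrier[OF S g] in auto)
  moreover have "P *\<^sub>v v = w" by (rule unique[OF PI[OF v] vw])
  ultimately show ?thesis using dim by blast
qed

section \<open>The limit projection\<close>

declare One_nat_def [simp del]

lemma mult3_mat_vec:
  fixes L :: "'a :: semiring_0 mat"
  assumes "L \<in> carrier_mat a b" "M \<in> carrier_mat b c" "M' \<in> carrier_mat c d" "x \<in> carrier_vec d"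
  shows "(L * M * M') *\<^sub>v x = L *\<^sub>v (M *\<^sub>v (M' *\<^sub>v x))"
proof -
  have "L * M \<in> carrier_mat a c" using assms by auto
  then have "(L * M * M') *\<^sub>v x = (L * M) *\<^sub>v (M' *\<^sub>v x)" using assms by (intro assoc_mult_mat_vec) auto
  also have "\<dots> = L *\<^sub>v (M *\<^sub>v (M' *\<^sub>v x))" using assms by (intro assoc_mult_mat_vec) auto
  finally show ?thesis .
qed

lemma mat_vec_tendsto:
  fixes X :: "'t \<Rightarrow> complex mat"
  assumes X: "\<And>t. X t \<in> carrier_mat nr nc" and L: "L \<in> carrier_mat nr nc" and x: "x \<in> carrier_vec nc"
    and lim: "\<And>i j. i < nr \<Longrightarrow> j < nc \<Longrightarrow> ((\<lambda>t. X t $$ (i, j)) \<longlongrightarrow> L $$ (i, j)) F" and i: "i < nr"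
  shows "((\<lambda>t. (X t *\<^sub>v x) $ i) \<longlongrightarrow> (L *\<^sub>v x) $ i) F"
proof -
  have "((\<lambda>t. \<Sum>j = 0..<nc. X t $$ (i, j) * x $ j) \<longlongrightarrow> (\<Sum>j = 0..<nc. L $$ (i, j) * x $ j)) F"
    by (intro tendsto_sum tendsto_mult tendsto_const lim i) auto
  moreover have "(Y *\<^sub>v x) $ i = (\<Sum>j = 0..<nc. Y $$ (i, j) * x $ j)" if "Y \<in> carrier_mat nr nc" for Y
    using that x i by (auto simp: scalar_prod_def)
  ultimately show ?thesis using X L by simp
qed

lemma vec_mat_tendsto:
  fixes f :: "'t \<Rightarrow> complex vec"
  assumes M: "M \<in> carrier_mat nr nc" and f: "\<And>t. f t \<in> carrier_vec nc" and x: "x \<in> carrier_vec nc"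
    and lim: "\<And>j. j < nc \<Longrightarrow> ((\<lambda>t. f t $ j) \<longlongrightarrow> x $ j) F" and i: "i < nr"
  shows "((\<lambda>t. (M *\<^sub>v f t) $ i) \<longlongrightarrow> (M *\<^sub>v x) $ i) F"
proof -
  have "((\<lambda>t. \<Sum>j = 0..<nc. M $$ (i, j) * f t $ j) \<longlongrightarrow> (\<Sum>j = 0..<nc. M $$ (i, j) * x $ j)) F"
    by (intro tendsto_sum tendsto_mult tendsto_const lim i) auto
  moreover have "(M *\<^sub>v z) $ i = (\<Sum>j = 0..<nc. M $$ (i, j) * z $ j)" if "z \<in> carrier_vec nc" for z
    using that M i by (auto simp: scalar_prod_def)
  ultimately show ?thesis using f x by simp
qed

text \<open>\<open>v\<close> is an eigenvector of \<open>diag(1, \<dots>, 1, d)\<close> fixed by the unipotent radical of the parabolic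
  of type \<open>(n, 1)\<close>. The operators \<open>c t\<close> contract the opposite unipotent radical as \<open>t\<close> tends to
  0, so their limit is the projection onto the weight space of \<open>v\<close>.\<close>

locale parabolic_highest_vector =
  fixes n :: nat and R :: rep and k :: int and v :: "complex vec"
  assumes irr: "irreducible_rep (Suc n) R"
    and v: "v \<in> carrier_vec (rdim R)" "v \<noteq> 0\<^sub>v (rdim R)"
    and torus: "\<And>d. d \<noteq> 0 \<Longrightarrow> act R (emb (1\<^sub>m n) d) *\<^sub>v v = (d powi k) \<cdot>\<^sub>v v"
    and unip: "\<And>x. x \<in> carrier_mat n 1 \<Longrightarrow> act R (up n x) *\<^sub>v v = v"
begin

abbreviation N where "N \<equiv> rdim R"

lemmas R = irreducible_is_rep[OF irr]
lemmas rc = rep_carrier[OF R]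
lemmas rvc = rep_vec_carrier[OF R]

text \<open>At \<open>t = 0\<close>, where \<open>emb (1\<^sub>m n) t\<close> is singular, the value is arbitrary.\<close>

definition c :: "complex \<Rightarrow> complex mat" where
  "c t = (if t = 0 then 1\<^sub>m N else (t powi (- k)) \<cdot>\<^sub>m act R (emb (1\<^sub>m n) t))"

lemma c_carrier: "c t \<in> carrier_mat N N"
  using rc[OF emb_one_GL] by (auto simp: c_def)

lemma c_vec_carrier: "x \<in> carrier_vec N \<Longrightarrow> c t *\<^sub>v x \<in> carrier_vec N"
  using mult_mat_vec_carrier[OF c_carrier] .

lemma c_vec: 
  "t \<noteq> 0 \<Longrightarrow> x \<in> carrier_vec N \<Longrightarrow> c t *\<^sub>v x = (t powi (- k)) \<cdot>\<^sub>v (act R (emb (1\<^sub>m n) t) *\<^sub>v x)"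
  using smult_mat_mult_vec[OF rc[OF emb_one_GL]] by (simp add: c_def)

lemma c_commute_act:
  assumes t: "t \<noteq> 0" and g: "g \<in> carrier (GL (Suc n))" and h: "h \<in> carrier (GL (Suc n))"
    and gh: "emb (1\<^sub>m n) t * g = h * emb (1\<^sub>m n) t" and x: "x \<in> carrier_vec N"
  shows "c t *\<^sub>v (act R g *\<^sub>v x) = act R h *\<^sub>v (c t *\<^sub>v x)"
proof -
  note e = emb_one_GL[OF t, of n]
  have "act R (emb (1\<^sub>m n) t) *\<^sub>v (act R g *\<^sub>v x) = act R h *\<^sub>v (act R (emb (1\<^sub>m n) t) *\<^sub>v x)"
    using rep_mult_vec[OF R e g x] rep_mult_vec[OF R h e x] gh by simp
  then show ?thesis
    using x g h by (simp add: c_vec t rvc e mult_mat_vec[OF rc[OF h] rvc[OF e x]])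
qed

lemma c_emb:
  "t \<noteq> 0 \<Longrightarrow> A \<in> carrier (GL n) \<Longrightarrow> d \<noteq> 0 \<Longrightarrow> x \<in> carrier_vec N \<Longrightarrow>
     c t *\<^sub>v (act R (emb A d) *\<^sub>v x) = act R (emb A d) *\<^sub>v (c t *\<^sub>v x)"
  by (rule c_commute_act) (auto simp: emb_GL emb_one_commute carrier_GL_iff[of _ n])

lemma c_lo:
  "t \<noteq> 0 \<Longrightarrow> y \<in> carrier_mat 1 n \<Longrightarrow> x \<in> carrier_vec N \<Longrightarrow>
     c t *\<^sub>v (act R (lo n y) *\<^sub>v x) = act R (lo n (t \<cdot>\<^sub>m y)) *\<^sub>v (c t *\<^sub>v x)"
  by (rule c_commute_act) (auto simp: lo_GL emb_one_lo)

lemma c_up: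
  assumes "t \<noteq> 0" "z \<in> carrier_mat n 1" "x \<in> carrier_vec N"
  shows "c t *\<^sub>v (act R (up n z) *\<^sub>v x) = act R (up n (inverse t \<cdot>\<^sub>m z)) *\<^sub>v (c t *\<^sub>v x)"
proof (rule c_commute_act)
  have "t \<cdot>\<^sub>m (inverse t \<cdot>\<^sub>m z) = z" using assms(1) by (intro eq_matI) auto
  then show "emb (1\<^sub>m n) t * up n z = up n (inverse t \<cdot>\<^sub>m z) * emb (1\<^sub>m n) t"
    using emb_one_up[of "inverse t \<cdot>\<^sub>m z" n t] assms by simp
qed (use assms in \<open>auto simp: up_GL\<close>)

lemma c_mult:
  assumes s: "s \<noteq> 0" and t: "t \<noteq> 0" and x: "x \<in> carrier_vec N"
  shows "c s *\<^sub>v (c t *\<^sub>v x) = c (s * t) *\<^sub>v x"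
proof -
  have "emb (1\<^sub>m n) s * emb (1\<^sub>m n) t = emb (1\<^sub>m n) (s * t)" by (simp add: emb_mult[of _ n])
  then have "act R (emb (1\<^sub>m n) s) *\<^sub>v (act R (emb (1\<^sub>m n) t) *\<^sub>v x) = act R (emb (1\<^sub>m n) (s * t)) *\<^sub>v x"
    using rep_mult_vec[OF R emb_one_GL[OF s] emb_one_GL[OF t] x] by simp
  then show ?thesis using s t x
    by (simp add: c_vec rvc emb_one_GL mult_mat_vec[OF rc[OF emb_one_GL]] smult_smult_assoc power_int_mult_distrib)
qed

text \<open>The space on which diag(1, ..., 1, t) acts by t^k, written as the vectors fixed by the
  rescaled operators. It will be the image of the limit projection.\<close>

definition V0 where "V0 = {x \<in> carrier_vec N. \<forall>t. t \<noteq> 0 \<longrightarrow> c t *\<^sub>v x = x}"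

lemma v_V0: "v \<in> V0"
  using v by (auto simp: V0_def c_vec torus smult_smult_assoc power_int_add[symmetric])

lemma V0_carrier: "x \<in> V0 \<Longrightarrow> x \<in> carrier_vec N"
  by (simp add: V0_def)

lemma c_V0: "x \<in> V0 \<Longrightarrow> t \<noteq> 0 \<Longrightarrow> c t *\<^sub>v x = x"
  by (simp add: V0_def)

lemma emb_V0: "x \<in> V0 \<Longrightarrow> A \<in> carrier (GL n) \<Longrightarrow> d \<noteq> 0 \<Longrightarrow> act R (emb A d) *\<^sub>v x \<in> V0"
  by (auto simp: V0_def c_emb rvc emb_GL)

lemma subspace_V0: "is_subspace N V0"
  unfolding subspace_vec_iff V0_def
  by (auto simp: mult_mat_zero_vec[OF c_carrier] mult_add_distrib_mat_vec[OF c_carrier] mult_mat_vec[OF c_carrier])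

text \<open>At t = 0 the lower unipotent element becomes the identity, and each coordinate,
  extracted by pairing with \<open>unit_vec N i\<close>, is a regular function of the group
  element.\<close>

lemma lo_tendsto:
  assumes x: "x \<in> carrier_vec N" and y: "y \<in> carrier_mat 1 n" and i: "i < N"
  shows "((\<lambda>t. (act R (lo n (t \<cdot>\<^sub>m y)) *\<^sub>v x) $ i) \<longlongrightarrow> x $ i) (at 0)"
proof -
  have reg: "regular_on (Suc n) (\<lambda>g. unit_vec N i \<bullet> (act R g *\<^sub>v x))"
    using x by (intro rep_coefficient_regular[OF R]) auto
  have one: "lo n (0 \<cdot>\<^sub>m y) = 1\<^sub>m (Suc n)" using y by (intro eq_matI) (auto simp: lo_def less_Suc_eq)
  have "((\<lambda>t. unit_vec N i \<bullet> (act R (lo n (t \<cdot>\<^sub>m y)) *\<^sub>v x)) \<longlongrightarrow>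
      unit_vec N i \<bullet> (act R (lo n (0 \<cdot>\<^sub>m y)) *\<^sub>v x)) (at 0)"
  proof (rule regular_on_tendsto[OF reg])
    show "lo n (0 \<cdot>\<^sub>m y) \<in> carrier (GL (Suc n))" by (simp add: one one_in_GL)
    fix a b assume ab: "a < Suc n" "b < Suc n"
    have "((\<lambda>t. t * y $$ (0, b)) \<longlongrightarrow> 0 * y $$ (0, b)) (at 0)" by (intro tendsto_intros)
    then show "((\<lambda>t. lo n (t \<cdot>\<^sub>m y) $$ (a, b)) \<longlongrightarrow> lo n (0 \<cdot>\<^sub>m y) $$ (a, b)) (at 0)"
      using ab y by (cases "a = n \<and> b < n") (auto simp: lo_def less_Suc_eq)
  qed (simp add: lo_carrier)
  then show ?thesis using x i rvc[OF lo_GL x] y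
    by (simp add: one rep_one[OF R] scalar_prod_left_unit[of _ N])
qed

text \<open>The vectors along which \<open>c t\<close> converges form a subspace. It contains every
  lower unipotent translate of a vector z of \<open>V0\<close>, since \<open>c t\<close> sends act R
  (lo n y) z to act R (lo n (t y)) z, which tends to z. The translates of the Levi orbit of v span
  everything.\<close>

lemma c_lim_exists:
  assumes "x \<in> carrier_vec N" "i < N"
  shows "\<exists>l. ((\<lambda>t. (c t *\<^sub>v x) $ i) \<longlongrightarrow> l) (at 0)"
proof -
  define W where "W = {x \<in> carrier_vec N. \<forall>i<N. \<exists>l. ((\<lambda>t. (c t *\<^sub>v x) $ i) \<longlongrightarrow> l) (at 0)}"
  have "W = carrier_vec N"
  proof (rule irreducible_big_cell_span[OF irr v unip])
    show "is_subspace N W" unfolding subspace_vec_iff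
    proof (intro conjI allI ballI)
      show "W \<subseteq> carrier_vec N" by (auto simp: W_def)
      show "0\<^sub>v N \<in> W" by (auto simp: W_def mult_mat_zero_vec[OF c_carrier] intro: tendsto_const)
    next
      fix x y assume xy: "x \<in> W" "y \<in> W"
      have "\<exists>l. ((\<lambda>t. (c t *\<^sub>v (x + y)) $ i) \<longlongrightarrow> l) (at 0)" if i: "i < N" for i
      proof -
        obtain l l' where "((\<lambda>t. (c t *\<^sub>v x) $ i) \<longlongrightarrow> l) (at 0)" "((\<lambda>t. (c t *\<^sub>v y) $ i) \<longlongrightarrow> l') (at 0)"
          using xy i unfolding W_def by blast
        from tendsto_add[OF this] have "((\<lambda>t. (c t *\<^sub>v (x + y)) $ i) \<longlongrightarrow> l + l') (at 0)"
          using xy i c_carrier by (simp add: W_def mult_add_distrib_mat_vec[OF c_carrier] carrier_matD[OF c_carrier] del: index_mult_mat_vec)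
        then show ?thesis by blast
      qed
      then show "x + y \<in> W" using xy by (simp add: W_def)
    next
      fix a x assume x: "x \<in> W"
      have "\<exists>l. ((\<lambda>t. (c t *\<^sub>v (a \<cdot>\<^sub>v x)) $ i) \<longlongrightarrow> l) (at 0)" if i: "i < N" for i
      proof -
        obtain l where "((\<lambda>t. (c t *\<^sub>v x) $ i) \<longlongrightarrow> l) (at 0)"
          using x i unfolding W_def by blast
        from tendsto_mult[OF tendsto_const this] have "((\<lambda>t. (c t *\<^sub>v (a \<cdot>\<^sub>v x)) $ i) \<longlongrightarrow> a * l) (at 0)"
          using x i c_carrier by (simp add: W_def mult_mat_vec[OF c_carrier] carrier_matD[OF c_carrier] del: index_mult_mat_vec)
        then show ?thesis by blast
      qed
      then show "a \<cdot>\<^sub>v x \<in> W" using x by (simp add: W_def)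
    qed
  next
    fix y A :: "complex mat" and d :: complex
    assume h: "y \<in> carrier_mat 1 n" "A \<in> carrier (GL n)" "d \<noteq> 0"
    let ?x = "act R (emb A d) *\<^sub>v v"
    have x: "?x \<in> V0" using h v_V0 by (intro emb_V0)
    have "((\<lambda>t. (c t *\<^sub>v (act R (lo n y) *\<^sub>v ?x)) $ i) \<longlongrightarrow> ?x $ i) (at 0)" if i: "i < N" for i
    proof (rule Lim_transform_eventually[OF lo_tendsto[OF V0_carrier[OF x] h(1) i]])
      show "eventually (\<lambda>t. (act R (lo n (t \<cdot>\<^sub>m y)) *\<^sub>v ?x) $ i = (c t *\<^sub>v (act R (lo n y) *\<^sub>v ?x)) $ i) (at 0)"
        unfolding eventually_at_filter using x h by (auto simp: c_lo V0_carrier c_V0)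
    qed
    then show "act R (lo n y) *\<^sub>v ?x \<in> W"
      using rvc[OF lo_GL[OF h(1)] V0_carrier[OF x]] by (auto simp: W_def)
  qed
  then show ?thesis using assms by (auto simp: W_def)
qed

definition p where "p = mat N N (\<lambda>(i, j). Lim (at 0) (\<lambda>t. c t $$ (i, j)))"

lemma p_carrier: "p \<in> carrier_mat N N"
  by (simp add: p_def)

lemma p_vec_carrier: "x \<in> carrier_vec N \<Longrightarrow> p *\<^sub>v x \<in> carrier_vec N"
  using mult_mat_vec_carrier[OF p_carrier] .

lemma c_tendsto:
  assumes "i < N" "j < N"
  shows "((\<lambda>t. c t $$ (i, j)) \<longlongrightarrow> p $$ (i, j)) (at 0)"
proof -
  obtain l where "((\<lambda>t. (c t *\<^sub>v unit_vec N j) $ i) \<longlongrightarrow> l) (at 0)"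
    using c_lim_exists[of "unit_vec N j" i] assms by auto
  then have l: "((\<lambda>t. c t $$ (i, j)) \<longlongrightarrow> l) (at 0)"
    using assms carrier_matD[OF c_carrier] by simp
  then show ?thesis using assms tendsto_Lim[OF _ l] by (simp add: p_def)
qed

lemma c_vec_tendsto:
  "x \<in> carrier_vec N \<Longrightarrow> i < N \<Longrightarrow> ((\<lambda>t. (c t *\<^sub>v x) $ i) \<longlongrightarrow> (p *\<^sub>v x) $ i) (at 0)"
  by (rule mat_vec_tendsto[OF c_carrier p_carrier _ c_tendsto])

lemma p_eqI:
  assumes x: "x \<in> carrier_vec N" and z: "z \<in> carrier_vec N"
    and f: "\<And>t. t \<noteq> 0 \<Longrightarrow> c t *\<^sub>v x = f t" and lim: "\<And>i. i < N \<Longrightarrow> ((\<lambda>t. f t $ i) \<longlongrightarrow> z $ i) (at 0)"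
  shows "p *\<^sub>v x = z"
proof (intro eq_vecI)
  fix i assume "i < dim_vec z"
  then have i: "i < N" using z by simp
  have "((\<lambda>t. (c t *\<^sub>v x) $ i) \<longlongrightarrow> z $ i) (at 0)"
    by (rule Lim_transform_eventually[OF lim[OF i]]) (auto simp: eventually_at_filter f)
  then show "(p *\<^sub>v x) $ i = z $ i"
    using c_vec_tendsto[OF x i] tendsto_unique[of "at (0::complex)"] by auto
qed (use z p_carrier in auto)

lemma p_V0: "x \<in> V0 \<Longrightarrow> p *\<^sub>v x = x"
  by (rule p_eqI[of _ _ "\<lambda>_. x"]) (auto simp: V0_carrier c_V0)

text \<open>Reparametrization of the limit: c s (p x) is the limit of c s (c (t / s) x) = c t x, and
  t / s tends to 0 together with t.\<close>

lemma p_in_V0: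
  assumes x: "x \<in> carrier_vec N" shows "p *\<^sub>v x \<in> V0"
proof -
  have "c s *\<^sub>v (p *\<^sub>v x) = p *\<^sub>v x" if s: "s \<noteq> 0" for s
  proof (rule p_eqI[OF x, symmetric])
    show "c s *\<^sub>v (p *\<^sub>v x) \<in> carrier_vec N" by (intro c_vec_carrier p_vec_carrier x)
    show "c t *\<^sub>v x = c s *\<^sub>v (c (t / s) *\<^sub>v x)" if "t \<noteq> 0" for t
      using that s x by (simp add: c_mult)
    fix i assume i: "i < N"
    have "filterlim (\<lambda>t. t / s) (at 0) (at 0)"
      unfolding filterlim_at
    proof
      have "((\<lambda>t. t / s) \<longlongrightarrow> 0 / s) (at 0)" by (intro tendsto_intros s)
      then show "((\<lambda>t. t / s) \<longlongrightarrow> 0) (at 0)" by simp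
    qed (use s in \<open>auto simp: eventually_at_filter\<close>)
    then have "((\<lambda>t. (c (t / s) *\<^sub>v x) $ j) \<longlongrightarrow> (p *\<^sub>v x) $ j) (at 0)" if "j < N" for j
      by (rule filterlim_compose[OF c_vec_tendsto[OF x that]])
    then show "((\<lambda>t. (c s *\<^sub>v (c (t / s) *\<^sub>v x)) $ i) \<longlongrightarrow> (c s *\<^sub>v (p *\<^sub>v x)) $ i) (at 0)"
      by (intro vec_mat_tendsto[OF c_carrier _ _ _ i] c_vec_carrier p_vec_carrier x)
  qed
  then show ?thesis using x by (simp add: V0_def p_vec_carrier)
qed

lemma p_emb:
  assumes x: "x \<in> carrier_vec N" and A: "A \<in> carrier (GL n)" and d: "d \<noteq> 0"
  shows "p *\<^sub>v (act R (emb A d) *\<^sub>v x) = act R (emb A d) *\<^sub>v (p *\<^sub>v x)"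
  by (rule p_eqI[of _ _ "\<lambda>t. act R (emb A d) *\<^sub>v (c t *\<^sub>v x)"])
    (auto simp: rvc emb_GL A d x c_emb p_vec_carrier c_vec_carrier c_vec_tendsto
      intro!: vec_mat_tendsto[OF rc[OF emb_GL[OF A d]]] simp del: index_mult_mat_vec)

text \<open>The projection forgets the lower unipotent factor. Hence after projecting, the big cell
  contributes only its Levi factor, which is what makes the image irreducible for GL(n).\<close>

lemma p_lo:
  assumes x: "x \<in> V0" and y: "y \<in> carrier_mat 1 n"
  shows "p *\<^sub>v (act R (lo n y) *\<^sub>v x) = x"
proof (rule p_eqI)
  show "act R (lo n y) *\<^sub>v x \<in> carrier_vec N" by (intro rvc lo_GL y V0_carrier x)
  show "c t *\<^sub>v (act R (lo n y) *\<^sub>v x) = act R (lo n (t \<cdot>\<^sub>m y)) *\<^sub>v x" if "t \<noteq> 0" for t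
    using that by (simp add: c_lo y V0_carrier[OF x] c_V0[OF x])
  show "x \<in> carrier_vec N" by (rule V0_carrier[OF x])
qed (rule lo_tendsto[OF V0_carrier[OF x] y])

text \<open>The coordinates of \<open>act R (up n (s \<cdot>\<^sub>m z)) *\<^sub>v x\<close> are polynomials in \<open>s\<close> which, since
  \<open>act R (up n (inverse t \<cdot>\<^sub>m z)) *\<^sub>v x = c t *\<^sub>v (act R (up n z) *\<^sub>v x)\<close>, have a finite limit at
  infinity.\<close>

lemma up_V0:
  assumes x: "x \<in> V0" and z: "z \<in> carrier_mat n 1"
  shows "act R (up n z) *\<^sub>v x = x"
proof (intro eq_vecI)
  note xc = V0_carrier[OF x]
  have uc: "act R (up n z') *\<^sub>v x \<in> carrier_vec N" if "z' \<in> carrier_mat n 1" for z'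
    using that by (intro rvc up_GL xc)
  then show "dim_vec (act R (up n z) *\<^sub>v x) = dim_vec x" using carrier_vecD[OF uc[OF z]] carrier_vecD[OF xc] by (simp del: dim_mult_mat_vec)
  fix i assume "i < dim_vec x"
  then have i: "i < N" using xc by simp
  have "regular_on (Suc n) (\<lambda>g. unit_vec N i \<bullet> (act R g *\<^sub>v x))"
    using xc by (intro rep_coefficient_regular[OF R]) auto
  from regular_on_up_poly[OF this z] obtain q where
    "\<And>s. unit_vec N i \<bullet> (act R (up n (s \<cdot>\<^sub>m z)) *\<^sub>v x) = poly q s" by blast
  then have q: "(act R (up n (s \<cdot>\<^sub>m z)) *\<^sub>v x) $ i = poly q s" for s
    using i uc z by (simp add: scalar_prod_left_unit[of _ N] del: index_mult_mat_vec)
  have "((\<lambda>t. (c t *\<^sub>v (act R (up n z) *\<^sub>v x)) $ i) \<longlongrightarrow> (p *\<^sub>v (act R (up n z) *\<^sub>v x)) $ i) (at 0)"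
    by (rule c_vec_tendsto[OF uc[OF z] i])
  then have "((\<lambda>t. poly q (inverse t)) \<longlongrightarrow> (p *\<^sub>v (act R (up n z) *\<^sub>v x)) $ i) (at 0)"
    by (rule Lim_transform_eventually)
      (auto simp: eventually_at_filter c_up[OF _ z xc] c_V0[OF x] q simp del: index_mult_mat_vec)
  \<comment> \<open>The values at s = 1 and s = 0 compare \<open>up n z\<close> with the
    identity.\<close>
  from poly_bounded_at_infinity_const[OF this, of 1]
  have "(act R (up n (1 \<cdot>\<^sub>m z)) *\<^sub>v x) $ i = (act R (up n (0 \<cdot>\<^sub>m z)) *\<^sub>v x) $ i" by (simp only: q)
  moreover have "1 \<cdot>\<^sub>m z = z" by (intro eq_matI) auto
  moreover have "up n (0 \<cdot>\<^sub>m z) = 1\<^sub>m (Suc n)" using z by (intro eq_matI) (auto simp: up_def less_Suc_eq)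
  ultimately show "(act R (up n z) *\<^sub>v x) $ i = x $ i" using xc by (simp add: rep_one[OF R])
qed

text \<open>The last torus coordinate acts on \<open>V0\<close> by a scalar, so invariance under
  GL(n) is the same as invariance under the Levi subgroup.\<close>

lemma emb_V0_scalar:
  assumes x: "x \<in> V0" and A: "A \<in> carrier (GL n)" and d: "d \<noteq> 0"
  shows "act R (emb A d) *\<^sub>v x = (d powi k) \<cdot>\<^sub>v (act R (emb A 1) *\<^sub>v x)"
proof -
  note xc = V0_carrier[OF x]
  have "(d powi k) \<cdot>\<^sub>v x = (d powi k) \<cdot>\<^sub>v (c d *\<^sub>v x)" using c_V0[OF x d] by simp
  also have "\<dots> = act R (emb (1\<^sub>m n) d) *\<^sub>v x"
    using d xc by (simp add: c_vec smult_smult_assoc power_int_add[symmetric])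
  finally have "act R (emb A 1) *\<^sub>v (act R (emb (1\<^sub>m n) d) *\<^sub>v x) = (d powi k) \<cdot>\<^sub>v (act R (emb A 1) *\<^sub>v x)"
    using mult_mat_vec[OF rc[OF emb_GL[OF A, of 1]] xc] by (metis one_neq_zero)
  moreover have "emb A 1 * emb (1\<^sub>m n) d = emb A d" using A by (simp add: emb_mult[of _ n] carrier_GL_iff right_mult_one_mat[of _ n n])
  ultimately show ?thesis using rep_mult_vec[OF R emb_GL[OF A, of 1] emb_one_GL[OF d] xc] by simp
qed

text \<open>For a left inverse \<open>F0\<close> of a basis matrix \<open>E\<close> of
  \<open>V0\<close>, the product \<open>E * F0\<close> is some projection onto \<open>V0\<close>,
  with an uncontrolled kernel. Replacing \<open>F0\<close> by \<open>F0 * p\<close> corrects the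
  kernel, and \<open>F0 * p * E\<close> is still 1 because \<open>p\<close> fixes
  \<open>V0\<close>.\<close>

lemma splitting:
  obtains K E F where "E \<in> carrier_mat N K" "F \<in> carrier_mat K N" "F * E = 1\<^sub>m K" "E * F = p"
proof -
  obtain K E F0 where E: "E \<in> carrier_mat N K" and F0: "F0 \<in> carrier_mat K N" and FE: "F0 * E = 1\<^sub>m K"
    and EV: "\<And>x. x \<in> carrier_vec K \<Longrightarrow> E *\<^sub>v x \<in> V0" and EF: "\<And>x. x \<in> V0 \<Longrightarrow> E *\<^sub>v (F0 *\<^sub>v x) = x"
    using subspace_splitting[OF subspace_V0] by metis
  show ?thesis
  proof (rule that[OF E])
    show "F0 * p \<in> carrier_mat K N" using F0 p_carrier by auto
    show "F0 * p * E = 1\<^sub>m K"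
    proof (rule mat_eq_by_vec)
      fix x :: "complex vec" assume x: "x \<in> carrier_vec K"
      have "(F0 * p * E) *\<^sub>v x = F0 *\<^sub>v (p *\<^sub>v (E *\<^sub>v x))" using E F0 p_carrier x by (intro mult3_mat_vec) auto
      also have "\<dots> = (F0 * E) *\<^sub>v x" using E F0 x by (simp add: p_V0 EV)
      finally show "(F0 * p * E) *\<^sub>v x = 1\<^sub>m K *\<^sub>v x" by (simp add: FE)
    qed (use E F0 p_carrier in auto)
    show "E * (F0 * p) = p"
    proof (rule mat_eq_by_vec)
      fix x :: "complex vec" assume x: "x \<in> carrier_vec N"
      have "(E * (F0 * p)) *\<^sub>v x = E *\<^sub>v (F0 *\<^sub>v (p *\<^sub>v x))"
        using E F0 p_carrier x mult3_mat_vec[OF E F0 p_carrier x] by simp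
      also have "\<dots> = p *\<^sub>v x" using x by (simp add: EF p_in_V0)
      finally show "(E * (F0 * p)) *\<^sub>v x = p *\<^sub>v x" .
    qed (use E F0 p_carrier in auto)
  qed
qed

end

text \<open>The action of GL(n) on the image of the projection \<open>E * F\<close>, in the
  coordinates given by the columns of \<open>E\<close>.\<close>

definition compress :: "rep \<Rightarrow> complex mat \<Rightarrow> complex mat \<Rightarrow> rep" where
  "compress R E F = \<lparr> rdim = dim_row F, act = (\<lambda>g. F * act R (emb g 1) * E) \<rparr>"

locale parabolic_splitting = parabolic_highest_vector +
  fixes K :: nat and E F :: "complex mat"
  assumes E: "E \<in> carrier_mat N K" and F: "F \<in> carrier_mat K N"
    and FE: "F * E = 1\<^sub>m K" and EF: "E * F = p"
begin

abbreviation R0 where "R0 \<equiv> compress R E F"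

lemma rdim_R0: "rdim R0 = K"
  using F by (simp add: compress_def)

lemma F_E_vec: "x \<in> carrier_vec K \<Longrightarrow> F *\<^sub>v (E *\<^sub>v x) = x"
  using assoc_mult_mat_vec[OF F E, of x] by (simp add: FE)

lemma E_F_vec: "x \<in> carrier_vec N \<Longrightarrow> E *\<^sub>v (F *\<^sub>v x) = p *\<^sub>v x"
  using assoc_mult_mat_vec[OF E F, of x] by (simp add: EF)

lemma F_p_vec: "x \<in> carrier_vec N \<Longrightarrow> F *\<^sub>v (p *\<^sub>v x) = F *\<^sub>v x"
  using F_E_vec[of "F *\<^sub>v x"] F by (simp add: E_F_vec)

lemma E_V0: "x \<in> carrier_vec K \<Longrightarrow> E *\<^sub>v x \<in> V0"
  using E_F_vec[of "E *\<^sub>v x"] p_in_V0[of "E *\<^sub>v x"] E by (simp add: F_E_vec)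

lemma E_F_V0: "x \<in> V0 \<Longrightarrow> E *\<^sub>v (F *\<^sub>v x) = x"
  by (simp add: E_F_vec V0_carrier p_V0)

lemma F_vec_carrier: "x \<in> carrier_vec N \<Longrightarrow> F *\<^sub>v x \<in> carrier_vec K"
  using F by auto

lemma R0_carrier: "g \<in> carrier (GL n) \<Longrightarrow> act R0 g \<in> carrier_mat K K"
  using E F rc[OF emb_GL[of g n 1]] by (simp add: compress_def)

lemma R0_vec:
  "g \<in> carrier (GL n) \<Longrightarrow> x \<in> carrier_vec K \<Longrightarrow> act R0 g *\<^sub>v x = F *\<^sub>v (act R (emb g 1) *\<^sub>v (E *\<^sub>v x))"
  using mult3_mat_vec[OF F rc[OF emb_GL[of g n 1]] E, of x] by (simp add: compress_def)

lemma R0_F_vec: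
  "g \<in> carrier (GL n) \<Longrightarrow> x \<in> V0 \<Longrightarrow> act R0 g *\<^sub>v (F *\<^sub>v x) = F *\<^sub>v (act R (emb g 1) *\<^sub>v x)"
  by (simp add: R0_vec F_vec_carrier V0_carrier E_F_V0)

text \<open>In the product of two compressed operators a factor \<open>E * F\<close> appears in the
  middle. It acts there as the identity, because \<open>emb h 1\<close> maps \<open>V0\<close> to
  itself.\<close>

lemma is_rep_R0: "is_rep n R0"
proof (rule is_repI)
  show "act R0 g \<in> carrier_mat (rdim R0) (rdim R0)" if "g \<in> carrier (GL n)" for g
    using R0_carrier[OF that] by (simp add: rdim_R0)
  show "act R0 (1\<^sub>m n) = 1\<^sub>m (rdim R0)"
    using F unfolding rdim_R0 by (simp add: compress_def emb_one_one rep_one[OF R] FE)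
next
  fix g h assume g: "g \<in> carrier (GL n)" and h: "h \<in> carrier (GL n)"
  have gh: "emb (g * h) 1 = emb g 1 * emb h 1"
    using g h by (simp add: emb_mult[of _ n] carrier_GL_iff)
  show "act R0 (g * h) = act R0 g * act R0 h"
  proof (rule mat_eq_by_vec)
    fix x :: "complex vec" assume x: "x \<in> carrier_vec K"
    have V: "act R (emb h 1) *\<^sub>v (E *\<^sub>v x) \<in> V0" using x h by (intro emb_V0 E_V0) auto
    have "act R0 (g * h) *\<^sub>v x = F *\<^sub>v (act R (emb g 1) *\<^sub>v (act R (emb h 1) *\<^sub>v (E *\<^sub>v x)))"
      using g h x by (simp add: R0_vec mult_in_GL gh rep_mult_vec[OF R] emb_GL V0_carrier[OF E_V0])
    also have "\<dots> = act R0 g *\<^sub>v (act R0 h *\<^sub>v x)"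
      using R0_F_vec[OF g V] h x by (simp add: R0_vec)
    finally show "act R0 (g * h) *\<^sub>v x = (act R0 g * act R0 h) *\<^sub>v x"
      using x R0_carrier g h by (simp add: assoc_mult_mat_vec[of _ K K _ K])
  qed (use R0_carrier[OF mult_in_GL[OF g h]] R0_carrier[OF g] R0_carrier[OF h] in auto)
next
  fix i j assume ij: "i < rdim R0" "j < rdim R0"
  have rF: "row F i \<in> carrier_vec N" and cE: "col E j \<in> carrier_vec N"
    using E F ij by (auto simp: rdim_R0)
  have "regular_on n (\<lambda>g. row F i \<bullet> (act R (emb g 1) *\<^sub>v col E j))"
    by (rule regular_on_emb[OF rep_coefficient_regular[OF R rF cE]])
  moreover have "act R0 g $$ (i, j) = row F i \<bullet> (act R (emb g 1) *\<^sub>v col E j)"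
    if g: "g \<in> carrier (GL n)" for g
  proof -
    have G: "act R (emb g 1) \<in> carrier_mat N N" using rc emb_GL g by auto
    have "act R0 g = F * (act R (emb g 1) * E)" using E F G by (simp add: compress_def)
    then have "act R0 g $$ (i, j) = row F i \<bullet> col (act R (emb g 1) * E) j"
      using E F G ij unfolding rdim_R0 by simp
    also have "col (act R (emb g 1) * E) j = act R (emb g 1) *\<^sub>v col E j"
      using ij by (intro col_mult2[OF G E]) (simp add: rdim_R0)
    finally show ?thesis .
  qed
  ultimately show "regular_on n (\<lambda>g. act R0 g $$ (i, j))" by (subst regular_on_cong) auto
qed

text \<open>A nonzero w in an invariant W lifts to x = E w in \<open>V0\<close>. By
  \<open>up_V0\<close> every such x, and not only v, is fixed by the upper radical, so the big cell
  spans the whole space from x. Under \<open>F\<close> the lower factor disappears and the last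
  torus coordinate becomes a scalar, so all of it lands in W.\<close>

lemma irreducible_R0: "irreducible_rep n R0"
  unfolding irreducible_rep_def
proof (intro conjI allI impI)
  show "is_rep n R0" by (rule is_rep_R0)
  have "K \<noteq> 0"
  proof
    assume "K = 0"
    then have "E *\<^sub>v (F *\<^sub>v v) = 0\<^sub>v N" using E F by (intro eq_vecI) (auto simp: scalar_prod_def)
    then show False using v E_F_V0[OF v_V0] by simp
  qed
  then show "0 < rdim R0" by (simp add: rdim_R0)
next
  fix W assume sub: "is_subspace (rdim R0) W" and inv: "\<forall>g\<in>carrier (GL n). \<forall>w\<in>W. act R0 g *\<^sub>v w \<in> W"
  have W: "W \<subseteq> carrier_vec K" "0\<^sub>v K \<in> W" "\<And>x y. x \<in> W \<Longrightarrow> y \<in> W \<Longrightarrow> x + y \<in> W"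
    "\<And>a x. x \<in> W \<Longrightarrow> a \<cdot>\<^sub>v x \<in> W"
    using sub by (auto simp: subspace_vec_iff rdim_R0)
  show "W = {0\<^sub>v (rdim R0)} \<or> W = carrier_vec (rdim R0)"
  proof (cases "W = {0\<^sub>v K}")
    case False
    then obtain w where w: "w \<in> W" "w \<noteq> 0\<^sub>v K" using W by auto
    have wK: "w \<in> carrier_vec K" using w W by auto
    define x where "x = E *\<^sub>v w"
    have x: "x \<in> V0" and Fx: "F *\<^sub>v x = w" using wK by (auto simp: x_def E_V0 F_E_vec)
    have x0: "x \<noteq> 0\<^sub>v N" using Fx w mult_mat_zero_vec[OF F] by auto
    define U where "U = {z \<in> carrier_vec N. F *\<^sub>v z \<in> W}"
    have U: "U = carrier_vec N"
    proof (rule irreducible_big_cell_span[OF irr V0_carrier[OF x] x0 up_V0[OF x]])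
      show "is_subspace N U" unfolding subspace_vec_iff U_def
        by (auto simp: mult_mat_zero_vec[OF F] mult_add_distrib_mat_vec[OF F] mult_mat_vec[OF F] W)
      fix y A :: "complex mat" and d :: complex
      assume h: "y \<in> carrier_mat 1 n" "A \<in> carrier (GL n)" "d \<noteq> 0"
      let ?z = "act R (emb A d) *\<^sub>v x"
      have z: "?z \<in> V0" using h x by (intro emb_V0)
      have c: "act R (lo n y) *\<^sub>v ?z \<in> carrier_vec N" using h z by (intro rvc lo_GL V0_carrier)
      have "F *\<^sub>v (act R (lo n y) *\<^sub>v ?z) = F *\<^sub>v ?z"
        using F_p_vec[OF c] by (simp add: p_lo[OF z h(1)])
      also have "\<dots> = (d powi k) \<cdot>\<^sub>v (act R0 A *\<^sub>v w)"
        using h x wK by (simp add: emb_V0_scalar[of x A d] R0_vec x_def[symmetric] mult_mat_vec[OF F] rvc emb_GL V0_carrier)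
      finally show "act R (lo n y) *\<^sub>v ?z \<in> U" using c inv h w by (simp add: U_def W)
    qed
    have "a \<in> W" if a: "a \<in> carrier_vec K" for a
    proof -
      have "E *\<^sub>v a \<in> U" using a by (simp add: U V0_carrier E_V0)
      then show ?thesis using a by (simp add: U_def F_E_vec)
    qed
    then show ?thesis using W by (auto simp: rdim_R0)
  qed (simp add: rdim_R0)
qed

text \<open>On the big cell the projected orbit of v depends only on d and on the action of A in the
  compressed representation. This is how information on GL(n) determines coefficients on GL(n +
  1).\<close>

lemma F_big_cell:
  assumes "y \<in> carrier_mat 1 n" "A \<in> carrier (GL n)" "d \<noteq> 0" "x \<in> carrier_mat n 1"
  shows "F *\<^sub>v (act R (lo n y * (emb A d * up n x)) *\<^sub>v v) = (d powi k) \<cdot>\<^sub>v (act R0 A *\<^sub>v (F *\<^sub>v v))"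
proof -
  let ?z = "act R (emb A d) *\<^sub>v v"
  have z: "?z \<in> V0" using assms v_V0 by (intro emb_V0)
  have c: "act R (lo n y) *\<^sub>v ?z \<in> carrier_vec N" using assms z by (intro rvc lo_GL V0_carrier)
  have "act R (lo n y * (emb A d * up n x)) *\<^sub>v v = act R (lo n y) *\<^sub>v ?z"
    using assms v by (simp add: rep_mult_vec[OF R] mult_in_GL lo_GL emb_GL up_GL unip)
  then have "F *\<^sub>v (act R (lo n y * (emb A d * up n x)) *\<^sub>v v) = F *\<^sub>v ?z"
    using F_p_vec[OF c] by (simp add: p_lo[OF z assms(1)])
  also have "\<dots> = (d powi k) \<cdot>\<^sub>v (F *\<^sub>v (act R (emb A 1) *\<^sub>v v))"
    using assms v_V0 by (simp add: emb_V0_scalar[of v A d] mult_mat_vec[OF F] rvc emb_GL V0_carrier)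
  finally show ?thesis using R0_F_vec[OF assms(2) v_V0] by simp
qed

lemma F_v_nonzero: "F *\<^sub>v v \<noteq> 0\<^sub>v K"
  using E_F_V0[OF v_V0] v mult_mat_zero_vec[OF E] by auto

end

section \<open>Uniqueness of highest weight representations\<close>

lemma highest_weight_vector_parabolic:
  assumes irr: "irreducible_rep (Suc n) R" and hw: "highest_weight_vector (Suc n) R \<nu> v"
  shows "parabolic_highest_vector n R (\<nu> ! n) v"
proof
  show "act R (emb (1\<^sub>m n) d) *\<^sub>v v = (d powi (\<nu> ! n)) \<cdot>\<^sub>v v" if d: "d \<noteq> 0" for d
  proof -
    have "diagonal_mat (emb (1\<^sub>m n) d)" by (auto simp: diagonal_mat_def emb_def less_Suc_eq)
    moreover have "(\<Prod>i<Suc n. emb (1\<^sub>m n) d $$ (i, i) powi (\<nu> ! i)) = d powi (\<nu> ! n)"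
      by (simp add: emb_def lessThan_Suc)
    ultimately show ?thesis using hw emb_one_GL[OF d] by (simp add: highest_weight_vector_def)
  qed
  show "act R (up n x) *\<^sub>v v = v" if x: "x \<in> carrier_mat n 1" for x
  proof -
    have "upper_triangular (up n x)" "\<forall>i<Suc n. up n x $$ (i, i) = 1"
      using x by (auto simp: upper_triangular_def up_def less_Suc_eq)
    then show ?thesis using hw up_GL[OF x] by (simp add: highest_weight_vector_def)
  qed
qed (use irr hw in \<open>auto simp: highest_weight_vector_def\<close>)

lemma (in parabolic_highest_vector) parabolic_splitting_exists:
  obtains K E F where "parabolic_splitting n R k v K E F"
proof -
  obtain K E F where EF: "E \<in> carrier_mat N K" "F \<in> carrier_mat K N" "F * E = 1\<^sub>m K" "E * F = p"
    using splitting by blast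
  have "parabolic_splitting n R k v K E F" by unfold_locales (fact EF)+
  then show ?thesis by (rule that)
qed

text \<open>The list \<nu> can stay untruncated, since a highest weight vector for
  \<open>GL n\<close> reads only its first n entries.\<close>

lemma (in parabolic_splitting) highest_weight_vector_R0:
  assumes hw: "highest_weight_vector (Suc n) R \<nu> v"
  shows "highest_weight_vector n R0 \<nu> (F *\<^sub>v v)"
  unfolding highest_weight_vector_def rdim_R0
proof (intro conjI ballI impI)
  show "F *\<^sub>v v \<in> carrier_vec K" by (rule F_vec_carrier[OF v(1)])
  show "F *\<^sub>v v \<noteq> 0\<^sub>v K" by (rule F_v_nonzero)
next
  fix t assume t: "t \<in> carrier (GL n)" "diagonal_mat t"
  have tc: "t \<in> carrier_mat n n" using t by (simp add: carrier_GL_iff)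
  have "diagonal_mat (emb t 1)" using t(2) tc by (auto simp: diagonal_mat_def emb_def less_Suc_eq)
  then have "act R (emb t 1) *\<^sub>v v = (\<Prod>i<Suc n. emb t 1 $$ (i, i) powi (\<nu> ! i)) \<cdot>\<^sub>v v"
    using hw emb_GL[OF t(1), of 1] by (simp add: highest_weight_vector_def)
  also have "(\<Prod>i<Suc n. emb t 1 $$ (i, i) powi (\<nu> ! i)) = (\<Prod>i<n. t $$ (i, i) powi (\<nu> ! i))"
    using tc by (simp add: emb_def lessThan_Suc)
  finally show "act R0 t *\<^sub>v (F *\<^sub>v v) = (\<Prod>i<n. t $$ (i, i) powi (\<nu> ! i)) \<cdot>\<^sub>v (F *\<^sub>v v)"
    using v by (simp add: R0_F_vec[OF t(1) v_V0] mult_mat_vec[OF F])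
next
  fix u assume u: "u \<in> carrier (GL n)" "upper_triangular u" "\<forall>i<n. u $$ (i, i) = 1"
  have uc: "u \<in> carrier_mat n n" using u by (simp add: carrier_GL_iff)
  have "upper_triangular (emb u 1)" "\<forall>i<Suc n. emb u 1 $$ (i, i) = 1"
    using u(2,3) uc by (auto simp: upper_triangular_def emb_def less_Suc_eq)
  then have "act R (emb u 1) *\<^sub>v v = v"
    using hw emb_GL[OF u(1), of 1] by (simp add: highest_weight_vector_def)
  then show "act R0 u *\<^sub>v (F *\<^sub>v v) = F *\<^sub>v v" by (simp add: R0_F_vec[OF u(1) v_V0])
qed

text \<open>By induction the weight spaces cut out by \<open>diag(1, \<dots>, 1, t)\<close> are isomorphic; composing with
  the projections onto them gives matrix coefficients of \<open>R\<close> and \<open>S\<close> that agree on the big cell.\<close>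

theorem highest_weight_unique:
  assumes "irreducible_rep m R" "irreducible_rep m S"
    and "highest_weight_vector m R \<nu> v" "highest_weight_vector m S \<nu> w"
  shows "rdim R = rdim S \<and> (\<exists>P \<in> carrier (GL (rdim R)). (\<forall>g \<in> carrier (GL m). P * act R g = act S g * P) \<and>
    P *\<^sub>v v = w)"
  using assms
proof (induction m arbitrary: R S v w)
  case 0
  have v: "v \<in> carrier_vec (rdim R)" "v \<noteq> 0\<^sub>v (rdim R)" and w: "w \<in> carrier_vec (rdim S)" "w \<noteq> 0\<^sub>v (rdim S)"
    using 0 by (auto simp: highest_weight_vector_def)
  \<comment> \<open>The group \<open>GL 0\<close> is trivial, so matching coefficients only requires
    functionals with the same nonzero value on v and w.\<close>
  have normalizing: "\<exists>Phi \<in> carrier_mat 1 N. Phi *\<^sub>v x = unit_vec 1 0"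
    if x: "x \<in> carrier_vec N" "x \<noteq> 0\<^sub>v N" for x :: "complex vec" and N
  proof -
    obtain i where i: "i < N" "x $ i \<noteq> 0" using x
      by (metis carrier_vecD eq_vecI index_zero_vec)
    define Phi where "Phi = mat 1 N (\<lambda>(_, j). if j = i then inverse (x $ i) else 0)"
    have "row Phi 0 \<bullet> x = (\<Sum>j = 0..<N. (if j = i then inverse (x $ i) else 0) * x $ j)"
      using x by (auto simp: Phi_def scalar_prod_def intro!: sum.cong)
    also have "\<dots> = (\<Sum>j = 0..<N. if j = i then 1 else 0)" using i by (intro sum.cong) auto
    also have "\<dots> = 1" using i by simp
    finally have "Phi *\<^sub>v x = unit_vec 1 0" by (intro eq_vecI) (auto simp: Phi_def)
    then show ?thesis by (intro bexI[of _ Phi]) (auto simp: Phi_def)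
  qed
  obtain Phi Psi where Phi: "Phi \<in> carrier_mat 1 (rdim R)" "Phi *\<^sub>v v = unit_vec 1 0"
    and Psi: "Psi \<in> carrier_mat 1 (rdim S)" "Psi *\<^sub>v w = unit_vec 1 0"
    using normalizing[OF v] normalizing[OF w] by blast
  show ?case
  proof (rule irreducible_equiv_by_coefficients[OF 0(1,2) Phi(1) Psi(1) v(1) w(1)])
    fix h :: "complex mat" assume "h \<in> carrier (GL 0)"
    then have "h = 1\<^sub>m 0" by (intro eq_matI) (auto simp: carrier_GL_iff)
    then show "Phi *\<^sub>v (act R h *\<^sub>v v) = Psi *\<^sub>v (act S h *\<^sub>v w)"
      using v w by (simp add: rep_one[OF irreducible_is_rep] 0 Phi Psi)
  qed (simp add: Phi)
next
  case (Suc n)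
  interpret pR: parabolic_highest_vector n R "\<nu> ! n" v
    by (rule highest_weight_vector_parabolic[OF Suc.prems(1,3)])
  interpret pS: parabolic_highest_vector n S "\<nu> ! n" w
    by (rule highest_weight_vector_parabolic[OF Suc.prems(2,4)])
  obtain KR ER FR where "parabolic_splitting n R (\<nu> ! n) v KR ER FR" by (rule pR.parabolic_splitting_exists)
  then interpret sR: parabolic_splitting n R "\<nu> ! n" v KR ER FR .
  obtain KS ES FS where "parabolic_splitting n S (\<nu> ! n) w KS ES FS" by (rule pS.parabolic_splitting_exists)
  then interpret sS: parabolic_splitting n S "\<nu> ! n" w KS ES FS .
  from Suc.IH[OF sR.irreducible_R0 sS.irreducible_R0 sR.highest_weight_vector_R0[OF Suc.prems(3)]
      sS.highest_weight_vector_R0[OF Suc.prems(4)]]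
  obtain P where K: "KR = KS" and PG: "P \<in> carrier (GL KR)"
    and P: "\<And>g. g \<in> carrier (GL n) \<Longrightarrow> P * act sR.R0 g = act sS.R0 g * P"
    and Pv: "P *\<^sub>v (FR *\<^sub>v v) = FS *\<^sub>v w"
    unfolding sR.rdim_R0 sS.rdim_R0 by blast
  have Pc: "P \<in> carrier_mat KR KR" using PG by (simp add: carrier_GL_iff)
  \<comment> \<open>The isomorphism P of the compressed representations carries the projected orbit
    of v into the space where the projected orbit of w lives, so the two can be compared.\<close>
  have Phi: "P * FR \<in> carrier_mat KR pR.N" using Pc sR.F by auto
  have Psi: "FS \<in> carrier_mat KR pS.N" using sS.F K by simp
  have Phi_vec: "(P * FR) *\<^sub>v x = P *\<^sub>v (FR *\<^sub>v x)" if "x \<in> carrier_vec pR.N" for x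
    using assoc_mult_mat_vec[OF Pc sR.F that] .
  show ?case
  proof (rule irreducible_equiv_by_coefficients[OF Suc.prems(1,2) Phi Psi pR.v(1) pS.v(1)])
    show "P * FR *\<^sub>v v \<noteq> 0\<^sub>v KR" using sS.F_v_nonzero by (simp add: Phi_vec pR.v Pv K)
    fix h assume h: "h \<in> carrier (GL (Suc n))"
    show "P * FR *\<^sub>v (act R h *\<^sub>v v) = FS *\<^sub>v (act S h *\<^sub>v w)"
    proof (intro eq_vecI)
      fix i assume "i < dim_vec (FS *\<^sub>v (act S h *\<^sub>v w))"
      then have i: "i < KR" using Psi by simp
      let ?f = "\<lambda>h. row (P * FR) i \<bullet> (act R h *\<^sub>v v) - row FS i \<bullet> (act S h *\<^sub>v w)"
      have reg: "regular_on (Suc n) ?f"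
        using i Phi Psi by (intro regular_on_diff rep_coefficient_regular[OF pR.R] 
            rep_coefficient_regular[OF pS.R] pR.v pS.v) auto
      have "?f h = 0"
      proof (rule regular_zero_on_big_cell[OF reg _ h])
        fix y A x :: "complex mat" and d :: complex
        assume a: "y \<in> carrier_mat 1 n" "A \<in> carrier (GL n)" "d \<noteq> 0" "x \<in> carrier_mat n 1"
        let ?h = "lo n y * (emb A d * up n x)"
        have hG: "?h \<in> carrier (GL (Suc n))" using a by (intro mult_in_GL lo_GL emb_GL up_GL)
        have FRv: "FR *\<^sub>v v \<in> carrier_vec KR" by (rule sR.F_vec_carrier[OF pR.v(1)])
        have RA: "act sR.R0 A \<in> carrier_mat KR KR" and SA: "act sS.R0 A \<in> carrier_mat KR KR"
          using sR.R0_carrier[OF a(2)] sS.R0_carrier[OF a(2)] K by auto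
        \<comment> \<open>Both sides carry the same power of d, because both highest weights end in
          the same entry, and P turns the action of A on one side into that on the other.\<close>
        have "(P * FR) *\<^sub>v (act R ?h *\<^sub>v v) = P *\<^sub>v ((d powi (\<nu> ! n)) \<cdot>\<^sub>v (act sR.R0 A *\<^sub>v (FR *\<^sub>v v)))"
          using pR.rvc[OF hG pR.v(1)] by (simp add: Phi_vec sR.F_big_cell[OF a])
        also have "\<dots> = (d powi (\<nu> ! n)) \<cdot>\<^sub>v (P *\<^sub>v (act sR.R0 A *\<^sub>v (FR *\<^sub>v v)))"
          using RA FRv by (intro mult_mat_vec[OF Pc]) auto
        also have "P *\<^sub>v (act sR.R0 A *\<^sub>v (FR *\<^sub>v v)) = act sS.R0 A *\<^sub>v (P *\<^sub>v (FR *\<^sub>v v))"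
          using P[OF a(2)] assoc_mult_mat_vec[OF Pc RA FRv] assoc_mult_mat_vec[OF SA Pc FRv] by simp
        also have "(d powi (\<nu> ! n)) \<cdot>\<^sub>v \<dots> = FS *\<^sub>v (act S ?h *\<^sub>v w)"
          by (simp add: Pv sS.F_big_cell[OF a])
        finally have "((P * FR) *\<^sub>v (act R ?h *\<^sub>v v)) $ i = (FS *\<^sub>v (act S ?h *\<^sub>v w)) $ i" by simp
        then show "?f ?h = 0" using i Pc Psi by simp
      qed
      then show "(P * FR *\<^sub>v (act R h *\<^sub>v v)) $ i = (FS *\<^sub>v (act S h *\<^sub>v w)) $ i"
        using i Pc Psi by simp
    qed (use Phi Psi in auto)
  qed
qed

corollary is_irrep_hw_equiv:
  assumes "is_irrep_hw m \<nu> R" "is_irrep_hw m \<nu> S"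
  shows "rep_equiv m R S"
proof -
  obtain v w where "highest_weight_vector m R \<nu> v" "highest_weight_vector m S \<nu> w"
    using assms by (auto simp: is_irrep_hw_def)
  then show ?thesis using highest_weight_unique[of m R S \<nu> v w] assms
    unfolding is_irrep_hw_def rep_equiv_def by blast
qed

text \<open>\<open>R0\<close> is the representation of \<open>GL n\<close> on the limit of \<open>R (diag(1, \<dots>, 1, t))\<close> as \<open>t\<close> tends to 0,
  i.e. on the vectors of weight 0 for the last coordinate, when all such weights are nonnegative.\<close>

definition zero_weight_part :: "nat \<Rightarrow> rep \<Rightarrow> rep \<Rightarrow> bool" where
  "zero_weight_part n R R0 \<longleftrightarrow>
     (\<forall>g \<in> carrier (GL (Suc n)). act R g \<in> carrier_mat (rdim R) (rdim R)) \<and>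
     (\<exists>E F. E \<in> carrier_mat (rdim R) (rdim R0) \<and> F \<in> carrier_mat (rdim R0) (rdim R) \<and>
        F * E = 1\<^sub>m (rdim R0) \<and>
        (\<forall>i < rdim R. \<forall>j < rdim R. ((\<lambda>t. act R (emb (1\<^sub>m n) t) $$ (i, j)) \<longlongrightarrow> (E * F) $$ (i, j)) (at 0)) \<and>
        (\<forall>g \<in> carrier (GL n). (E * F) * act R (emb g 1) = act R (emb g 1) * (E * F) \<and>
           act R0 g = F * act R (emb g 1) * E))"

lemma zero_weight_partI:
  assumes "\<And>g. g \<in> carrier (GL (Suc n)) \<Longrightarrow> act R g \<in> carrier_mat (rdim R) (rdim R)"
    and "E \<in> carrier_mat (rdim R) (rdim R0)" "F \<in> carrier_mat (rdim R0) (rdim R)" "F * E = 1\<^sub>m (rdim R0)"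
    and "\<And>i j. i < rdim R \<Longrightarrow> j < rdim R \<Longrightarrow>
      ((\<lambda>t. act R (emb (1\<^sub>m n) t) $$ (i, j)) \<longlongrightarrow> (E * F) $$ (i, j)) (at 0)"
    and "\<And>g. g \<in> carrier (GL n) \<Longrightarrow> (E * F) * act R (emb g 1) = act R (emb g 1) * (E * F)"
    and "\<And>g. g \<in> carrier (GL n) \<Longrightarrow> act R0 g = F * act R (emb g 1) * E"
  shows "zero_weight_part n R R0"
  unfolding zero_weight_part_def using assms by blast

text \<open>When the last entry is 0 the rescaling factor in \<open>c\<close> is 1, so
  \<open>p\<close> is the limit of the action of diag(1, ..., 1, t) itself.\<close>

lemma irrep_hw_zero_weight_part:
  assumes irr: "is_irrep_hw (Suc n) \<nu> R" and last: "\<nu> ! n = 0"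
  shows "\<exists>R0. is_irrep_hw n (take n \<nu>) R0 \<and> zero_weight_part n R R0"
proof -
  obtain v where hw: "highest_weight_vector (Suc n) R \<nu> v" and iR: "irreducible_rep (Suc n) R"
    and dom: "dominant (Suc n) \<nu>"
    using irr by (auto simp: is_irrep_hw_def)
  interpret parabolic_highest_vector n R "\<nu> ! n" v
    by (rule highest_weight_vector_parabolic[OF iR hw])
  obtain K E F where "parabolic_splitting n R (\<nu> ! n) v K E F" by (rule parabolic_splitting_exists)
  then interpret s: parabolic_splitting n R "\<nu> ! n" v K E F .
  have dom': "dominant n (take n \<nu>)" using dom by (auto simp: dominant_def intro: sorted_wrt_take)
  have hw': "highest_weight_vector n s.R0 (take n \<nu>) (F *\<^sub>v v)"
    using s.highest_weight_vector_R0[OF hw] by (simp add: highest_weight_vector_def)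
  have irr': "is_irrep_hw n (take n \<nu>) s.R0"
    using dom' hw' s.irreducible_R0 by (auto simp: is_irrep_hw_def)
  moreover have "zero_weight_part n R s.R0"
  proof (rule zero_weight_partI[of n R E s.R0 F, unfolded s.rdim_R0])
    fix i j assume ij: "i < N" "j < N"
    have "c t $$ (i, j) = act R (emb (1\<^sub>m n) t) $$ (i, j)" if "t \<noteq> 0" for t
      using that ij rc[OF emb_one_GL[OF that]] unfolding c_def by (simp add: last)
    then have "eventually (\<lambda>t. c t $$ (i, j) = act R (emb (1\<^sub>m n) t) $$ (i, j)) (at 0)"
      by (simp add: eventually_at_filter)
    with c_tendsto[OF ij] have "((\<lambda>t. act R (emb (1\<^sub>m n) t) $$ (i, j)) \<longlongrightarrow> p $$ (i, j)) (at 0)"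
      by (rule Lim_transform_eventually)
    then show "((\<lambda>t. act R (emb (1\<^sub>m n) t) $$ (i, j)) \<longlongrightarrow> (E * F) $$ (i, j)) (at 0)"
      by (simp only: s.EF)
  next
    fix g assume g: "g \<in> carrier (GL n)"
    have G: "act R (emb g 1) \<in> carrier_mat N N" using rc[OF emb_GL[OF g]] by simp
    show "E * F * act R (emb g 1) = act R (emb g 1) * (E * F)"
      unfolding s.EF
    proof (rule mat_eq_by_vec)
      fix x :: "complex vec" assume x: "x \<in> carrier_vec N"
      show "(p * act R (emb g 1)) *\<^sub>v x = (act R (emb g 1) * p) *\<^sub>v x"
        using p_emb[OF x g, of 1] assoc_mult_mat_vec[OF p_carrier G x] assoc_mult_mat_vec[OF G p_carrier x] by simp
    qed (use G p_carrier in auto)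
    show "act s.R0 g = F * act R (emb g 1) * E" by (simp add: compress_def)
  qed (use rc s.E s.F s.FE in auto)
  ultimately show ?thesis by blast
qed

section \<open>Tensor products and direct sums\<close>

lemma kronecker_carrier:
  "A \<in> carrier_mat a b \<Longrightarrow> B \<in> carrier_mat c d \<Longrightarrow> kronecker A B \<in> carrier_mat (a * c) (b * d)"
  by (auto simp: kronecker_def)

lemma div_mod_less:
  fixes i :: nat assumes "i < a * c" shows "i div c < a" "i mod c < c"
proof -
  have "0 < c" using assms by (cases c) auto
  then show "i div c < a" "i mod c < c" using assms by (auto simp: less_mult_imp_div_less)
qed

lemma kronecker_index:
  "A \<in> carrier_mat a b \<Longrightarrow> B \<in> carrier_mat c d \<Longrightarrow> i < a * c \<Longrightarrow> j < b * d \<Longrightarrow>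
     kronecker A B $$ (i, j) = A $$ (i div c, j div d) * B $$ (i mod c, j mod d)"
  by (auto simp: kronecker_def)

lemma sum_div_mod:
  fixes f :: "nat \<Rightarrow> nat \<Rightarrow> complex"
  shows "(\<Sum>l = 0..<a * b. f (l div b) (l mod b)) = (\<Sum>i = 0..<a. \<Sum>j = 0..<b. f i j)"
proof -
  have "(\<Sum>i = 0..<a. \<Sum>j = 0..<b. f i j) = (\<Sum>(i, j) \<in> {0..<a} \<times> {0..<b}. f i j)"
    by (rule sum.cartesian_product)
  also have "\<dots> = (\<Sum>l = 0..<a * b. f (l div b) (l mod b))"
  proof (rule sum.reindex_bij_witness[of _ "\<lambda>l. (l div b, l mod b)" "\<lambda>(i, j). i * b + j"])
    fix p assume "p \<in> {0..<a} \<times> {0..<b}"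
    then obtain i j where p: "p = (i, j)" "i < a" "j < b" by auto
    have "i * b + j < Suc i * b" using p by simp
    also have "\<dots> \<le> a * b" using p by (intro mult_le_mono1) simp
    finally show "(case p of (i, j) \<Rightarrow> i * b + j) \<in> {0..<a * b}" using p by simp
    show "((case p of (i, j) \<Rightarrow> i * b + j) div b, (case p of (i, j) \<Rightarrow> i * b + j) mod b) = p" 
      using p by simp
    show "f ((case p of (i, j) \<Rightarrow> i * b + j) div b) ((case p of (i, j) \<Rightarrow> i * b + j) mod b) = (case p of (i, j) \<Rightarrow> f i j)" 
      using p by simp
  qed (auto simp: div_mod_less)
  finally show ?thesis ..
qed

text \<open>The mixed-product rule: the summation index l splits into (l div b', l mod b'), and the
  resulting double sum factors.\<close>

lemma kronecker_mult:
  assumes A: "A \<in> carrier_mat a b" and B: "B \<in> carrier_mat a' b'"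
    and C: "C \<in> carrier_mat b c" and D: "D \<in> carrier_mat b' c'"
  shows "kronecker (A * C) (B * D) = kronecker A B * kronecker C D"
proof (intro eq_matI)
  have AC: "A * C \<in> carrier_mat a c" and BD: "B * D \<in> carrier_mat a' c'" using assms by auto
  note AB = kronecker_carrier[OF A B] and CD = kronecker_carrier[OF C D]
  fix i j assume "i < dim_row (kronecker A B * kronecker C D)" "j < dim_col (kronecker A B * kronecker C D)"
  then have i: "i < a * a'" and j: "j < c * c'" using AB CD by auto
  have "(kronecker A B * kronecker C D) $$ (i, j) =
      (\<Sum>l = 0..<b * b'. kronecker A B $$ (i, l) * kronecker C D $$ (l, j))"
    using i j AB CD by (simp add: scalar_prod_def)
  also have "\<dots> = (\<Sum>l = 0..<b * b'. (A $$ (i div a', l div b') * C $$ (l div b', j div c')) *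
      (B $$ (i mod a', l mod b') * D $$ (l mod b', j mod c')))"
    using i j by (intro sum.cong) (auto simp: kronecker_index[OF A B] kronecker_index[OF C D])
  also have "\<dots> = (\<Sum>l = 0..<b. A $$ (i div a', l) * C $$ (l, j div c')) *
      (\<Sum>l' = 0..<b'. B $$ (i mod a', l') * D $$ (l', j mod c'))"
    by (subst sum_div_mod[of "\<lambda>l l'. (A $$ (i div a', l) * C $$ (l, j div c')) *
      (B $$ (i mod a', l') * D $$ (l', j mod c'))"]) (simp add: sum_product)
  also have "\<dots> = kronecker (A * C) (B * D) $$ (i, j)"
    using i j div_mod_less[OF i] div_mod_less[OF j] assms
    by (simp add: kronecker_index[OF AC BD] scalar_prod_def)
  finally show "kronecker (A * C) (B * D) $$ (i, j) = (kronecker A B * kronecker C D) $$ (i, j)" ..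
qed (use assms in \<open>auto simp: kronecker_def\<close>)

lemma kronecker_one: "kronecker (1\<^sub>m a) (1\<^sub>m b) = 1\<^sub>m (a * b)"
proof (intro eq_matI)
  fix i j assume "i < dim_row (1\<^sub>m (a * b) :: complex mat)" "j < dim_col (1\<^sub>m (a * b) :: complex mat)"
  then have ij: "i < a * b" "j < a * b" by auto
  have "i div b = j div b \<and> i mod b = j mod b \<longleftrightarrow> i = j" by (metis div_mult_mod_eq)
  then show "kronecker (1\<^sub>m a) (1\<^sub>m b) $$ (i, j) = 1\<^sub>m (a * b) $$ (i, j)"
    using ij div_mod_less[OF ij(1)] div_mod_less[OF ij(2)]
    by (auto simp: kronecker_index[of _ a a _ b b])
qed (auto simp: kronecker_def)

lemma act_tensor: "act (tensor_rep R S) g = kronecker (act R g) (act S g)"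
  and rdim_tensor: "rdim (tensor_rep R S) = rdim R * rdim S"
  by (simp_all add: tensor_rep_def)

text \<open>Entries of a Kronecker product are products of entries, so the limit is the Kronecker
  product of the two limits. In terms of weights: since both factors have only nonnegative
  exponents, exponent 0 in the product can arise only from exponent 0 in both.\<close>

lemma zero_weight_part_tensor:
  assumes R: "zero_weight_part n R R0" and S: "zero_weight_part n S S0"
  shows "zero_weight_part n (tensor_rep R S) (tensor_rep R0 S0)"
proof -
  let ?N = "rdim R" and ?M = "rdim S" and ?K = "rdim R0" and ?L = "rdim S0"
  from R obtain E F where
    Rc: "\<And>g. g \<in> carrier (GL (Suc n)) \<Longrightarrow> act R g \<in> carrier_mat ?N ?N"
    and E: "E \<in> carrier_mat ?N ?K" and F: "F \<in> carrier_mat ?K ?N" and FE: "F * E = 1\<^sub>m ?K"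
    and Rlim: "\<And>i j. i < ?N \<Longrightarrow> j < ?N \<Longrightarrow> ((\<lambda>t. act R (emb (1\<^sub>m n) t) $$ (i, j)) \<longlongrightarrow> (E * F) $$ (i, j)) (at 0)"
    and Rcomm: "\<And>g. g \<in> carrier (GL n) \<Longrightarrow> (E * F) * act R (emb g 1) = act R (emb g 1) * (E * F)"
    and R0: "\<And>g. g \<in> carrier (GL n) \<Longrightarrow> act R0 g = F * act R (emb g 1) * E"
    unfolding zero_weight_part_def by blast
  from S obtain E' F' where
    Sc: "\<And>g. g \<in> carrier (GL (Suc n)) \<Longrightarrow> act S g \<in> carrier_mat ?M ?M"
    and E': "E' \<in> carrier_mat ?M ?L" and F': "F' \<in> carrier_mat ?L ?M" and FE': "F' * E' = 1\<^sub>m ?L"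
    and Slim: "\<And>i j. i < ?M \<Longrightarrow> j < ?M \<Longrightarrow> ((\<lambda>t. act S (emb (1\<^sub>m n) t) $$ (i, j)) \<longlongrightarrow> (E' * F') $$ (i, j)) (at 0)"
    and Scomm: "\<And>g. g \<in> carrier (GL n) \<Longrightarrow> (E' * F') * act S (emb g 1) = act S (emb g 1) * (E' * F')"
    and S0: "\<And>g. g \<in> carrier (GL n) \<Longrightarrow> act S0 g = F' * act S (emb g 1) * E'"
    unfolding zero_weight_part_def by blast
  have EF: "E * F \<in> carrier_mat ?N ?N" and EF': "E' * F' \<in> carrier_mat ?M ?M" using E F E' F' by auto
  have kEF: "kronecker E E' * kronecker F F' = kronecker (E * F) (E' * F')"
    by (rule kronecker_mult[OF E E' F F', symmetric])
  show ?thesis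
  proof (rule zero_weight_partI[of n "tensor_rep R S" "kronecker E E'" "tensor_rep R0 S0" "kronecker F F'",
        unfolded act_tensor rdim_tensor])
    show "kronecker F F' * kronecker E E' = 1\<^sub>m (?K * ?L)"
      using kronecker_mult[OF F F' E E'] by (simp add: FE FE' kronecker_one)
  next
    fix i j assume ij: "i < ?N * ?M" "j < ?N * ?M"
    have "((\<lambda>t. act R (emb (1\<^sub>m n) t) $$ (i div ?M, j div ?M) * act S (emb (1\<^sub>m n) t) $$ (i mod ?M, j mod ?M)) \<longlongrightarrow>
        (E * F) $$ (i div ?M, j div ?M) * (E' * F') $$ (i mod ?M, j mod ?M)) (at 0)"
      by (intro tendsto_mult Rlim Slim div_mod_less[OF ij(1)] div_mod_less[OF ij(2)])
    then have lim: "((\<lambda>t. act R (emb (1\<^sub>m n) t) $$ (i div ?M, j div ?M) * act S (emb (1\<^sub>m n) t) $$ (i mod ?M, j mod ?M)) \<longlongrightarrow>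
        (kronecker E E' * kronecker F F') $$ (i, j)) (at 0)"
      by (simp only: kEF kronecker_index[OF EF EF' ij])
    \<comment> \<open>The entry formula needs the dimensions of both matrices, which are known on
      the group only; at t = 0 the argument is singular.\<close>
    have "act R (emb (1\<^sub>m n) t) $$ (i div ?M, j div ?M) * act S (emb (1\<^sub>m n) t) $$ (i mod ?M, j mod ?M) =
        kronecker (act R (emb (1\<^sub>m n) t)) (act S (emb (1\<^sub>m n) t)) $$ (i, j)" if "t \<noteq> 0" for t
      using kronecker_index[OF Rc[OF emb_one_GL[OF that]] Sc[OF emb_one_GL[OF that]] ij] by simp
    then show "((\<lambda>t. kronecker (act R (emb (1\<^sub>m n) t)) (act S (emb (1\<^sub>m n) t)) $$ (i, j)) \<longlongrightarrow>
        (kronecker E E' * kronecker F F') $$ (i, j)) (at 0)"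
      by (intro Lim_transform_eventually[OF lim]) (simp add: eventually_at_filter)
  next
    fix g assume g: "g \<in> carrier (GL n)"
    note Rg = Rc[OF emb_GL[OF g one_neq_zero]] and Sg = Sc[OF emb_GL[OF g one_neq_zero]]
    show "kronecker E E' * kronecker F F' * kronecker (act R (emb g 1)) (act S (emb g 1)) =
        kronecker (act R (emb g 1)) (act S (emb g 1)) * (kronecker E E' * kronecker F F')"
      unfolding kEF using kronecker_mult[OF EF EF' Rg Sg] kronecker_mult[OF Rg Sg EF EF']
      by (simp add: Rcomm g Scomm)
    have FR: "F * act R (emb g 1) \<in> carrier_mat ?K ?N" and FS: "F' * act S (emb g 1) \<in> carrier_mat ?L ?M"
      using F F' Rg Sg by auto
    show "kronecker (act R0 g) (act S0 g) =
        kronecker F F' * kronecker (act R (emb g 1)) (act S (emb g 1)) * kronecker E E'"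
      using kronecker_mult[OF FR FS E E'] kronecker_mult[OF F F' Rg Sg] by (simp add: R0 S0 g)
  qed (use Rc Sc E E' F F' in \<open>auto intro!: kronecker_carrier\<close>)
qed

section \<open>Block diagonal matrices and direct sums\<close>

definition diag2 :: "complex mat \<Rightarrow> complex mat \<Rightarrow> complex mat" where
  "diag2 A B = four_block_mat A (0\<^sub>m (dim_row A) (dim_col B)) (0\<^sub>m (dim_row B) (dim_col A)) B"

lemma diag2_carrier:
  "A \<in> carrier_mat a b \<Longrightarrow> B \<in> carrier_mat a' b' \<Longrightarrow> diag2 A B \<in> carrier_mat (a + a') (b + b')"
  by (auto simp: diag2_def)

lemma diag2_index:
  "A \<in> carrier_mat a b \<Longrightarrow> B \<in> carrier_mat a' b' \<Longrightarrow> i < a + a' \<Longrightarrow> j < b + b' \<Longrightarrow>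
     diag2 A B $$ (i, j) = (if i < a then if j < b then A $$ (i, j) else 0
       else if j < b then 0 else B $$ (i - a, j - b))"
  by (auto simp: diag2_def)

lemma diag2_mult:
  assumes A: "A \<in> carrier_mat a b" and B: "B \<in> carrier_mat a' b'"
    and C: "C \<in> carrier_mat b c" and D: "D \<in> carrier_mat b' c'"
  shows "diag2 (A * C) (B * D) = diag2 A B * diag2 C D"
proof -
  have "diag2 A B * diag2 C D = four_block_mat (A * C + 0\<^sub>m a b' * 0\<^sub>m b' c) (A * 0\<^sub>m b c' + 0\<^sub>m a b' * D)
      (0\<^sub>m a' b * C + B * 0\<^sub>m b' c) (0\<^sub>m a' b * 0\<^sub>m b c' + B * D)"
    using assms unfolding diag2_def by (subst mult_four_block_mat[of _ a b _ b' _ a' _ _ c _ c']) auto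
  also have "\<dots> = diag2 (A * C) (B * D)"
    unfolding diag2_def using assms by (intro cong_four_block_mat) auto
  finally show ?thesis ..
qed

lemma diag2_one: "diag2 (1\<^sub>m a) (1\<^sub>m b) = 1\<^sub>m (a + b)"
  by (simp add: diag2_def)

lemma act_direct_sum_Cons: "act (direct_sum_rep (R # Rs)) g = diag2 (act R g) (act (direct_sum_rep Rs) g)"
  and rdim_direct_sum_Cons: "rdim (direct_sum_rep (R # Rs)) = rdim R + rdim (direct_sum_rep Rs)"
  by (simp_all add: direct_sum_rep_def diag2_def Let_def)

text \<open>Limits are taken block by block, and \<open>diag2_mult\<close> plays the part that the
  mixed-product rule plays for tensor products.\<close>

lemma zero_weight_part_direct_sum_Cons:
  assumes R: "zero_weight_part n R R0" and S: "zero_weight_part n (direct_sum_rep Rs) (direct_sum_rep R0s)"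
  shows "zero_weight_part n (direct_sum_rep (R # Rs)) (direct_sum_rep (R0 # R0s))"
proof -
  define S S0 where "S = direct_sum_rep Rs" and "S0 = direct_sum_rep R0s"
  let ?N = "rdim R" and ?M = "rdim S" and ?K = "rdim R0" and ?L = "rdim S0"
  from R obtain E F where
    Rc: "\<And>g. g \<in> carrier (GL (Suc n)) \<Longrightarrow> act R g \<in> carrier_mat ?N ?N"
    and E: "E \<in> carrier_mat ?N ?K" and F: "F \<in> carrier_mat ?K ?N" and FE: "F * E = 1\<^sub>m ?K"
    and Rlim: "\<And>i j. i < ?N \<Longrightarrow> j < ?N \<Longrightarrow> ((\<lambda>t. act R (emb (1\<^sub>m n) t) $$ (i, j)) \<longlongrightarrow> (E * F) $$ (i, j)) (at 0)"
    and Rcomm: "\<And>g. g \<in> carrier (GL n) \<Longrightarrow> (E * F) * act R (emb g 1) = act R (emb g 1) * (E * F)"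
    and R0: "\<And>g. g \<in> carrier (GL n) \<Longrightarrow> act R0 g = F * act R (emb g 1) * E"
    unfolding zero_weight_part_def by blast
  from S[folded S_def S0_def] obtain E' F' where
    Sc: "\<And>g. g \<in> carrier (GL (Suc n)) \<Longrightarrow> act S g \<in> carrier_mat ?M ?M"
    and E': "E' \<in> carrier_mat ?M ?L" and F': "F' \<in> carrier_mat ?L ?M" and FE': "F' * E' = 1\<^sub>m ?L"
    and Slim: "\<And>i j. i < ?M \<Longrightarrow> j < ?M \<Longrightarrow> ((\<lambda>t. act S (emb (1\<^sub>m n) t) $$ (i, j)) \<longlongrightarrow> (E' * F') $$ (i, j)) (at 0)"
    and Scomm: "\<And>g. g \<in> carrier (GL n) \<Longrightarrow> (E' * F') * act S (emb g 1) = act S (emb g 1) * (E' * F')"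
    and S0: "\<And>g. g \<in> carrier (GL n) \<Longrightarrow> act S0 g = F' * act S (emb g 1) * E'"
    unfolding zero_weight_part_def by blast
  have EF: "E * F \<in> carrier_mat ?N ?N" and EF': "E' * F' \<in> carrier_mat ?M ?M" using E F E' F' by auto
  have kEF: "diag2 E E' * diag2 F F' = diag2 (E * F) (E' * F')"
    by (rule diag2_mult[OF E E' F F', symmetric])
  show ?thesis
  proof (rule zero_weight_partI[of n "direct_sum_rep (R # Rs)" "diag2 E E'" "direct_sum_rep (R0 # R0s)" "diag2 F F'",
        unfolded act_direct_sum_Cons rdim_direct_sum_Cons, folded S_def S0_def])
    show "diag2 F F' * diag2 E E' = 1\<^sub>m (?K + ?L)"
      using diag2_mult[OF F F' E E'] by (simp add: FE FE' diag2_one)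
  next
    fix i j assume ij: "i < ?N + ?M" "j < ?N + ?M"
    let ?d = "\<lambda>A B. if i < ?N then if j < ?N then A $$ (i, j) else 0
       else if j < ?N then 0 else B $$ (i - ?N, j - ?N) :: complex"
    have "((\<lambda>t. ?d (act R (emb (1\<^sub>m n) t)) (act S (emb (1\<^sub>m n) t))) \<longlongrightarrow> ?d (E * F) (E' * F')) (at 0)"
      using ij Rlim[of i j] Slim[of "i - ?N" "j - ?N"] 
      by (cases "i < ?N"; cases "j < ?N") (simp_all del: index_mult_mat)
    then have lim: "((\<lambda>t. ?d (act R (emb (1\<^sub>m n) t)) (act S (emb (1\<^sub>m n) t))) \<longlongrightarrow>
        (diag2 E E' * diag2 F F') $$ (i, j)) (at 0)"
      by (simp only: kEF diag2_index[OF EF EF' ij])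
    have "?d (act R (emb (1\<^sub>m n) t)) (act S (emb (1\<^sub>m n) t)) =
        diag2 (act R (emb (1\<^sub>m n) t)) (act S (emb (1\<^sub>m n) t)) $$ (i, j)" if "t \<noteq> 0" for t
      using diag2_index[OF Rc[OF emb_one_GL[OF that]] Sc[OF emb_one_GL[OF that]] ij] by simp
    then show "((\<lambda>t. diag2 (act R (emb (1\<^sub>m n) t)) (act S (emb (1\<^sub>m n) t)) $$ (i, j)) \<longlongrightarrow>
        (diag2 E E' * diag2 F F') $$ (i, j)) (at 0)"
      by (intro Lim_transform_eventually[OF lim]) (simp add: eventually_at_filter)
  next
    fix g assume g: "g \<in> carrier (GL n)"
    note Rg = Rc[OF emb_GL[OF g one_neq_zero]] and Sg = Sc[OF emb_GL[OF g one_neq_zero]]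
    show "diag2 E E' * diag2 F F' * diag2 (act R (emb g 1)) (act S (emb g 1)) =
        diag2 (act R (emb g 1)) (act S (emb g 1)) * (diag2 E E' * diag2 F F')"
      unfolding kEF using diag2_mult[OF EF EF' Rg Sg] diag2_mult[OF Rg Sg EF EF']
      by (simp add: Rcomm g Scomm)
    have FR: "F * act R (emb g 1) \<in> carrier_mat ?K ?N" and FS: "F' * act S (emb g 1) \<in> carrier_mat ?L ?M"
      using F F' Rg Sg by auto
    show "diag2 (act R0 g) (act S0 g) =
        diag2 F F' * diag2 (act R (emb g 1)) (act S (emb g 1)) * diag2 E E'"
      using diag2_mult[OF FR FS E E'] diag2_mult[OF F F' Rg Sg] by (simp add: R0 S0 g)
  qed (use Rc Sc E E' F F' in \<open>auto intro!: diag2_carrier\<close>)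
qed

lemma zero_weight_part_direct_sum:
  "list_all2 (zero_weight_part n) Rs R0s \<Longrightarrow> zero_weight_part n (direct_sum_rep Rs) (direct_sum_rep R0s)"
proof (induction rule: list_all2_induct)
  case Nil
  show ?case unfolding zero_weight_part_def
    by (intro conjI exI[of _ "0\<^sub>m 0 0"]) (auto simp: direct_sum_rep_def)
next
  case (Cons R Rs R0 R0s)
  then show ?case by (intro zero_weight_part_direct_sum_Cons)
qed

text \<open>An equivalence P intertwines the two actions of diag(1, ..., 1, t), hence their limits p
  and q. It therefore maps the image of p isomorphically onto the image of q, and X is this
  restriction in coordinates.\<close>

lemma zero_weight_part_equiv:
  assumes eq: "rep_equiv (Suc n) R S" and R: "zero_weight_part n R R0" and S: "zero_weight_part n S S0"
  shows "rep_equiv n R0 S0"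
proof -
  let ?N = "rdim R" and ?K = "rdim R0" and ?L = "rdim S0"
  from eq obtain P where dim: "rdim S = ?N" and PG: "P \<in> carrier (GL ?N)"
    and P: "\<And>g. g \<in> carrier (GL (Suc n)) \<Longrightarrow> P * act R g = act S g * P"
    unfolding rep_equiv_def by auto
  obtain Q where QG: "Q \<in> carrier (GL ?N)" and PQ: "P * Q = 1\<^sub>m ?N" and QP: "Q * P = 1\<^sub>m ?N"
    using GL_inverse[OF PG] by blast
  have Pc: "P \<in> carrier_mat ?N ?N" and Qc: "Q \<in> carrier_mat ?N ?N" using PG QG by (auto simp: carrier_GL_iff)
  from R obtain E F where
    Rc: "\<And>g. g \<in> carrier (GL (Suc n)) \<Longrightarrow> act R g \<in> carrier_mat ?N ?N"
    and E: "E \<in> carrier_mat ?N ?K" and F: "F \<in> carrier_mat ?K ?N" and FE: "F * E = 1\<^sub>m ?K"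
    and Rlim: "\<And>i j. i < ?N \<Longrightarrow> j < ?N \<Longrightarrow> ((\<lambda>t. act R (emb (1\<^sub>m n) t) $$ (i, j)) \<longlongrightarrow> (E * F) $$ (i, j)) (at 0)"
    and Rcomm: "\<And>g. g \<in> carrier (GL n) \<Longrightarrow> (E * F) * act R (emb g 1) = act R (emb g 1) * (E * F)"
    and R0: "\<And>g. g \<in> carrier (GL n) \<Longrightarrow> act R0 g = F * act R (emb g 1) * E"
    unfolding zero_weight_part_def by blast
  from S obtain E' F' where
    Sc: "\<And>g. g \<in> carrier (GL (Suc n)) \<Longrightarrow> act S g \<in> carrier_mat ?N ?N"
    and E': "E' \<in> carrier_mat ?N ?L" and F': "F' \<in> carrier_mat ?L ?N" and FE': "F' * E' = 1\<^sub>m ?L"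
    and Slim: "\<And>i j. i < ?N \<Longrightarrow> j < ?N \<Longrightarrow> ((\<lambda>t. act S (emb (1\<^sub>m n) t) $$ (i, j)) \<longlongrightarrow> (E' * F') $$ (i, j)) (at 0)"
    and Scomm: "\<And>g. g \<in> carrier (GL n) \<Longrightarrow> (E' * F') * act S (emb g 1) = act S (emb g 1) * (E' * F')"
    and S0: "\<And>g. g \<in> carrier (GL n) \<Longrightarrow> act S0 g = F' * act S (emb g 1) * E'"
    unfolding zero_weight_part_def dim by blast
  define p q where "p = E * F" and "q = E' * F'"
  have pc: "p \<in> carrier_mat ?N ?N" and qc: "q \<in> carrier_mat ?N ?N" using E F E' F' by (auto simp: p_def q_def)
  \<comment> \<open>Each entry of a product is a finite sum, so the intertwining relation passes to
    the limit entry by entry.\<close>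
  have Pp: "P * p = q * P"
  proof (intro eq_matI)
    fix i j assume "i < dim_row (q * P)" "j < dim_col (q * P)"
    then have ij: "i < ?N" "j < ?N" using qc Pc by auto
    have mult: "(A * B) $$ (i, j) = (\<Sum>l = 0..<?N. A $$ (i, l) * B $$ (l, j))"
      if "A \<in> carrier_mat ?N ?N" "B \<in> carrier_mat ?N ?N" for A B :: "complex mat"
      using that ij by (simp add: scalar_prod_def)
    have "((\<lambda>t. \<Sum>l = 0..<?N. P $$ (i, l) * act R (emb (1\<^sub>m n) t) $$ (l, j)) \<longlongrightarrow>
        (\<Sum>l = 0..<?N. P $$ (i, l) * (E * F) $$ (l, j))) (at 0)"
      by (intro tendsto_sum tendsto_mult tendsto_const Rlim ij) auto
    then have l1: "((\<lambda>t. \<Sum>l = 0..<?N. P $$ (i, l) * act R (emb (1\<^sub>m n) t) $$ (l, j)) \<longlongrightarrow> (P * p) $$ (i, j)) (at 0)"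
      by (simp only: p_def[symmetric] mult[OF Pc pc])
    have "((\<lambda>t. \<Sum>l = 0..<?N. act S (emb (1\<^sub>m n) t) $$ (i, l) * P $$ (l, j)) \<longlongrightarrow>
        (\<Sum>l = 0..<?N. (E' * F') $$ (i, l) * P $$ (l, j))) (at 0)"
      by (intro tendsto_sum tendsto_mult tendsto_const Slim ij) auto
    then have l2: "((\<lambda>t. \<Sum>l = 0..<?N. act S (emb (1\<^sub>m n) t) $$ (i, l) * P $$ (l, j)) \<longlongrightarrow> (q * P) $$ (i, j)) (at 0)"
      by (simp only: q_def[symmetric] mult[OF qc Pc])
    have "(\<Sum>l = 0..<?N. P $$ (i, l) * act R (emb (1\<^sub>m n) t) $$ (l, j)) =
        (\<Sum>l = 0..<?N. act S (emb (1\<^sub>m n) t) $$ (i, l) * P $$ (l, j))" if "t \<noteq> 0" for t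
      using P[OF emb_one_GL[OF that]] mult[OF Pc Rc[OF emb_one_GL[OF that]]]
        mult[OF Sc[OF emb_one_GL[OF that]] Pc] by simp
    then have "((\<lambda>t. \<Sum>l = 0..<?N. act S (emb (1\<^sub>m n) t) $$ (i, l) * P $$ (l, j)) \<longlongrightarrow> (P * p) $$ (i, j)) (at 0)"
      by (intro Lim_transform_eventually[OF l1]) (simp add: eventually_at_filter)
    from tendsto_unique[OF _ this l2] show "(P * p) $$ (i, j) = (q * P) $$ (i, j)" by simp
  qed (use pc qc Pc in auto)
  define X Y where "X = F' * P * E" and "Y = F * Q * E'"
  have X: "X \<in> carrier_mat ?L ?K" and Y: "Y \<in> carrier_mat ?K ?L" 
    using E F E' F' Pc Qc by (auto simp: X_def Y_def)
  have Xv: "X *\<^sub>v x = F' *\<^sub>v (P *\<^sub>v (E *\<^sub>v x))" if "x \<in> carrier_vec ?K" for x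
    unfolding X_def by (rule mult3_mat_vec[OF F' Pc E that])
  have Yv: "Y *\<^sub>v x = F *\<^sub>v (Q *\<^sub>v (E' *\<^sub>v x))" if "x \<in> carrier_vec ?L" for x
    unfolding Y_def by (rule mult3_mat_vec[OF F Qc E' that])
  have pv: "p *\<^sub>v x = E *\<^sub>v (F *\<^sub>v x)" and qv: "q *\<^sub>v x = E' *\<^sub>v (F' *\<^sub>v x)" if "x \<in> carrier_vec ?N" for x
    using that E F E' F' by (auto simp: p_def q_def)
  have FEv: "F *\<^sub>v (E *\<^sub>v x) = x" if "x \<in> carrier_vec ?K" for x
    using assoc_mult_mat_vec[OF F E that] that by (simp add: FE)
  have FEv': "F' *\<^sub>v (E' *\<^sub>v x) = x" if "x \<in> carrier_vec ?L" for x
    using assoc_mult_mat_vec[OF F' E' that] that by (simp add: FE')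
  have PQv: "P *\<^sub>v (Q *\<^sub>v x) = x" and QPv: "Q *\<^sub>v (P *\<^sub>v x) = x" if "x \<in> carrier_vec ?N" for x
    using assoc_mult_mat_vec[OF Pc Qc that] assoc_mult_mat_vec[OF Qc Pc that] that by (simp_all add: PQ QP)
  have Ppv: "P *\<^sub>v (p *\<^sub>v x) = q *\<^sub>v (P *\<^sub>v x)" if "x \<in> carrier_vec ?N" for x
    using assoc_mult_mat_vec[OF Pc pc that] assoc_mult_mat_vec[OF qc Pc that] by (simp add: Pp)
  have Qqv: "Q *\<^sub>v (q *\<^sub>v x) = p *\<^sub>v (Q *\<^sub>v x)" if x: "x \<in> carrier_vec ?N" for x
  proof -
    have "Q *\<^sub>v (q *\<^sub>v x) = Q *\<^sub>v (q *\<^sub>v (P *\<^sub>v (Q *\<^sub>v x)))" by (simp add: PQv x)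
    also have "\<dots> = Q *\<^sub>v (P *\<^sub>v (p *\<^sub>v (Q *\<^sub>v x)))" using Qc x by (subst Ppv) auto
    also have "\<dots> = p *\<^sub>v (Q *\<^sub>v x)" using Qc pc x by (intro QPv) auto
    finally show ?thesis .
  qed
  have vc: "E *\<^sub>v x \<in> carrier_vec ?N" if "x \<in> carrier_vec ?K" for x using that E by auto
  have vc': "E' *\<^sub>v x \<in> carrier_vec ?N" if "x \<in> carrier_vec ?L" for x using that E' by auto
  have pE: "p *\<^sub>v (E *\<^sub>v x) = E *\<^sub>v x" if "x \<in> carrier_vec ?K" for x
    using that by (simp add: pv vc FEv)
  have qE: "q *\<^sub>v (E' *\<^sub>v x) = E' *\<^sub>v x" if "x \<in> carrier_vec ?L" for x
    using that by (simp add: qv vc' FEv')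
  have Pv: "P *\<^sub>v x \<in> carrier_vec ?N" and Qv: "Q *\<^sub>v x \<in> carrier_vec ?N" if "x \<in> carrier_vec ?N" for x
    using that Pc Qc by auto
  \<comment> \<open>As P maps the image of p into the image of q, the projection
    \<open>E' * F'\<close> hidden in \<open>E' *\<^sub>v (X *\<^sub>v x)\<close> acts as the
    identity.\<close>
  have E'X: "E' *\<^sub>v (X *\<^sub>v x) = P *\<^sub>v (E *\<^sub>v x)" if x: "x \<in> carrier_vec ?K" for x
    using x Ppv[OF vc[OF x]] by (simp add: Xv qv[symmetric] Pv vc pE)
  have EY: "E *\<^sub>v (Y *\<^sub>v x) = Q *\<^sub>v (E' *\<^sub>v x)" if x: "x \<in> carrier_vec ?L" for x
    using x Qqv[OF vc'[OF x]] by (simp add: Yv pv[symmetric] Qv vc' qE)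
  have Xc: "X *\<^sub>v x \<in> carrier_vec ?L" if "x \<in> carrier_vec ?K" for x using X that by auto
  have Yc: "Y *\<^sub>v x \<in> carrier_vec ?K" if "x \<in> carrier_vec ?L" for x using Y that by auto
  have XY: "X * Y = 1\<^sub>m ?L"
  proof (rule mat_eq_by_vec)
    fix x :: "complex vec" assume x: "x \<in> carrier_vec ?L"
    have "X *\<^sub>v (Y *\<^sub>v x) = F' *\<^sub>v (P *\<^sub>v (E *\<^sub>v (Y *\<^sub>v x)))" by (rule Xv[OF Yc[OF x]])
    also have "\<dots> = x" using x by (simp add: EY PQv vc' FEv')
    finally show "(X * Y) *\<^sub>v x = 1\<^sub>m ?L *\<^sub>v x" using X Y x by simp
  qed (use X Y in auto)
  have YX: "Y * X = 1\<^sub>m ?K"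
  proof (rule mat_eq_by_vec)
    fix x :: "complex vec" assume x: "x \<in> carrier_vec ?K"
    have "Y *\<^sub>v (X *\<^sub>v x) = F *\<^sub>v (Q *\<^sub>v (E' *\<^sub>v (X *\<^sub>v x)))" by (rule Yv[OF Xc[OF x]])
    also have "\<dots> = x" using x by (simp add: E'X QPv vc FEv)
    finally show "(Y * X) *\<^sub>v x = 1\<^sub>m ?K *\<^sub>v x" using X Y x by simp
  qed (use X Y in auto)
  have KL: "?L = ?K" using left_right_inverse_dim_eq[OF X Y YX XY] .
  have "X \<in> carrier (GL ?K)" using X Y XY KL by (intro carrier_GLI[of _ _ Y]) auto
  moreover have "X * act R0 g = act S0 g * X" if g: "g \<in> carrier (GL n)" for g
  proof (rule mat_eq_by_vec)
    note Rg = Rc[OF emb_GL[OF g one_neq_zero]] and Sg = Sc[OF emb_GL[OF g one_neq_zero]]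
    have R0c: "act R0 g \<in> carrier_mat ?K ?K" and S0c: "act S0 g \<in> carrier_mat ?L ?L"
      using F Rg E F' Sg E' by (auto simp: R0 S0 g)
    show "X * act R0 g \<in> carrier_mat ?L ?K" "act S0 g * X \<in> carrier_mat ?L ?K" using X R0c S0c by auto
    fix x :: "complex vec" assume x: "x \<in> carrier_vec ?K"
    let ?y = "E *\<^sub>v x"
    note y = vc[OF x]
    have Ry: "act R (emb g 1) *\<^sub>v ?y \<in> carrier_vec ?N" using Rg y by auto
    have "p *\<^sub>v (act R (emb g 1) *\<^sub>v ?y) = act R (emb g 1) *\<^sub>v ?y"
      using assoc_mult_mat_vec[OF pc Rg y] assoc_mult_mat_vec[OF Rg pc y] Rcomm[OF g]
      by (simp add: p_def[symmetric] pE x)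
    then have "E *\<^sub>v (act R0 g *\<^sub>v x) = act R (emb g 1) *\<^sub>v ?y"
      using mult3_mat_vec[OF F Rg E x] pv[OF Ry] by (simp add: R0 g)
    then have "X *\<^sub>v (act R0 g *\<^sub>v x) = F' *\<^sub>v (P *\<^sub>v (act R (emb g 1) *\<^sub>v ?y))"
      using x R0c by (simp add: Xv)
    also have "P *\<^sub>v (act R (emb g 1) *\<^sub>v ?y) = act S (emb g 1) *\<^sub>v (P *\<^sub>v ?y)"
      using assoc_mult_mat_vec[OF Pc Rg y] assoc_mult_mat_vec[OF Sg Pc y] P[OF emb_GL[OF g one_neq_zero]] by simp
    also have "F' *\<^sub>v (act S (emb g 1) *\<^sub>v (P *\<^sub>v ?y)) = act S0 g *\<^sub>v (X *\<^sub>v x)"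
      using mult3_mat_vec[OF F' Sg E' Xc[OF x]] by (simp add: S0 g E'X x)
    finally show "(X * act R0 g) *\<^sub>v x = (act S0 g * X) *\<^sub>v x"
      using assoc_mult_mat_vec[OF X R0c x] assoc_mult_mat_vec[OF S0c X x] by simp
  qed
  ultimately show ?thesis using KL unfolding rep_equiv_def by auto
qed

section \<open>Composing equivalences and changing models\<close>

lemma rep_equiv_trans:
  assumes RS: "rep_equiv m R S" and ST: "rep_equiv m S T"
    and R: "\<And>g. g \<in> carrier (GL m) \<Longrightarrow> act R g \<in> carrier_mat (rdim R) (rdim R)"
    and S: "\<And>g. g \<in> carrier (GL m) \<Longrightarrow> act S g \<in> carrier_mat (rdim S) (rdim S)"
    and T: "\<And>g. g \<in> carrier (GL m) \<Longrightarrow> act T g \<in> carrier_mat (rdim T) (rdim T)"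
  shows "rep_equiv m R T"
proof -
  let ?N = "rdim R"
  from RS obtain P where dS: "rdim S = ?N" and PG: "P \<in> carrier (GL ?N)"
    and P: "\<And>g. g \<in> carrier (GL m) \<Longrightarrow> P * act R g = act S g * P"
    unfolding rep_equiv_def by auto
  from ST obtain Q where dT: "rdim T = ?N" and QG: "Q \<in> carrier (GL ?N)"
    and Q: "\<And>g. g \<in> carrier (GL m) \<Longrightarrow> Q * act S g = act T g * Q"
    unfolding rep_equiv_def dS by auto
  have Pc: "P \<in> carrier_mat ?N ?N" and Qc: "Q \<in> carrier_mat ?N ?N" using PG QG by (auto simp: carrier_GL_iff)
  have "(Q * P) * act R g = act T g * (Q * P)" if g: "g \<in> carrier (GL m)" for g
  proof -
    note Rg = R[OF g] and Sg = S[OF g, unfolded dS] and Tg = T[OF g, unfolded dT]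
    have "(Q * P) * act R g = Q * (act S g * P)" using assoc_mult_mat[OF Qc Pc Rg] P[OF g] by simp
    also have "\<dots> = (act T g * Q) * P" using assoc_mult_mat[OF Qc Sg Pc] Q[OF g] by simp
    also have "\<dots> = act T g * (Q * P)" by (rule assoc_mult_mat[OF Tg Qc Pc])
    finally show ?thesis .
  qed
  then show ?thesis using mult_in_GL[OF QG PG] dT unfolding rep_equiv_def by auto
qed

text \<open>The Kronecker product of the two equivalences is an equivalence, with the Kronecker
  product of their inverses as inverse.\<close>

lemma rep_equiv_tensor:
  assumes eR: "rep_equiv m R R'" and eS: "rep_equiv m S S'"
    and R: "is_rep m R" and R': "is_rep m R'" and S: "is_rep m S" and S': "is_rep m S'"
  shows "rep_equiv m (tensor_rep R S) (tensor_rep R' S')"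
proof -
  let ?N = "rdim R" and ?M = "rdim S"
  from eR obtain P where dR: "rdim R' = ?N" and PG: "P \<in> carrier (GL ?N)"
    and P: "\<And>g. g \<in> carrier (GL m) \<Longrightarrow> P * act R g = act R' g * P"
    unfolding rep_equiv_def by auto
  from eS obtain Q where dS: "rdim S' = ?M" and QG: "Q \<in> carrier (GL ?M)"
    and Q: "\<And>g. g \<in> carrier (GL m) \<Longrightarrow> Q * act S g = act S' g * Q"
    unfolding rep_equiv_def by auto
  obtain P' Q' where PG': "P' \<in> carrier (GL ?N)" and PP': "P * P' = 1\<^sub>m ?N"
    and QG': "Q' \<in> carrier (GL ?M)" and QQ': "Q * Q' = 1\<^sub>m ?M"
    using GL_inverse[OF PG] GL_inverse[OF QG] by metis
  have c: "P \<in> carrier_mat ?N ?N" "Q \<in> carrier_mat ?M ?M" "P' \<in> carrier_mat ?N ?N" "Q' \<in> carrier_mat ?M ?M"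
    using PG QG PG' QG' by (auto simp: carrier_GL_iff)
  have "kronecker P Q * kronecker P' Q' = 1\<^sub>m (?N * ?M)"
    using kronecker_mult[OF c] by (simp add: PP' QQ' kronecker_one)
  then have "kronecker P Q \<in> carrier (GL (?N * ?M))"
    using kronecker_carrier[OF c(1,2)] kronecker_carrier[OF c(3,4)] by (intro carrier_GLI)
  moreover have "kronecker P Q * kronecker (act R g) (act S g) = kronecker (act R' g) (act S' g) * kronecker P Q"
    if g: "g \<in> carrier (GL m)" for g
    using kronecker_mult[OF c(1,2) rep_carrier[OF R g] rep_carrier[OF S g]]
      kronecker_mult[OF rep_carrier[OF R' g, unfolded dR] rep_carrier[OF S' g, unfolded dS] c(1,2)]
    by (simp add: P Q g)
  ultimately show ?thesis unfolding rep_equiv_def act_tensor rdim_tensor dR dS by auto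
qed

lemma tensor_carrier:
  "is_rep m R \<Longrightarrow> is_rep m S \<Longrightarrow> g \<in> carrier (GL m) \<Longrightarrow>
     act (tensor_rep R S) g \<in> carrier_mat (rdim (tensor_rep R S)) (rdim (tensor_rep R S))"
  unfolding act_tensor rdim_tensor by (intro kronecker_carrier rep_carrier)

lemma direct_sum_carrier:
  "(\<And>R. R \<in> set Rs \<Longrightarrow> is_rep m R) \<Longrightarrow> g \<in> carrier (GL m) \<Longrightarrow>
     act (direct_sum_rep Rs) g \<in> carrier_mat (rdim (direct_sum_rep Rs)) (rdim (direct_sum_rep Rs))"
proof (induction Rs)
  case Nil
  then show ?case by (simp add: direct_sum_rep_def)
next
  case (Cons R Rs)
  then show ?case unfolding act_direct_sum_Cons rdim_direct_sum_Cons
    by (intro diag2_carrier[OF rep_carrier[of m]]) auto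
qed

text \<open>List position n is the entry numbered n + 1. If it were nonzero, \<open>Suc n\<close>
  would belong to the set whose maximum is the length.\<close>

lemma weight_length_le_imp_last_zero:
  assumes "length \<nu> = Suc n" "weight_length \<nu> \<le> n"
  shows "\<nu> ! n = 0"
proof (rule ccontr)
  let ?S = "{s. 1 \<le> s \<and> s \<le> length \<nu> \<and> \<nu> ! (s - 1) \<noteq> 0}"
  assume "\<nu> ! n \<noteq> 0"
  then have "Suc n \<in> insert 0 ?S" using assms by simp
  moreover have "finite ?S" by (rule finite_subset[of _ "{..length \<nu>}"]) auto
  ultimately have "Suc n \<le> weight_length \<nu>" unfolding weight_length_def by (intro Max_ge) auto
  with assms show False by simp
qed

text \<open>On weights ending in 0, dropping the last entry is injective with appending 0 as
  inverse, so multiplicities do not merge.\<close>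

lemma count_list_map_take:
  assumes "\<And>x. x \<in> set L \<Longrightarrow> length x = Suc n \<and> x ! n = (0 :: int)"
  shows "count_list (map (take n) L) y = count_list L (y @ [0])"
  using assms
proof (induction L)
  case (Cons x L)
  have "length x = Suc n" "x ! n = 0" using Cons.prems by auto
  then have x: "x = take n x @ [0]" by (metis lessI order_refl take_Suc_conv_app_nth take_all)
  then have "take n x = y \<longleftrightarrow> x = y @ [0]" by (metis butlast_snoc)
  then show ?case using Cons by simp
qed simp

lemma irrep_hw_rep: "is_irrep_hw m \<nu> R \<Longrightarrow> is_rep m R"
  by (simp add: is_irrep_hw_def irreducible_is_rep)

theorem theorem3p1:
  fixes n :: nat
    and lam mu :: "int list"
    and C :: "int list \<Rightarrow> nat"
    and Psi_lam Psi_mu Psi_lam' Psi_mu' :: rep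
  assumes "dominant (n + 1) lam" and "\<forall>x \<in> set lam. 0 \<le> x"
    and "dominant (n + 1) mu" and "\<forall>x \<in> set mu. 0 \<le> x"
    and "is_irrep_hw (n + 1) lam Psi_lam"
    and "is_irrep_hw (n + 1) mu Psi_mu"
    and "weight_length lam \<le> n"
    and "weight_length mu \<le> n"
    and "decomposes_as (n + 1) (tensor_rep Psi_lam Psi_mu) C"
    and "\<forall>\<nu>. C \<nu> \<noteq> 0 \<longrightarrow> weight_length \<nu> \<le> n"
    and "is_irrep_hw n (take n lam) Psi_lam'"
    and "is_irrep_hw n (take n mu) Psi_mu'"
  shows "decomposes_as n (tensor_rep Psi_lam' Psi_mu') (\<lambda>\<nu>. C (\<nu> @ [0]))"
proof -
  have Suc: "n + 1 = Suc n" by simp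
  note a = assms[unfolded Suc]
  have "lam ! n = 0" "mu ! n = 0"
    using a(1,3,7,8) by (auto intro: weight_length_le_imp_last_zero simp: dominant_def)
  then obtain R0 S0 where R0: "is_irrep_hw n (take n lam) R0" "zero_weight_part n Psi_lam R0"
    and S0: "is_irrep_hw n (take n mu) S0" "zero_weight_part n Psi_mu S0"
    using irrep_hw_zero_weight_part a(5,6) by meson
  from a(9) obtain Xs where irr: "\<And>x. x \<in> set Xs \<Longrightarrow> is_irrep_hw (Suc n) (fst x) (snd x)"
    and count: "\<And>\<nu>. count_list (map fst Xs) \<nu> = C \<nu>"
    and eq: "rep_equiv (Suc n) (tensor_rep Psi_lam Psi_mu) (direct_sum_rep (map snd Xs))"
    unfolding decomposes_as_def by fastforce
  have last: "length (fst x) = Suc n \<and> fst x ! n = 0" if x: "x \<in> set Xs" for x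
  proof -
    \<comment> \<open>A weight listed in \<open>Xs\<close> occurs with positive multiplicity, so the
      assumption on the support of C applies to it.\<close>
    have "count_list (map fst Xs) (fst x) \<noteq> 0" using x by (simp add: count_list_0_iff)
    then have "weight_length (fst x) \<le> n" using a(10) by (simp add: count)
    moreover have "length (fst x) = Suc n" using irr[OF x] by (simp add: is_irrep_hw_def dominant_def)
    ultimately show ?thesis by (simp add: weight_length_le_imp_last_zero)
  qed
  then have "\<forall>x \<in> set Xs. \<exists>T. is_irrep_hw n (take n (fst x)) T \<and> zero_weight_part n (snd x) T"
    using irrep_hw_zero_weight_part irr by blast
  then obtain f where f: "\<And>x. x \<in> set Xs \<Longrightarrow> is_irrep_hw n (take n (fst x)) (f x)"
    "\<And>x. x \<in> set Xs \<Longrightarrow> zero_weight_part n (snd x) (f x)"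
    by (metis bchoice)
  \<comment> \<open>The given decomposition restricted to the image of the limit of diag(1, ..., 1,
    t) on both sides.\<close>
  have e1: "rep_equiv n (tensor_rep R0 S0) (direct_sum_rep (map f Xs))"
  proof (rule zero_weight_part_equiv[OF eq])
    show "zero_weight_part n (tensor_rep Psi_lam Psi_mu) (tensor_rep R0 S0)"
      by (rule zero_weight_part_tensor[OF R0(2) S0(2)])
    show "zero_weight_part n (direct_sum_rep (map snd Xs)) (direct_sum_rep (map f Xs))"
      using f(2) by (intro zero_weight_part_direct_sum) (simp add: list.rel_map list.rel_refl_strong)
  qed
  \<comment> \<open>\<open>R0\<close> and \<open>S0\<close> are particular models with the truncated
    highest weights; uniqueness exchanges them for the given ones.\<close>
  have e2: "rep_equiv n (tensor_rep Psi_lam' Psi_mu') (tensor_rep R0 S0)"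
    by (intro rep_equiv_tensor is_irrep_hw_equiv[OF a(11) R0(1)] is_irrep_hw_equiv[OF a(12) S0(1)]
        irrep_hw_rep[OF a(11)] irrep_hw_rep[OF a(12)] irrep_hw_rep[OF R0(1)] irrep_hw_rep[OF S0(1)])
  have fR: "is_rep n T" if "T \<in> set (map f Xs)" for T
  proof -
    from that[unfolded set_map] obtain x where "T = f x" "x \<in> set Xs" by (rule imageE)
    then show ?thesis using irrep_hw_rep[OF f(1)] by simp
  qed
  have eq': "rep_equiv n (tensor_rep Psi_lam' Psi_mu') (direct_sum_rep (map f Xs))"
    by (rule rep_equiv_trans[OF e2 e1 tensor_carrier[OF irrep_hw_rep[OF a(11)] irrep_hw_rep[OF a(12)]]
        tensor_carrier[OF irrep_hw_rep[OF R0(1)] irrep_hw_rep[OF S0(1)]] direct_sum_carrier[OF fR]])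
  define Ys where "Ys = map (\<lambda>x. (take n (fst x), f x)) Xs"
  have last_fst: "length \<nu> = Suc n \<and> \<nu> ! n = 0" if "\<nu> \<in> set (map fst Xs)" for \<nu>
  proof -
    from that[unfolded set_map] obtain x where "\<nu> = fst x" "x \<in> set Xs" by (rule imageE)
    then show ?thesis using last by simp
  qed
  have "count_list (map fst Ys) \<nu> = C (\<nu> @ [0])" for \<nu>
    using count_list_map_take[of "map fst Xs" n \<nu>, OF last_fst] by (simp add: Ys_def comp_def count)
  moreover have "is_irrep_hw n (fst y) (snd y)" if "y \<in> set Ys" for y
  proof -
    from that[unfolded Ys_def set_map] obtain x where "y = (take n (fst x), f x)" "x \<in> set Xs"
      by (rule imageE)
    then show ?thesis using f(1) by simp
  qed
  moreover have "map snd Ys = map f Xs" by (simp add: Ys_def comp_def)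
  ultimately show ?thesis unfolding decomposes_as_def using eq'
    by (intro exI[of _ Ys]) (simp add: case_prod_beta)
qed

end
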